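(* Let $G$ be a second-countable locally compact group which contains an amenable closed normal subgroup $N \neq \{1\}$. Then $G$ is not C$^*$-simple.
   Context: A unitary representation of a topological group $G$ in a nonzero complex Hilbert space $\mathcal H$ is a homomorphism $\rho$ from $G$ to the unitary group $\mathcal U(\mathcal H)$ such that the map $G\times\mathcal H\to\mathcal H$, $(g,\xi)\mapsto\rho(g)\xi$, is continuous. For $\xi\in\mathcal H$, the corresponding diagonal matrix coefficient of $\rho$ is the function $G\to\mathbf C$, $g\mapsto\langle\xi\mid\rho(g)\xi\rangle$. Given two unitary representations $\rho,\sigma$ of $G$, $\rho$ is weakly contained in $\sigma$, written $\rho\prec\sigma$, if every diagonal matrix coefficient of $\rho$ is a limit of (finite) sums of diagonal matrix coefficients of $\sigma$, uniformly on compact subsets of $G$. They are weakly equivalent, written $\rho\sim\sigma$, if $\rho\prec\sigma$ and $\sigma\prec\rho$. For $G$ locally compact, $1_G$ denotes the unit representation on $\mathbf C$ ($1_G(g)=\mathrm{id}$ for all $g$), and $\lambda_G$ denotes the left-regular representation on $L^2(G)$ (with respect to a left-invariant Haar measure), $(\lambda_G(g)\xi)(g')=\xi(g^{-1}g')$. A locally compact group $G$ is amenable if $1_G\prec\lambda_G$. It is C$^*$-simple if, for every unitary representation $\rho$ of $G$, the conditions $\rho\prec\lambda_G$ and $\rho\sim\lambda_G$ are equivalent. *)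

theory Defs
  imports "HOL-Analysis.Analysis" "HOL-Algebra.Algebra"
begin

section \<open>Locally compact groups and Haar measure\<close>

locale topological_group = group G for G (structure) +
  fixes T :: "'a topology"
  assumes topspace_eq: "topspace T = carrier G"
    and continuous_mult: "continuous_map (prod_topology T T) T (\<lambda>(x, y). x \<otimes> y)"
    and continuous_inv: "continuous_map T T (\<lambda>x. inv x)"

text \<open>Locally compact groups are Hausdorff by convention.\<close>

locale locally_compact_group = topological_group +
  assumes Hausdorff: "Hausdorff_space T"
    and locally_compact: "locally_compact_space T"

text \<open>A left Haar measure is a nonzero left-invariant Radon measure on the Borel sets.\<close>

definition left_haar_measure ::
    "('a, 'b) monoid_scheme \<Rightarrow> 'a topology \<Rightarrow> 'a measure \<Rightarrow> bool" where
  "left_haar_measure G T \<mu> \<longleftrightarrow>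
     space \<mu> = topspace T \<and>
     sets \<mu> = sigma_sets (topspace T) {U. openin T U} \<and>
     emeasure \<mu> (space \<mu>) \<noteq> 0 \<and>
     (\<forall>K. compactin T K \<longrightarrow> emeasure \<mu> K < \<infinity>) \<and>
     (\<forall>A \<in> sets \<mu>. emeasure \<mu> A = (INF U \<in> {U. openin T U \<and> A \<subseteq> U}. emeasure \<mu> U)) \<and>
     (\<forall>U. openin T U \<longrightarrow>
        emeasure \<mu> U = (SUP K \<in> {K. compactin T K \<and> K \<subseteq> U}. emeasure \<mu> K)) \<and>
     (\<forall>g \<in> carrier G. \<forall>A \<in> sets \<mu>. emeasure \<mu> (g <#\<^bsub>G\<^esub> A) = emeasure \<mu> A)"


section \<open>Complex Hilbert spaces\<close>

definition complex_field :: "complex ring" where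
  "complex_field = \<lparr>carrier = UNIV, monoid.mult = (*), monoid.one = 1,
     ring.zero = 0, ring.add = (+)\<rparr>"

text \<open>
  Hilbert spaces are modules in the sense of HOL-Algebra, with an inner product that is
  antilinear in its first argument.  The fields \<open>mult\<close> and \<open>one\<close>, which the record
  inherits from rings, play no role.
\<close>

record 'h hilbert = "(complex, 'h) module" +
  cinner :: "'h \<Rightarrow> 'h \<Rightarrow> complex"

definition cnorm :: "'h hilbert \<Rightarrow> 'h \<Rightarrow> real" where
  "cnorm H x = sqrt (Re (cinner H x x))"

definition cdist :: "'h hilbert \<Rightarrow> 'h \<Rightarrow> 'h \<Rightarrow> real" where
  "cdist H x y = cnorm H (x \<ominus>\<^bsub>H\<^esub> y)"

abbreviation norm_topology :: "'h hilbert \<Rightarrow> 'h topology" where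
  "norm_topology H \<equiv> Metric_space.mtopology (carrier H) (cdist H)"

locale complex_hilbert_space = module complex_field H for H :: "'h hilbert" (structure) +
  assumes cinner_commute:
      "\<lbrakk>x \<in> carrier H; y \<in> carrier H\<rbrakk> \<Longrightarrow> cinner H x y = cnj (cinner H y x)"
    and cinner_add_right:
      "\<lbrakk>x \<in> carrier H; y \<in> carrier H; z \<in> carrier H\<rbrakk>
        \<Longrightarrow> cinner H x (y \<oplus> z) = cinner H x y + cinner H x z"
    and cinner_smult_right:
      "\<lbrakk>x \<in> carrier H; y \<in> carrier H\<rbrakk> \<Longrightarrow> cinner H x (c \<odot> y) = c * cinner H x y"
    and cinner_nonneg: "x \<in> carrier H \<Longrightarrow> 0 \<le> Re (cinner H x x)"
    and cinner_definite: "\<lbrakk>x \<in> carrier H; cinner H x x = 0\<rbrakk> \<Longrightarrow> x = \<zero>"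
    and complete: "Metric_space.mcomplete (carrier H) (cdist H)"

text \<open>Elements of \<open>Bij\<close> are extensional, so that equality of unitary operators is equality
  on the carrier.\<close>

definition unitary_group :: "'h hilbert \<Rightarrow> ('h \<Rightarrow> 'h) monoid" where
  "unitary_group H = BijGroup (carrier H)
     \<lparr>carrier := {U \<in> Bij (carrier H).
        (\<forall>x \<in> carrier H. \<forall>y \<in> carrier H. U (x \<oplus>\<^bsub>H\<^esub> y) = U x \<oplus>\<^bsub>H\<^esub> U y) \<and>
        (\<forall>c. \<forall>x \<in> carrier H. U (c \<odot>\<^bsub>H\<^esub> x) = c \<odot>\<^bsub>H\<^esub> U x) \<and>
        (\<forall>x \<in> carrier H. \<forall>y \<in> carrier H. cinner H (U x) (U y) = cinner H x y)}\<rparr>"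


section \<open>Unitary representations and weak containment\<close>

record ('a, 'h) representation =
  rep_space :: "'h hilbert"
  rep_map :: "'a \<Rightarrow> 'h \<Rightarrow> 'h"

definition unitary_rep ::
    "('a, 'b) monoid_scheme \<Rightarrow> 'a topology \<Rightarrow> ('a, 'h) representation \<Rightarrow> bool" where
  "unitary_rep G T \<rho> \<longleftrightarrow>
     complex_hilbert_space (rep_space \<rho>) \<and>
     carrier (rep_space \<rho>) \<noteq> {\<zero>\<^bsub>rep_space \<rho>\<^esub>} \<and>
     rep_map \<rho> \<in> hom G (unitary_group (rep_space \<rho>)) \<and>
     continuous_map (prod_topology T (norm_topology (rep_space \<rho>)))
       (norm_topology (rep_space \<rho>)) (\<lambda>(g, \<xi>). rep_map \<rho> g \<xi>)"

definition diag_coeff :: "('a, 'h) representation \<Rightarrow> 'h \<Rightarrow> 'a \<Rightarrow> complex" where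
  "diag_coeff \<rho> \<xi> g = cinner (rep_space \<rho>) \<xi> (rep_map \<rho> g \<xi>)"

definition weakly_contained ::
    "'a topology \<Rightarrow> ('a, 'h) representation \<Rightarrow> ('a, 'k) representation \<Rightarrow> bool" where
  "weakly_contained T \<rho> \<sigma> \<longleftrightarrow>
     (\<forall>\<xi> \<in> carrier (rep_space \<rho>). \<forall>K. compactin T K \<longrightarrow> (\<forall>\<epsilon>>0.
        \<exists>n. \<exists>\<eta> :: nat \<Rightarrow> 'k. (\<forall>i<n. \<eta> i \<in> carrier (rep_space \<sigma>)) \<and>
          (\<forall>g\<in>K. cmod (diag_coeff \<rho> \<xi> g - (\<Sum>i<n. diag_coeff \<sigma> (\<eta> i) g)) < \<epsilon>)))"

definition weakly_equivalent ::
    "'a topology \<Rightarrow> ('a, 'h) representation \<Rightarrow> ('a, 'k) representation \<Rightarrow> bool" where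
  "weakly_equivalent T \<rho> \<sigma> \<longleftrightarrow> weakly_contained T \<rho> \<sigma> \<and> weakly_contained T \<sigma> \<rho>"


section \<open>The unit representation and the left-regular representation\<close>

definition complex_line :: "complex hilbert" where
  "complex_line = \<lparr>carrier = UNIV,
     monoid.mult = undefined, monoid.one = undefined,
     ring.zero = 0, ring.add = (+),
     module.smult = (*), cinner = (\<lambda>z w. cnj z * w)\<rparr>"

definition unit_rep :: "('a, complex) representation" where
  "unit_rep = \<lparr>rep_space = complex_line, rep_map = (\<lambda>g. id)\<rparr>"

definition square_integrable :: "'a measure \<Rightarrow> ('a \<Rightarrow> complex) set" where
  "square_integrable \<mu> =
     {f \<in> borel_measurable \<mu>. integrable \<mu> (\<lambda>x. (cmod (f x))\<^sup>2)}"

definition AE_eq_rel :: "'a measure \<Rightarrow> (('a \<Rightarrow> complex) \<times> ('a \<Rightarrow> complex)) set" where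
  "AE_eq_rel \<mu> =
     {(f, h). f \<in> square_integrable \<mu> \<and> h \<in> square_integrable \<mu> \<and> (AE x in \<mu>. f x = h x)}"

definition L2_class :: "'a measure \<Rightarrow> ('a \<Rightarrow> complex) \<Rightarrow> ('a \<Rightarrow> complex) set" where
  "L2_class \<mu> f = AE_eq_rel \<mu> `` {f}"

definition L2_repr :: "('a \<Rightarrow> complex) set \<Rightarrow> 'a \<Rightarrow> complex" where
  "L2_repr A = (SOME f. f \<in> A)"

definition L2 :: "'a measure \<Rightarrow> ('a \<Rightarrow> complex) set hilbert" where
  "L2 \<mu> = \<lparr>carrier = square_integrable \<mu> // AE_eq_rel \<mu>,
     monoid.mult = undefined, monoid.one = undefined,
     ring.zero = L2_class \<mu> (\<lambda>x. 0),
     ring.add = (\<lambda>A B. L2_class \<mu> (\<lambda>x. L2_repr A x + L2_repr B x)),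
     module.smult = (\<lambda>c A. L2_class \<mu> (\<lambda>x. c * L2_repr A x)),
     cinner = (\<lambda>A B. \<integral>x. cnj (L2_repr A x) * L2_repr B x \<partial>\<mu>)\<rparr>"

definition left_regular_rep ::
    "('a, 'b) monoid_scheme \<Rightarrow> 'a measure \<Rightarrow> ('a, ('a \<Rightarrow> complex) set) representation" where
  "left_regular_rep G \<mu> = \<lparr>rep_space = L2 \<mu>,
     rep_map = (\<lambda>g. \<lambda>A \<in> carrier (L2 \<mu>). L2_class \<mu> (\<lambda>x. L2_repr A (inv\<^bsub>G\<^esub> g \<otimes>\<^bsub>G\<^esub> x)))\<rparr>"


section \<open>Amenability and C*-simplicity\<close>

text \<open>
  Left Haar measures exist and are unique up to a positive factor, so the existential
  quantifier over \<open>\<mu>\<close> just makes a choice, on which the properties do not depend.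
\<close>

definition amenable :: "('a, 'b) monoid_scheme \<Rightarrow> 'a topology \<Rightarrow> bool" where
  "amenable G T \<longleftrightarrow>
     (\<exists>\<mu>. left_haar_measure G T \<mu> \<and> weakly_contained T unit_rep (left_regular_rep G \<mu>))"

text \<open>
  HOL cannot quantify over all types, so \<open>\<rho>\<close> ranges over the unitary representations on
  Hilbert spaces whose elements are taken from the type in which \<open>L2 \<mu>\<close> lives.  Up to unitary
  equivalence these include all cyclic representations, for their Hilbert spaces have at most
  as many elements as there are functions from the group to the complex numbers.  This is no
  restriction: if an arbitrary \<open>\<rho>\<close> is weakly contained in the regular representation, so is
  any nonzero cyclic subrepresentation \<open>\<rho>'\<close>, and if the regular representation is weakly
  contained in \<open>\<rho>'\<close> then also in \<open>\<rho>\<close>.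
\<close>

definition Cstar_simple :: "('a, 'b) monoid_scheme \<Rightarrow> 'a topology \<Rightarrow> bool" where
  "Cstar_simple G T \<longleftrightarrow>
     (\<exists>\<mu>. left_haar_measure G T \<mu> \<and>
       (\<forall>\<rho> :: ('a, ('a \<Rightarrow> complex) set) representation. unitary_rep G T \<rho> \<longrightarrow>
          (weakly_contained T \<rho> (left_regular_rep G \<mu>) \<longleftrightarrow>
           weakly_equivalent T \<rho> (left_regular_rep G \<mu>))))"

end

theory Submission
  imports Defs
begin

text \<open>
  The group \<open>G\<close> acts on \<open>L2\<close> of \<open>G / N\<close>, and \<open>N\<close> acts trivially, whereas it does not act trivially on
  \<open>L2\<close> of \<open>G\<close>; hence the regular representation is not weakly contained in this one.  Conversely, take
  \<open>f\<close> in \<open>L2\<close> of \<open>G / N\<close> and vectors \<open>\<zeta>\<close> in \<open>L2\<close> of \<open>N\<close> whose coefficients add up to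
  almost \<open>1\<close> on a large compact set.  They may be taken nonnegative.  Spread \<open>\<zeta>\<close> over the cosets of
  \<open>N\<close> by averaging its translates along a Bruhat function \<open>\<beta>\<close>, and multiply by \<open>f\<close>: the
  coefficients of these vectors in \<open>L2\<close> of \<open>G\<close> add up to almost the coefficient of \<open>f\<close>.
\<close>

section \<open>Square-integrable functions\<close>

text \<open>Moving vectors from N to G directly would call for a Borel section of G -> G/N. The
  weights \<open>\<beta>\<close>, of integral 1 over each coset, replace it: they choose the point
  of a coset at random, and bounds valid on N survive averaging against a probability. Amenability,
  however, controls coefficients on a compact subset of N only. This dictates the support of
  \<open>\<beta>\<close>: on the cosets that meet a given \<open>U j\<close> it lies in
  \<open>U j\<close>, so that two chosen points, one of them moved by an element of a compact set,
  differ by an element of a compact part of N.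

  Absolute values leave the norms of the vectors unchanged and can only enlarge the moduli of their
  coefficients. The new sum is thus at most the sum of the squared norms, which is the old sum at
  the identity, and at least the modulus of the old sum. What is gained is Tonelli's theorem in
  \<open>ennreal\<close>, with no integrability to check.

  Functions on G that are measurable for a smaller \<sigma>-algebra stand for functions on G/N. No
  quotient group or quotient topology has to be built, and the representation has the type over
  which \<open>Cstar_simple\<close> quantifies.\<close>

definition l2norm :: "'a measure \<Rightarrow> ('a \<Rightarrow> complex) \<Rightarrow> real" where
  "l2norm M f = sqrt (\<integral>x. (cmod (f x))\<^sup>2 \<partial>M)"

lemma square_integrableD:
  assumes "f \<in> square_integrable M"
  shows "f \<in> borel_measurable M" "integrable M (\<lambda>x. (cmod (f x))\<^sup>2)"
  using assms by (auto simp: square_integrable_def)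

lemma square_integrableI:
  assumes "f \<in> borel_measurable M" "integrable M (\<lambda>x. (cmod (f x))\<^sup>2)"
  shows "f \<in> square_integrable M"
  using assms by (auto simp: square_integrable_def)

lemma integrable_norm_mult:
  assumes "f \<in> square_integrable M" "h \<in> square_integrable M"
  shows "integrable M (\<lambda>x. cmod (f x) * cmod (h x))"
proof (rule Bochner_Integration.integrable_bound)
  note [measurable] = square_integrableD(1)[OF assms(1)] square_integrableD(1)[OF assms(2)]
  show "integrable M (\<lambda>x. (cmod (f x))\<^sup>2 + (cmod (h x))\<^sup>2)"
    using assms square_integrableD(2) by (intro Bochner_Integration.integrable_add) auto
  show "(\<lambda>x. cmod (f x) * cmod (h x)) \<in> borel_measurable M" by measurable
  have "a * b \<le> a\<^sup>2 + b\<^sup>2" if "a \<ge> 0" "b \<ge> 0" for a b :: real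
    using sum_squares_bound[of a b] mult_nonneg_nonneg[OF that] by linarith
  then show "AE x in M. norm (cmod (f x) * cmod (h x)) \<le> norm ((cmod (f x))\<^sup>2 + (cmod (h x))\<^sup>2)"
    by (auto simp: norm_mult)
qed

lemma integrable_cnj_mult:
  assumes "f \<in> square_integrable M" "h \<in> square_integrable M"
  shows "integrable M (\<lambda>x. cnj (f x) * h x)"
proof (rule Bochner_Integration.integrable_bound[OF integrable_norm_mult[OF assms]])
  note [measurable] = square_integrableD(1)[OF assms(1)] square_integrableD(1)[OF assms(2)]
  have "(\<lambda>x. cnj (f x)) \<in> borel_measurable M"
    by (rule borel_measurable_continuous_onI[THEN measurable_compose[rotated]])
       (auto intro: continuous_intros square_integrableD(1)[OF assms(1)])
  then show "(\<lambda>x. cnj (f x) * h x) \<in> borel_measurable M" by measurable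
qed (auto simp: norm_mult)

lemma square_integrable_bound:
  assumes "f \<in> square_integrable M" "h \<in> borel_measurable M" "\<And>x. cmod (h x) \<le> cmod (f x)"
  shows "h \<in> square_integrable M"
proof (rule square_integrableI[OF assms(2)])
  note [measurable] = assms(2)
  show "integrable M (\<lambda>x. (cmod (h x))\<^sup>2)"
    by (rule Bochner_Integration.integrable_bound[OF square_integrableD(2)[OF assms(1)]])
       (auto intro!: AE_I2 power_mono assms(3))
qed

lemma square_integrable_add:
  assumes "f \<in> square_integrable M" "h \<in> square_integrable M"
  shows "(\<lambda>x. f x + h x) \<in> square_integrable M"
proof (rule square_integrableI)
  note [measurable] = square_integrableD(1)[OF assms(1)] square_integrableD(1)[OF assms(2)]
  show "(\<lambda>x. f x + h x) \<in> borel_measurable M" by measurable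
  show "integrable M (\<lambda>x. (cmod (f x + h x))\<^sup>2)"
  proof (rule Bochner_Integration.integrable_bound)
    show "integrable M (\<lambda>x. 2 * (cmod (f x))\<^sup>2 + 2 * (cmod (h x))\<^sup>2)"
      using square_integrableD(2)[OF assms(1)] square_integrableD(2)[OF assms(2)]
      by (intro Bochner_Integration.integrable_add integrable_mult_right) auto
    have "(cmod (u + v))\<^sup>2 \<le> 2 * (cmod u)\<^sup>2 + 2 * (cmod v)\<^sup>2" for u v
    proof -
      have "(cmod (u + v))\<^sup>2 \<le> (cmod u + cmod v)\<^sup>2"
        by (intro power_mono norm_triangle_ineq) auto
      also have "\<dots> \<le> 2 * (cmod u)\<^sup>2 + 2 * (cmod v)\<^sup>2"
        using sum_squares_bound[of "cmod u" "cmod v"] by (simp add: power2_sum)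
      finally show ?thesis .
    qed
    then show "AE x in M. norm ((cmod (f x + h x))\<^sup>2) \<le> norm (2 * (cmod (f x))\<^sup>2 + 2 * (cmod (h x))\<^sup>2)"
      by (auto intro!: AE_I2)
  qed measurable
qed

lemma square_integrable_cmult:
  assumes "f \<in> square_integrable M"
  shows "(\<lambda>x. c * f x) \<in> square_integrable M"
  using square_integrableD[OF assms]
  by (auto intro!: square_integrableI simp: norm_mult power_mult_distrib)

lemma square_integrable_uminus:
  assumes "f \<in> square_integrable M"
  shows "(\<lambda>x. - f x) \<in> square_integrable M"
  using square_integrable_cmult[OF assms, of "-1"] by simp

lemma square_integrable_diff:
  assumes "f \<in> square_integrable M" "h \<in> square_integrable M"
  shows "(\<lambda>x. f x - h x) \<in> square_integrable M"
  using square_integrable_add[OF assms(1) square_integrable_uminus[OF assms(2)]] by simp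

lemma square_integrable_zero: "(\<lambda>x. 0) \<in> square_integrable M"
  by (auto intro!: square_integrableI)

lemma integral_cnj_mult_self:
  "(\<integral>x. cnj (f x) * f x \<partial>M) = complex_of_real (\<integral>x. (cmod (f x))\<^sup>2 \<partial>M)"
proof -
  have "cnj (f x) * f x = complex_of_real ((cmod (f x))\<^sup>2)" for x
    by (metis complex_norm_square mult.commute)
  then show ?thesis
    by (simp only: integral_complex_of_real)
qed

lemma l2norm_nonneg: "l2norm M f \<ge> 0"
  by (simp add: l2norm_def)

lemma l2norm_power2: "(l2norm M f)\<^sup>2 = (\<integral>x. (cmod (f x))\<^sup>2 \<partial>M)"
  by (simp add: l2norm_def)

lemma l2norm_minus_commute: "l2norm M (\<lambda>x. f x - h x) = l2norm M (\<lambda>x. h x - f x)"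
  by (simp add: l2norm_def norm_minus_commute)

lemma l2norm_eq_0_iff:
  assumes "f \<in> square_integrable M"
  shows "l2norm M f = 0 \<longleftrightarrow> (AE x in M. f x = 0)"
  using integral_nonneg_eq_0_iff_AE[OF square_integrableD(2)[OF assms]]
  by (simp add: l2norm_def)

text \<open>The quadratic polynomial \<integral> (t |f| - |h|)^2 in t is nonnegative. The absolute
  values stand inside the integral because the bound is applied later to correlations of absolute
  values, which dominate the coefficients themselves.\<close>

lemma Cauchy_Schwarz_l2norm:
  assumes "f \<in> square_integrable M" "h \<in> square_integrable M"
  shows "(\<integral>x. cmod (f x) * cmod (h x) \<partial>M) \<le> l2norm M f * l2norm M h"
proof -
  define a b c where "a = l2norm M f" and "b = l2norm M h"
    and "c = (\<integral>x. cmod (f x) * cmod (h x) \<partial>M)"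
  note i = square_integrableD(2)[OF assms(1)] square_integrableD(2)[OF assms(2)]
    integrable_norm_mult[OF assms]
  have quad: "0 \<le> t\<^sup>2 * a\<^sup>2 - 2 * t * c + b\<^sup>2" for t
  proof -
    have "0 \<le> (\<integral>x. (t * cmod (f x) - cmod (h x))\<^sup>2 \<partial>M)" by simp
    also have "\<dots> = (\<integral>x. t\<^sup>2 * (cmod (f x))\<^sup>2 - 2 * t * (cmod (f x) * cmod (h x)) + (cmod (h x))\<^sup>2 \<partial>M)"
      by (intro Bochner_Integration.integral_cong) (auto simp: power2_eq_square algebra_simps)
    also have "\<dots> = t\<^sup>2 * a\<^sup>2 - 2 * t * c + b\<^sup>2"
      using i by (simp add: a_def b_def c_def l2norm_power2)
    finally show ?thesis .
  qed
  have a0: "a \<ge> 0" and b0: "b \<ge> 0" by (simp_all add: a_def b_def l2norm_nonneg)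
  have "c \<le> a * b"
  proof (cases "a = 0")
    case True
    then have "AE x in M. f x = 0" using l2norm_eq_0_iff[OF assms(1)] by (simp add: a_def)
    then have "c = 0" unfolding c_def by (intro integral_eq_zero_AE) auto
    then show ?thesis using a0 b0 by simp
  next
    case False
    then have a: "a > 0" using a0 by simp
    \<comment> \<open>The quadratic is minimal at t = c / a^2.\<close>
    have "0 \<le> (c / a\<^sup>2)\<^sup>2 * a\<^sup>2 - 2 * (c / a\<^sup>2) * c + b\<^sup>2" by (rule quad)
    also have "\<dots> = b\<^sup>2 - c\<^sup>2 / a\<^sup>2" using a by (simp add: field_simps power2_eq_square)
    finally have "c\<^sup>2 \<le> (a * b)\<^sup>2" using a by (simp add: field_simps power2_eq_square)
    then show ?thesis using a0 b0 by (meson mult_nonneg_nonneg power2_le_imp_le)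
  qed
  then show ?thesis by (simp add: a_def b_def c_def)
qed

lemma norm_integral_cnj_mult_le:
  assumes "f \<in> square_integrable M" "h \<in> square_integrable M"
  shows "cmod (\<integral>x. cnj (f x) * h x \<partial>M) \<le> l2norm M f * l2norm M h"
proof -
  have "cmod (\<integral>x. cnj (f x) * h x \<partial>M) \<le> (\<integral>x. cmod (cnj (f x) * h x) \<partial>M)"
    by (rule integral_norm_bound)
  also have "\<dots> = (\<integral>x. cmod (f x) * cmod (h x) \<partial>M)" by (simp add: norm_mult)
  finally show ?thesis using Cauchy_Schwarz_l2norm[OF assms] by linarith
qed

lemma l2norm_triangle:
  assumes "f \<in> square_integrable M" "h \<in> square_integrable M"
  shows "l2norm M (\<lambda>x. f x + h x) \<le> l2norm M f + l2norm M h"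
proof (rule power2_le_imp_le)
  note i = square_integrableD(2)[OF assms(1)] square_integrableD(2)[OF assms(2)]
    integrable_norm_mult[OF assms]
  have "(l2norm M (\<lambda>x. f x + h x))\<^sup>2 = (\<integral>x. (cmod (f x + h x))\<^sup>2 \<partial>M)" by (rule l2norm_power2)
  also have "\<dots> \<le> (\<integral>x. (cmod (f x))\<^sup>2 + 2 * (cmod (f x) * cmod (h x)) + (cmod (h x))\<^sup>2 \<partial>M)"
  proof (rule integral_mono)
    show "integrable M (\<lambda>x. (cmod (f x + h x))\<^sup>2)"
      using square_integrableD(2)[OF square_integrable_add[OF assms]] .
    show "integrable M (\<lambda>x. (cmod (f x))\<^sup>2 + 2 * (cmod (f x) * cmod (h x)) + (cmod (h x))\<^sup>2)"
      using i by auto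
    show "(cmod (f x + h x))\<^sup>2 \<le> (cmod (f x))\<^sup>2 + 2 * (cmod (f x) * cmod (h x)) + (cmod (h x))\<^sup>2" for x
      using power_mono[OF norm_triangle_ineq[of "f x" "h x"], of 2] by (simp add: power2_sum)
  qed
  also have "\<dots> = (l2norm M f)\<^sup>2 + 2 * (\<integral>x. cmod (f x) * cmod (h x) \<partial>M) + (l2norm M h)\<^sup>2"
    using i by (simp add: l2norm_power2)
  also have "\<dots> \<le> (l2norm M f + l2norm M h)\<^sup>2"
    using Cauchy_Schwarz_l2norm[OF assms] by (simp add: power2_sum)
  finally show "(l2norm M (\<lambda>x. f x + h x))\<^sup>2 \<le> (l2norm M f + l2norm M h)\<^sup>2" .
qed (simp add: l2norm_nonneg)

lemma l2norm_triangle_diff: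
  assumes "f \<in> square_integrable M" "h \<in> square_integrable M" "k \<in> square_integrable M"
  shows "l2norm M (\<lambda>x. f x - k x) \<le> l2norm M (\<lambda>x. f x - h x) + l2norm M (\<lambda>x. h x - k x)"
  using l2norm_triangle[OF square_integrable_diff[OF assms(1,2)] square_integrable_diff[OF assms(2,3)]]
  by simp

lemma nn_integral_l2norm:
  assumes "f \<in> square_integrable M"
  shows "(\<integral>\<^sup>+x. ennreal ((cmod (f x))\<^sup>2) \<partial>M) = ennreal ((l2norm M f)\<^sup>2)"
  using nn_integral_eq_integral[OF square_integrableD(2)[OF assms]] by (simp add: l2norm_power2)

lemma square_integrable_if_nn_integral:
  assumes "f \<in> borel_measurable M" "(\<integral>\<^sup>+x. ennreal ((cmod (f x))\<^sup>2) \<partial>M) \<le> ennreal (r\<^sup>2)" "r \<ge> 0"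
  shows "f \<in> square_integrable M" "l2norm M f \<le> r"
proof -
  have "integrable M (\<lambda>x. (cmod (f x))\<^sup>2)"
    using assms by (intro integrableI_bounded) (auto intro: le_less_trans)
  then show *: "f \<in> square_integrable M" using assms by (auto intro: square_integrableI)
  have "(l2norm M f)\<^sup>2 \<le> r\<^sup>2"
    using assms(2) unfolding nn_integral_l2norm[OF *] by (simp add: ennreal_le_iff)
  then show "l2norm M f \<le> r" using assms(3) power2_le_imp_le by blast
qed

section \<open>Completeness in the L2 seminorm\<close>

text \<open>The weights 2^k are small enough for the integral of \<Sum> 2^k |f k|^2 to be at most
  \<Sum> (1/2)^k. Wherever this series has a finite value C, the term |f k| is at most sqrt C times
  sqrt (1/2)^k, and a geometric series dominates.\<close>

lemma summable_AE_of_l2norm: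
  assumes f: "\<And>k. f k \<in> square_integrable M" and le: "\<And>k. l2norm M (f k) \<le> (1/2)^k"
  shows "AE x in M. summable (\<lambda>k. f k x)"
proof -
  note [measurable] = square_integrableD(1)[OF f]
  have "(\<integral>\<^sup>+x. suminf (\<lambda>k. ennreal (2^k * (cmod (f k x))\<^sup>2)) \<partial>M) = suminf (\<lambda>k. \<integral>\<^sup>+x. ennreal (2^k * (cmod (f k x))\<^sup>2) \<partial>M)"
    by (rule nn_integral_suminf) measurable
  also have "\<dots> \<le> suminf (\<lambda>k. ennreal ((1/2)^k))"
  proof (rule suminf_le)
    fix k
    have "(\<integral>\<^sup>+x. ennreal (2^k * (cmod (f k x))\<^sup>2) \<partial>M) = ennreal (2^k) * ennreal ((l2norm M (f k))\<^sup>2)"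
      by (simp add: ennreal_mult nn_integral_cmult nn_integral_l2norm[OF f])
    also have "\<dots> = ennreal (2^k * (l2norm M (f k))\<^sup>2)"
      by (simp add: ennreal_mult)
    also have "\<dots> \<le> ennreal (2^k * ((1/2)^k)\<^sup>2)"
      by (intro ennreal_leI mult_left_mono power_mono le l2norm_nonneg) auto
    also have "(2^k * ((1/2)^k)\<^sup>2) = ((1/2)^k :: real)"
      by (simp add: power2_eq_square power_one_over)
    finally show "(\<integral>\<^sup>+x. ennreal (2^k * (cmod (f k x))\<^sup>2) \<partial>M) \<le> ennreal ((1/2)^k)" .
  qed auto
  also have "\<dots> = ennreal (suminf (\<lambda>k. (1/2)^k))"
    by (intro suminf_ennreal2 summable_geometric) auto
  also have "\<dots> < \<infinity>" by simp
  finally have "(\<integral>\<^sup>+x. suminf (\<lambda>k. ennreal (2^k * (cmod (f k x))\<^sup>2)) \<partial>M) \<noteq> \<infinity>"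
    by simp
  then have "AE x in M. suminf (\<lambda>k. ennreal (2^k * (cmod (f k x))\<^sup>2)) \<noteq> \<infinity>"
    by (intro nn_integral_noteq_infinite) measurable
  then show ?thesis
  proof eventually_elim
    case (elim x)
    define S where "S = suminf (\<lambda>k. ennreal (2^k * (cmod (f k x))\<^sup>2))"
    have "S < top_class.top" using elim unfolding S_def by (simp add: less_top)
    then obtain C where C: "S = ennreal C" "C \<ge> 0"
      unfolding less_top_ennreal by blast
    have b: "cmod (f k x) \<le> sqrt C * (sqrt (1/2))^k" for k
    proof -
      have "ennreal (2^k * (cmod (f k x))\<^sup>2) \<le> S"
        using sum_le_suminf[of "\<lambda>k. ennreal (2^k * (cmod (f k x))\<^sup>2)" "{k}", OF summableI]
        by (simp only: S_def sum.insert sum.empty finite.intros not_False_eq_True empty_iff add_0_right zero_le simp_thms)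
      then have "2^k * (cmod (f k x))\<^sup>2 \<le> C" using C by (simp add: ennreal_le_iff)
      then have "(cmod (f k x))\<^sup>2 \<le> C * (1/2)^k" by (simp add: field_simps power_one_over)
      then have "cmod (f k x) \<le> sqrt (C * (1/2)^k)" by (simp add: real_le_rsqrt)
      then show ?thesis by (simp add: real_sqrt_mult real_sqrt_power)
    qed
    show ?case
    proof (rule summable_comparison_test')
      show "summable (\<lambda>k. sqrt C * (sqrt (1/2))^k)"
        by (intro summable_mult summable_geometric) (auto simp: real_sqrt_lt_1_iff)
    qed (use b in auto)
  qed
qed

text \<open>Riesz-Fischer: a rapidly converging subsequence converges almost everywhere, and Fatou's
  lemma, applied along it, bounds the distance of every late term of the whole sequence to the
  pointwise limit.\<close>

lemma l2norm_complete:
  assumes s: "\<And>n. s n \<in> square_integrable M"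
    and C: "\<And>e. e > 0 \<Longrightarrow> \<exists>n0. \<forall>n\<ge>n0. \<forall>m\<ge>n0. l2norm M (\<lambda>x. s n x - s m x) < e"
  obtains f where "f \<in> square_integrable M" "(\<lambda>n. l2norm M (\<lambda>x. s n x - f x)) \<longlonglongrightarrow> 0"
proof -
  note [measurable] = square_integrableD(1)[OF s]
  have "\<forall>k. \<exists>n0. \<forall>n\<ge>n0. \<forall>m\<ge>n0. l2norm M (\<lambda>x. s n x - s m x) < (1/2)^k"
    using C by simp
  then obtain N where N: "\<And>k n m. n \<ge> N k \<Longrightarrow> m \<ge> N k \<Longrightarrow> l2norm M (\<lambda>x. s n x - s m x) < (1/2)^k"
    by metis
  \<comment> \<open>Summing \<open>N i + 1\<close> gives indices that exceed \<open>N k\<close>,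
    increase with k and are at least k, so that consecutive distances along \<open>r\<close> are
    below (1/2)^k and \<open>r\<close> is cofinal.\<close>
  define r where "r = (\<lambda>k. \<Sum>i\<le>k. N i + 1)"
  have rN: "N k \<le> r k" for k
    unfolding r_def by (rule order_trans[OF _ member_le_sum[of k]]) auto
  have rs: "r (Suc k) = r k + N (Suc k) + 1" for k by (simp add: r_def)
  have "k \<le> r k" for k by (induction k) (auto simp: rs)
  then have rSuc: "r k \<le> r (Suc k)" "k \<le> r k" for k by (simp_all add: rs)
  define d where "d = (\<lambda>k x. s (r (Suc k)) x - s (r k) x)"
  have dsq: "d k \<in> square_integrable M" for k unfolding d_def by (intro square_integrable_diff s)
  have "l2norm M (d k) \<le> (1/2)^k" for k
    unfolding d_def by (rule less_imp_le, rule N[OF order_trans[OF rN rSuc(1)] rN])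
  from summable_AE_of_l2norm[OF dsq this]
  have sumd: "AE x in M. summable (\<lambda>k. d k x)" .
  have tel: "s (r k) x = s (r 0) x + (\<Sum>i<k. d i x)" for k x
    by (induction k) (auto simp: d_def)
  define f where "f = (\<lambda>x. lim (\<lambda>k. s (r k) x))"
  have [measurable]: "f \<in> borel_measurable M"
    unfolding f_def by (rule borel_measurable_lim_metric) measurable
  have lim: "AE x in M. (\<lambda>k. s (r k) x) \<longlonglongrightarrow> f x"
    using sumd
  proof eventually_elim
    case (elim x)
    then have "(\<lambda>k. s (r 0) x + (\<Sum>i<k. d i x)) \<longlonglongrightarrow> s (r 0) x + suminf (\<lambda>k. d k x)"
      by (intro tendsto_intros summable_LIMSEQ)
    then show ?case unfolding tel[symmetric] f_def using convergentI convergent_LIMSEQ_iff by blast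
  qed
  have fatou: "(\<integral>\<^sup>+x. ennreal ((cmod (s n x - f x))\<^sup>2) \<partial>M) \<le> ennreal (((1/2)^k)\<^sup>2)" if "n \<ge> N k" for n k
  proof -
    have "(\<integral>\<^sup>+x. ennreal ((cmod (s n x - f x))\<^sup>2) \<partial>M)
       = (\<integral>\<^sup>+x. liminf (\<lambda>j. ennreal ((cmod (s n x - s (r j) x))\<^sup>2)) \<partial>M)"
    proof (rule nn_integral_cong_AE, use lim in eventually_elim)
      case (elim x)
      then have "(\<lambda>j. ennreal ((cmod (s n x - s (r j) x))\<^sup>2)) \<longlonglongrightarrow> ennreal ((cmod (s n x - f x))\<^sup>2)"
        by (intro tendsto_intros)
      from lim_imp_Liminf[OF _ this] show ?case by simp
    qed
    also have "\<dots> \<le> liminf (\<lambda>j. \<integral>\<^sup>+x. ennreal ((cmod (s n x - s (r j) x))\<^sup>2) \<partial>M)"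
      by (rule nn_integral_liminf) measurable
    also have "\<dots> \<le> ennreal (((1/2)^k)\<^sup>2)"
    proof (rule Liminf_le)
      show "\<forall>\<^sub>F j in sequentially. (\<integral>\<^sup>+x. ennreal ((cmod (s n x - s (r j) x))\<^sup>2) \<partial>M) \<le> ennreal (((1/2)^k)\<^sup>2)"
        using eventually_ge_at_top[of "N k"]
      proof eventually_elim
        case (elim j)
        have "l2norm M (\<lambda>x. s n x - s (r j) x) < (1/2)^k"
          by (rule N) (use that elim rSuc(2)[of j] in auto)
        then show ?case
          by (subst nn_integral_l2norm) (auto intro!: square_integrable_diff s ennreal_leI power_mono l2norm_nonneg)
      qed
    qed simp
    finally show ?thesis .
  qed
  have diff: "(\<lambda>x. s n x - f x) \<in> square_integrable M" "l2norm M (\<lambda>x. s n x - f x) \<le> (1/2)^k"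
    if "n \<ge> N k" for n k
    by (rule square_integrable_if_nn_integral[OF _ fatou[OF that]]; simp)+
  have "f \<in> square_integrable M"
    using square_integrable_diff[OF s[of "N 0"] diff(1)[of 0 "N 0"]] by simp
  moreover have "(\<lambda>n. l2norm M (\<lambda>x. s n x - f x)) \<longlonglongrightarrow> 0"
  proof (rule LIMSEQ_I)
    fix e :: real assume "e > 0"
    then obtain k where k: "(1/2)^k < e" using real_arch_pow_inv[of e "1/2"] by auto
    show "\<exists>n0. \<forall>n\<ge>n0. norm (l2norm M (\<lambda>x. s n x - f x) - 0) < e"
      using diff(2)[of k] k l2norm_nonneg[of M] by (intro exI[of _ "N k"]) (force simp: abs_of_nonneg)
  qed
  ultimately show ?thesis by (rule that)
qed

section \<open>Polarisation and truncation\<close>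

lemma l2norm_diff_power2:
  assumes "f \<in> square_integrable M" "k \<in> square_integrable M"
  shows "(l2norm M (\<lambda>x. f x - k x))\<^sup>2 = (l2norm M f)\<^sup>2 + (l2norm M k)\<^sup>2 - 2 * Re (\<integral>x. cnj (f x) * k x \<partial>M)"
proof -
  note i = square_integrableD(2)[OF assms(1)] square_integrableD(2)[OF assms(2)] integrable_cnj_mult[OF assms]
  define p where "p = (\<lambda>x. cnj (f x) * k x)"
  have p: "integrable M p" using i(3) by (simp add: p_def)
  have "(cmod (f x - k x))\<^sup>2 = (cmod (f x))\<^sup>2 + (cmod (k x))\<^sup>2 - 2 * Re (p x)" for x
    unfolding p_def by (simp add: cmod_power2) (simp add: power2_eq_square algebra_simps)
  then have "(l2norm M (\<lambda>x. f x - k x))\<^sup>2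
    = (\<integral>x. (cmod (f x))\<^sup>2 + (cmod (k x))\<^sup>2 - 2 * Re (p x) \<partial>M)"
    unfolding l2norm_power2 by (simp only:)
  also have "\<dots> = (\<integral>x. (cmod (f x))\<^sup>2 \<partial>M) + (\<integral>x. (cmod (k x))\<^sup>2 \<partial>M) - 2 * (\<integral>x. Re (p x) \<partial>M)"
    using i(1,2) integrable_Re[OF p] by simp
  also have "(\<integral>x. Re (p x) \<partial>M) = Re (\<integral>x. cnj (f x) * k x \<partial>M)"
    unfolding p_def by (rule integral_Re[OF i(3)])
  finally show ?thesis by (simp add: l2norm_power2)
qed

lemma l2norm_dominated:
  assumes f: "f \<in> square_integrable M" and s [measurable]: "\<And>k. s k \<in> borel_measurable M"
    and le: "\<And>k x. cmod (f x - s k x) \<le> cmod (f x)"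
    and lim: "\<And>x. x \<in> space M \<Longrightarrow> (\<lambda>k. s k x) \<longlonglongrightarrow> f x"
  shows "(\<lambda>k. l2norm M (\<lambda>x. f x - s k x)) \<longlonglongrightarrow> 0"
proof -
  note [measurable] = square_integrableD(1)[OF f]
  have "(\<lambda>k. \<integral>x. (cmod (f x - s k x))\<^sup>2 \<partial>M) \<longlonglongrightarrow> (\<integral>x. 0 \<partial>M)"
  proof (rule integral_dominated_convergence)
    show "integrable M (\<lambda>x. (cmod (f x))\<^sup>2)" by (rule square_integrableD(2)[OF f])
    show "AE x in M. (\<lambda>k. (cmod (f x - s k x))\<^sup>2) \<longlonglongrightarrow> 0"
    proof (rule AE_I2)
      fix x assume "x \<in> space M"
      then have "(\<lambda>k. (cmod (f x - s k x))\<^sup>2) \<longlonglongrightarrow> (cmod (f x - f x))\<^sup>2"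
        by (intro tendsto_intros lim)
      then show "(\<lambda>k. (cmod (f x - s k x))\<^sup>2) \<longlonglongrightarrow> 0" by simp
    qed
    show "AE x in M. norm ((cmod (f x - s k x))\<^sup>2) \<le> (cmod (f x))\<^sup>2" for k
      using le by (auto intro!: power_mono)
  qed measurable
  then have "(\<lambda>k. l2norm M (\<lambda>x. f x - s k x)) \<longlonglongrightarrow> sqrt 0"
    unfolding l2norm_def by (intro tendsto_real_sqrt) simp
  then show ?thesis by simp
qed

text \<open>Truncation to the set where |f| lies between 1/(k+1) and k+1. The upper cut makes the
  result bounded; the lower cut makes it integrable, since |f| is at most (k+1) |f|^2 there. Both
  serve to derive continuity of translation in L2 from continuity in L1.\<close>

lemma bounded_integrable_approx:
  assumes f: "f \<in> square_integrable M" and e: "e > 0"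
  obtains h C where "h \<in> square_integrable M" "integrable M h" "\<And>x. cmod (h x) \<le> C"
    "l2norm M (\<lambda>x. f x - h x) < e"
proof -
  note [measurable] = square_integrableD(1)[OF f]
  define s where "s = (\<lambda>(k::nat) x. if 1 / real (Suc k) \<le> cmod (f x) \<and> cmod (f x) \<le> real (Suc k) then f x else 0)"
  have [measurable]: "s k \<in> borel_measurable M" for k unfolding s_def by measurable
  have "(\<lambda>k. l2norm M (\<lambda>x. f x - s k x)) \<longlonglongrightarrow> 0"
  proof (rule l2norm_dominated[OF f])
    fix x
    show "(\<lambda>k. s k x) \<longlonglongrightarrow> f x"
    proof (cases "f x = 0")
      case True then show ?thesis by (simp add: s_def)
    next
      case False
      have "\<forall>\<^sub>F k in sequentially. 1 / real (Suc k) < cmod (f x)"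
        using False by (intro order_tendstoD(2)[OF LIMSEQ_Suc[OF lim_1_over_n]]) auto
      moreover have "\<forall>\<^sub>F k in sequentially. cmod (f x) \<le> real (Suc k)"
        using eventually_ge_at_top[of "nat \<lceil>cmod (f x)\<rceil>"]
        by eventually_elim linarith
      ultimately have "\<forall>\<^sub>F k in sequentially. s k x = f x"
        by eventually_elim (simp add: s_def)
      then show ?thesis by (rule tendsto_eventually)
    qed
  next
    show "cmod (f x - s k x) \<le> cmod (f x)" for k x by (simp add: s_def)
  qed measurable
  then obtain k where k: "l2norm M (\<lambda>x. f x - s k x) < e"
    using e by (metis (no_types, lifting) eventually_happens order_tendstoD(2) trivial_limit_sequentially)
  have sq: "s k \<in> square_integrable M"
    by (rule square_integrable_bound[OF f]) (measurable, simp add: s_def)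
  have "integrable M (s k)"
  proof (rule Bochner_Integration.integrable_bound)
    show "integrable M (\<lambda>x. real (Suc k) * (cmod (f x))\<^sup>2)"
      using square_integrableD(2)[OF f] by simp
    have "cmod (s k x) \<le> real (Suc k) * (cmod (f x))\<^sup>2" for x
    proof (cases "1 / real (Suc k) \<le> cmod (f x)")
      case True
      then have "1 * cmod (f x) \<le> (real (Suc k) * cmod (f x)) * cmod (f x)"
        by (intro mult_right_mono) (simp_all add: field_simps)
      then show ?thesis by (simp add: s_def power2_eq_square mult.assoc)
    qed (simp add: s_def)
    then show "AE x in M. norm (s k x) \<le> norm (real (Suc k) * (cmod (f x))\<^sup>2)" by simp
  qed measurable
  moreover have "cmod (s k x) \<le> real (Suc k)" for x by (simp add: s_def)
  ultimately show ?thesis using that[OF sq _ _ k] by blast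
qed

section \<open>Completeness of \<open>L2\<close>\<close>

lemma mem_L2_class:
  "h \<in> L2_class M f \<longleftrightarrow> f \<in> square_integrable M \<and> h \<in> square_integrable M \<and> (AE x in M. f x = h x)"
  by (auto simp: L2_class_def AE_eq_rel_def)

lemma L2_class_self: "f \<in> square_integrable M \<Longrightarrow> f \<in> L2_class M f"
  by (simp add: mem_L2_class)

lemma L2_class_eqI:
  assumes "f \<in> square_integrable M" "h \<in> square_integrable M" "AE x in M. f x = h x"
  shows "L2_class M f = L2_class M h"
proof -
  have "(AE x in M. f x = k x) \<longleftrightarrow> (AE x in M. h x = k x)" for k
    using assms(3) by (auto elim: eventually_elim2)
  then show ?thesis using assms by (auto simp: mem_L2_class)
qed

lemma L2_class_eq_iff:
  assumes "f \<in> square_integrable M" "h \<in> square_integrable M"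
  shows "L2_class M f = L2_class M h \<longleftrightarrow> (AE x in M. f x = h x)"
  using L2_class_eqI[OF assms] L2_class_self[OF assms(2)] mem_L2_class[of h M f] by metis

lemma L2_repr_L2_class:
  assumes "f \<in> square_integrable M"
  shows "L2_repr (L2_class M f) \<in> square_integrable M" "AE x in M. f x = L2_repr (L2_class M f) x"
  using someI[of "\<lambda>h. h \<in> L2_class M f", OF L2_class_self[OF assms]]
  by (auto simp: L2_repr_def mem_L2_class)

lemma L2_carrier: "carrier (L2 M) = L2_class M ` square_integrable M"
  by (auto simp: L2_def quotient_def L2_class_def)

lemma L2_carrierE:
  assumes "A \<in> carrier (L2 M)"
  obtains f where "f \<in> square_integrable M" "A = L2_class M f"
  using assms by (auto simp: L2_carrier)

lemma L2_class_in_carrier: "f \<in> square_integrable M \<Longrightarrow> L2_class M f \<in> carrier (L2 M)"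
  by (auto simp: L2_carrier)

lemma L2_zero: "\<zero>\<^bsub>L2 M\<^esub> = L2_class M (\<lambda>x. 0)"
  by (simp add: L2_def)

lemma L2_add:
  assumes "f \<in> square_integrable M" "h \<in> square_integrable M"
  shows "L2_class M f \<oplus>\<^bsub>L2 M\<^esub> L2_class M h = L2_class M (\<lambda>x. f x + h x)"
proof -
  have "AE x in M. L2_repr (L2_class M f) x + L2_repr (L2_class M h) x = f x + h x"
    using L2_repr_L2_class(2)[OF assms(1)] L2_repr_L2_class(2)[OF assms(2)] by eventually_elim simp
  then show ?thesis
    using L2_class_eqI[OF square_integrable_add[OF L2_repr_L2_class(1)[OF assms(1)] L2_repr_L2_class(1)[OF assms(2)]]
        square_integrable_add[OF assms]]
    by (simp add: L2_def)
qed

lemma L2_smult: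
  assumes "f \<in> square_integrable M"
  shows "c \<odot>\<^bsub>L2 M\<^esub> L2_class M f = L2_class M (\<lambda>x. c * f x)"
proof -
  have "AE x in M. c * L2_repr (L2_class M f) x = c * f x"
    using L2_repr_L2_class(2)[OF assms(1)] by eventually_elim simp
  then show ?thesis
    using L2_class_eqI[OF square_integrable_cmult[OF L2_repr_L2_class(1)[OF assms]] square_integrable_cmult[OF assms]]
    by (simp add: L2_def)
qed

lemma L2_cinner:
  assumes "f \<in> square_integrable M" "h \<in> square_integrable M"
  shows "cinner (L2 M) (L2_class M f) (L2_class M h) = (\<integral>x. cnj (f x) * h x \<partial>M)"
proof -
  have "AE x in M. cnj (L2_repr (L2_class M f) x) * L2_repr (L2_class M h) x = cnj (f x) * h x"
    using L2_repr_L2_class(2)[OF assms(1)] L2_repr_L2_class(2)[OF assms(2)] by eventually_elim simp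
  moreover have "(\<lambda>x. cnj (L2_repr (L2_class M f) x) * L2_repr (L2_class M h) x) \<in> borel_measurable M"
    "(\<lambda>x. cnj (f x) * h x) \<in> borel_measurable M"
    using assms L2_repr_L2_class(1)
    by (auto intro!: borel_measurable_integrable integrable_cnj_mult)
  ultimately show ?thesis
    by (auto simp: L2_def intro!: integral_cong_AE)
qed

text \<open>
  The library's metric spaces demand \<open>d x y = d y x\<close> also for points outside the carrier, which
  the addition of \<open>L2 M\<close> cannot guarantee.  Sending junk to zero before adding repairs this
  without changing anything on the carrier.
\<close>

definition L2_retract :: "'a measure \<Rightarrow> ('a \<Rightarrow> complex) set \<Rightarrow> ('a \<Rightarrow> complex) set" where
  "L2_retract M A = (if A \<in> carrier (L2 M) then A else \<zero>\<^bsub>L2 M\<^esub>)"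

definition L2_total :: "'a measure \<Rightarrow> ('a \<Rightarrow> complex) set hilbert" where
  "L2_total M = (L2 M)\<lparr>ring.add := \<lambda>A B. L2_retract M A \<oplus>\<^bsub>L2 M\<^esub> L2_retract M B\<rparr>"

lemma L2_total_simps [simp]:
  "carrier (L2_total M) = carrier (L2 M)" "\<zero>\<^bsub>L2_total M\<^esub> = \<zero>\<^bsub>L2 M\<^esub>"
  "c \<odot>\<^bsub>L2_total M\<^esub> A = c \<odot>\<^bsub>L2 M\<^esub> A" "cinner (L2_total M) = cinner (L2 M)"
  by (simp_all add: L2_total_def)

lemma L2_retract_carrier: "A \<in> carrier (L2 M) \<Longrightarrow> L2_retract M A = A"
  by (simp add: L2_retract_def)

lemma L2_retract_class: "f \<in> square_integrable M \<Longrightarrow> L2_retract M (L2_class M f) = L2_class M f"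
  by (simp add: L2_retract_def L2_class_in_carrier)

lemma L2_retractE:
  obtains f where "f \<in> square_integrable M" "L2_retract M A = L2_class M f"
  by (metis L2_carrierE L2_retract_def L2_zero square_integrable_zero)

lemma L2_total_add_retract:
  "A \<oplus>\<^bsub>L2_total M\<^esub> B = L2_retract M A \<oplus>\<^bsub>L2 M\<^esub> L2_retract M B"
  by (simp add: L2_total_def)

lemma L2_total_add:
  assumes "f \<in> square_integrable M" "h \<in> square_integrable M"
  shows "L2_class M f \<oplus>\<^bsub>L2_total M\<^esub> L2_class M h = L2_class M (\<lambda>x. f x + h x)"
  using assms by (simp add: L2_total_add_retract L2_retract_class L2_add)

text \<open>\<open>A\<close> may lie outside the carrier, where the group laws say nothing. The
  definite description behind the inverse is therefore evaluated by hand; addition sees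
  \<open>A\<close> only through its retraction, which \<open>f\<close> represents.\<close>

lemma L2_total_a_inv:
  assumes f: "f \<in> square_integrable M" and A: "L2_retract M A = L2_class M f"
  shows "\<ominus>\<^bsub>L2_total M\<^esub> A = L2_class M (\<lambda>x. - f x)"
proof -
  have "(THE B. B \<in> carrier (L2 M) \<and> A \<oplus>\<^bsub>L2_total M\<^esub> B = \<zero>\<^bsub>L2 M\<^esub> \<and> B \<oplus>\<^bsub>L2_total M\<^esub> A = \<zero>\<^bsub>L2 M\<^esub>)
     = L2_class M (\<lambda>x. - f x)"
  proof (rule the_equality)
    show "L2_class M (\<lambda>x. - f x) \<in> carrier (L2 M) \<and>
        A \<oplus>\<^bsub>L2_total M\<^esub> L2_class M (\<lambda>x. - f x) = \<zero>\<^bsub>L2 M\<^esub> \<and>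
        L2_class M (\<lambda>x. - f x) \<oplus>\<^bsub>L2_total M\<^esub> A = \<zero>\<^bsub>L2 M\<^esub>"
      using f square_integrable_uminus[OF f]
      by (simp add: L2_class_in_carrier L2_total_add_retract A L2_retract_class L2_add L2_zero)
  next
    fix B assume B: "B \<in> carrier (L2 M) \<and> A \<oplus>\<^bsub>L2_total M\<^esub> B = \<zero>\<^bsub>L2 M\<^esub> \<and> B \<oplus>\<^bsub>L2_total M\<^esub> A = \<zero>\<^bsub>L2 M\<^esub>"
    then obtain h where h: "h \<in> square_integrable M" "B = L2_class M h" using L2_carrierE by blast
    have "L2_class M (\<lambda>x. f x + h x) = L2_class M (\<lambda>x. 0)"
      using B h f by (simp add: L2_total_add_retract A L2_retract_class L2_add L2_zero)
    then have "AE x in M. f x + h x = 0"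
      using L2_class_eq_iff[OF square_integrable_add[OF f h(1)] square_integrable_zero] by simp
    then have "AE x in M. h x = - f x" by eventually_elim (simp add: add_eq_0_iff)
    then show "B = L2_class M (\<lambda>x. - f x)"
      using L2_class_eqI[OF h(1) square_integrable_uminus[OF f]] h by simp
  qed
  then show ?thesis by (simp add: a_inv_def m_inv_def)
qed

lemma L2_total_minus:
  assumes f: "f \<in> square_integrable M" "L2_retract M A = L2_class M f"
    and h: "h \<in> square_integrable M" "L2_retract M B = L2_class M h"
  shows "A \<ominus>\<^bsub>L2_total M\<^esub> B = L2_class M (\<lambda>x. f x - h x)"
proof -
  have "A \<ominus>\<^bsub>L2_total M\<^esub> B = A \<oplus>\<^bsub>L2_total M\<^esub> L2_class M (\<lambda>x. - h x)"
    by (simp add: a_minus_def L2_total_a_inv[OF h])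
  also have "\<dots> = L2_class M (\<lambda>x. f x + - h x)"
    using L2_add[OF f(1) square_integrable_uminus[OF h(1)]]
    by (simp add: L2_total_add_retract f L2_retract_class square_integrable_uminus[OF h(1)])
  finally show ?thesis by simp
qed

lemma L2_total_cdist:
  assumes f: "f \<in> square_integrable M" "L2_retract M A = L2_class M f"
    and h: "h \<in> square_integrable M" "L2_retract M B = L2_class M h"
  shows "cdist (L2_total M) A B = l2norm M (\<lambda>x. f x - h x)"
  using square_integrable_diff[OF f(1) h(1)]
  by (simp add: cdist_def cnorm_def L2_total_minus[OF f h] L2_cinner integral_cnj_mult_self
      l2norm_def del: complex_cnj_diff)

lemma L2_total_cdist_class:
  assumes "f \<in> square_integrable M" "h \<in> square_integrable M"
  shows "cdist (L2_total M) (L2_class M f) (L2_class M h) = l2norm M (\<lambda>x. f x - h x)"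
  using assms by (intro L2_total_cdist) (simp_all add: L2_retract_class)

lemma Metric_space_L2_total: "Metric_space (carrier (L2 M)) (cdist (L2_total M))"
proof
  fix A B
  obtain f h where f: "f \<in> square_integrable M" "L2_retract M A = L2_class M f"
    and h: "h \<in> square_integrable M" "L2_retract M B = L2_class M h"
    using L2_retractE by metis
  show "0 \<le> cdist (L2_total M) A B"
    by (simp add: L2_total_cdist[OF f h] l2norm_nonneg)
  show "cdist (L2_total M) A B = cdist (L2_total M) B A"
    unfolding L2_total_cdist[OF f h] L2_total_cdist[OF h f] by (rule l2norm_minus_commute)
  show "cdist (L2_total M) A B = 0 \<longleftrightarrow> A = B" if "A \<in> carrier (L2 M)" "B \<in> carrier (L2 M)"
    unfolding L2_total_cdist[OF f h] l2norm_eq_0_iff[OF square_integrable_diff[OF f(1) h(1)]]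
    using f(2) h(2) L2_class_eq_iff[OF f(1) h(1)] that by (simp add: L2_retract_carrier)
next
  fix A B C
  obtain f h k where "f \<in> square_integrable M" "L2_retract M A = L2_class M f"
    and "h \<in> square_integrable M" "L2_retract M B = L2_class M h"
    and "k \<in> square_integrable M" "L2_retract M C = L2_class M k"
    using L2_retractE by metis
  then show "cdist (L2_total M) A C \<le> cdist (L2_total M) A B + cdist (L2_total M) B C"
    by (simp add: L2_total_cdist l2norm_triangle_diff)
qed

lemma mcomplete_L2_total: "Metric_space.mcomplete (carrier (L2 M)) (cdist (L2_total M))"
proof -
  interpret Metric_space "carrier (L2 M)" "cdist (L2_total M)" by (rule Metric_space_L2_total)
  show ?thesis unfolding mcomplete_def
  proof (intro allI impI)
    fix S assume S: "MCauchy S"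
    then have "\<forall>n. \<exists>f. f \<in> square_integrable M \<and> S n = L2_class M f"
      unfolding MCauchy_def by (metis L2_carrierE range_subsetD)
    then obtain s where s: "\<And>n. s n \<in> square_integrable M" "\<And>n. S n = L2_class M (s n)" by metis
    have Cau: "\<exists>n0. \<forall>n\<ge>n0. \<forall>m\<ge>n0. l2norm M (\<lambda>x. s n x - s m x) < e" if "e > 0" for e
      using S that unfolding MCauchy_def s by (simp add: L2_total_cdist_class s)
    obtain f where f: "f \<in> square_integrable M" "(\<lambda>n. l2norm M (\<lambda>x. s n x - f x)) \<longlonglongrightarrow> 0"
      by (rule l2norm_complete[OF s(1) Cau])
    have "limitin mtopology S (L2_class M f) sequentially"
      unfolding limitin_metric
    proof (intro conjI allI impI)
      fix e :: real assume "e > 0"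
      with f(2) have "\<forall>\<^sub>F n in sequentially. l2norm M (\<lambda>x. s n x - f x) < e"
        by (rule order_tendstoD)
      then show "\<forall>\<^sub>F n in sequentially. S n \<in> carrier (L2 M) \<and> cdist (L2_total M) (S n) (L2_class M f) < e"
        by eventually_elim (simp add: s f L2_total_cdist_class L2_class_in_carrier)
    qed (simp add: f L2_class_in_carrier)
    then show "\<exists>x. limitin mtopology S x sequentially" by blast
  qed
qed

lemma cring_complex_field: "cring complex_field"
proof (rule cringI)
  show "abelian_group complex_field"
  proof (rule abelian_groupI)
    fix x :: complex
    show "\<exists>y\<in>carrier complex_field. y \<oplus>\<^bsub>complex_field\<^esub> x = \<zero>\<^bsub>complex_field\<^esub>"
      by (rule bexI[of _ "- x"]) (auto simp: complex_field_def)
  qed (auto simp: complex_field_def)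
  show "Group.comm_monoid complex_field"
    by unfold_locales (auto simp: complex_field_def)
qed (auto simp: complex_field_def algebra_simps)

lemma complex_hilbert_space_L2_total: "complex_hilbert_space (L2_total M)"
proof -
  note sq = square_integrable_add square_integrable_cmult square_integrable_zero square_integrable_uminus
  note ops = L2_total_add L2_smult L2_cinner L2_zero L2_class_in_carrier sq
  interpret module complex_field "L2_total M"
  proof (rule moduleI)
    show "abelian_group (L2_total M)"
    proof (rule abelian_groupI)
      fix A assume "A \<in> carrier (L2_total M)"
      then obtain f where f: "f \<in> square_integrable M" "A = L2_class M f" by (auto elim: L2_carrierE)
      show "\<exists>B\<in>carrier (L2_total M). B \<oplus>\<^bsub>L2_total M\<^esub> A = \<zero>\<^bsub>L2_total M\<^esub>"
        by (rule bexI[of _ "L2_class M (\<lambda>x. - f x)"]) (simp_all add: f ops)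
    qed (auto elim!: L2_carrierE simp: ops add_ac)
  qed (auto elim!: L2_carrierE simp: ops algebra_simps cring_complex_field, auto simp: complex_field_def ops algebra_simps)
  show ?thesis
  proof
    fix A B C c assume "A \<in> carrier (L2_total M)" "B \<in> carrier (L2_total M)" "C \<in> carrier (L2_total M)"
    then obtain f h k where f: "f \<in> square_integrable M" "A = L2_class M f"
      and h: "h \<in> square_integrable M" "B = L2_class M h"
      and k: "k \<in> square_integrable M" "C = L2_class M k" by (auto elim!: L2_carrierE)
    note [simp] = f h k ops
    show "cinner (L2_total M) A B = cnj (cinner (L2_total M) B A)"
    proof -
      have "(\<integral>x. cnj (f x) * h x \<partial>M) = (\<integral>x. cnj (cnj (h x) * f x) \<partial>M)"
        by (simp add: mult.commute)
      also have "\<dots> = cnj (\<integral>x. cnj (h x) * f x \<partial>M)" by (rule Bochner_Integration.integral_cnj)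
      finally show ?thesis by simp
    qed
    show "cinner (L2_total M) A (B \<oplus>\<^bsub>L2_total M\<^esub> C) = cinner (L2_total M) A B + cinner (L2_total M) A C"
      by (simp add: ring_distribs integrable_cnj_mult)
    show "cinner (L2_total M) A (c \<odot>\<^bsub>L2_total M\<^esub> B) = c * cinner (L2_total M) A B"
      by (simp add: mult.left_commute[of _ c])
  next
    fix A assume "A \<in> carrier (L2_total M)"
    then obtain f where f: "f \<in> square_integrable M" "A = L2_class M f" by (auto elim!: L2_carrierE)
    show "0 \<le> Re (cinner (L2_total M) A A)"
      by (simp add: f L2_cinner integral_cnj_mult_self)
    assume "cinner (L2_total M) A A = 0"
    then have "l2norm M f = 0"
      by (simp add: f L2_cinner integral_cnj_mult_self l2norm_def)
    then show "A = \<zero>\<^bsub>L2_total M\<^esub>"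
      using l2norm_eq_0_iff[OF f(1)] by (simp add: f L2_zero L2_class_eq_iff square_integrable_zero)
  next
    show "Metric_space.mcomplete (carrier (L2_total M)) (cdist (L2_total M))"
      using mcomplete_L2_total by simp
  qed
qed

section \<open>Left translation on the square-integrable functions\<close>

lemma rep_space_left_regular [simp]:
  "rep_space (left_regular_rep G M) = L2 M"
  by (simp add: left_regular_rep_def)

text \<open>Invariance is separated from topology so that one interface covers the Haar measures of
  G and of N, the conjugates of the latter, and the measure of the quotient, whose \<sigma>-algebra
  on G is that of the saturated Borel sets.\<close>

locale left_invariant_measure = group G for G (structure) +
  fixes M :: "'a measure"
  assumes space_eq: "space M = carrier G"
    and translate_measurable: "g \<in> carrier G \<Longrightarrow> (\<lambda>x. g \<otimes> x) \<in> measurable M M"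
    and distr_translate: "g \<in> carrier G \<Longrightarrow> distr M M (\<lambda>x. g \<otimes> x) = M"
begin

lemma AE_translate:
  assumes "AE x in M. P x" "g \<in> carrier G"
  shows "AE x in M. P (g \<otimes> x)"
  using AE_distrD[OF translate_measurable[OF assms(2)], of P] assms(1)
  unfolding distr_translate[OF assms(2)] by blast

lemma integral_translate:
  fixes f :: "'a \<Rightarrow> 'c :: {banach, second_countable_topology}"
  assumes "f \<in> borel_measurable M" "g \<in> carrier G"
  shows "(\<integral>x. f (g \<otimes> x) \<partial>M) = (\<integral>x. f x \<partial>M)"
  using integral_distr[OF translate_measurable[OF assms(2)] assms(1)] by (simp add: distr_translate assms(2))

lemma nn_integral_translate:
  assumes "f \<in> borel_measurable M" "g \<in> carrier G"
  shows "(\<integral>\<^sup>+x. f (g \<otimes> x) \<partial>M) = (\<integral>\<^sup>+x. f x \<partial>M)"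
  using nn_integral_distr[OF translate_measurable[OF assms(2)], of f] assms by (simp add: distr_translate)

lemma measurable_translate:
  assumes "f \<in> measurable M N" "g \<in> carrier G"
  shows "(\<lambda>x. f (g \<otimes> x)) \<in> measurable M N"
  using measurable_compose[OF translate_measurable[OF assms(2)] assms(1)] .

lemma integrable_translate:
  fixes f :: "'a \<Rightarrow> 'c :: {banach, second_countable_topology}"
  assumes "integrable M f" "g \<in> carrier G"
  shows "integrable M (\<lambda>x. f (g \<otimes> x))"
  using integrable_distr[OF translate_measurable[OF assms(2)], of f] assms by (simp add: distr_translate)

lemma square_integrable_translate:
  assumes "f \<in> square_integrable M" "g \<in> carrier G"
  shows "(\<lambda>x. f (g \<otimes> x)) \<in> square_integrable M"
  using measurable_translate[OF square_integrableD(1)[OF assms(1)] assms(2)]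
    integrable_translate[OF square_integrableD(2)[OF assms(1)] assms(2)]
  by (rule square_integrableI)

lemma l2norm_translate:
  assumes "f \<in> borel_measurable M" "g \<in> carrier G"
  shows "l2norm M (\<lambda>x. f (g \<otimes> x)) = l2norm M f"
  using integral_translate[of "\<lambda>x. (cmod (f x))\<^sup>2", OF _ assms(2)] assms(1) by (simp add: l2norm_def)

lemma left_regular_rep_class:
  assumes "f \<in> square_integrable M" "g \<in> carrier G"
  shows "rep_map (left_regular_rep G M) g (L2_class M f) = L2_class M (\<lambda>x. f (inv g \<otimes> x))"
proof -
  have "AE x in M. L2_repr (L2_class M f) (inv g \<otimes> x) = f (inv g \<otimes> x)"
    using AE_translate[OF L2_repr_L2_class(2)[OF assms(1)], of "inv g"] assms(2)
    by (auto elim: eventually_mono)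
  then show ?thesis
    using L2_class_eqI[OF square_integrable_translate[OF L2_repr_L2_class(1)[OF assms(1)]]
        square_integrable_translate[OF assms(1)]] assms
    by (simp add: left_regular_rep_def L2_class_in_carrier)
qed

lemma left_regular_rep_mult:
  assumes "A \<in> carrier (L2 M)" "g \<in> carrier G" "h \<in> carrier G"
  shows "rep_map (left_regular_rep G M) (g \<otimes> h) A
    = rep_map (left_regular_rep G M) g (rep_map (left_regular_rep G M) h A)"
proof -
  obtain f where f: "f \<in> square_integrable M" "A = L2_class M f" using assms(1) by (rule L2_carrierE)
  have "f (inv (g \<otimes> h) \<otimes> x) = f (inv h \<otimes> (inv g \<otimes> x))" if "x \<in> space M" for x
    using that assms space_eq by (simp add: inv_mult_group m_assoc)
  then show ?thesis
    using assms f
    by (simp add: left_regular_rep_class square_integrable_translate)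
      (intro L2_class_eqI square_integrable_translate, auto)
qed

lemma left_regular_rep_one:
  assumes "A \<in> carrier (L2 M)"
  shows "rep_map (left_regular_rep G M) \<one> A = A"
proof -
  obtain f where f: "f \<in> square_integrable M" "A = L2_class M f" using assms(1) by (rule L2_carrierE)
  then show ?thesis
    by (simp add: left_regular_rep_class)
      (intro L2_class_eqI AE_I2, use f space_eq in \<open>auto intro: square_integrable_translate[of _ \<one>]\<close>)
qed

lemma left_regular_rep_closed:
  assumes "A \<in> carrier (L2 M)" "g \<in> carrier G"
  shows "rep_map (left_regular_rep G M) g A \<in> carrier (L2 M)"
  using assms(1) by (rule L2_carrierE)
    (use assms in \<open>simp add: left_regular_rep_class L2_class_in_carrier square_integrable_translate\<close>)

lemma diag_coeff_left_regular_rep: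
  assumes "f \<in> square_integrable M" "g \<in> carrier G"
  shows "diag_coeff (left_regular_rep G M) (L2_class M f) g = (\<integral>x. cnj (f x) * f (inv g \<otimes> x) \<partial>M)"
  using assms by (simp add: diag_coeff_def left_regular_rep_class L2_cinner square_integrable_translate)

section \<open>Left translation as a unitary representation\<close>

text \<open>The same operators on the repaired Hilbert space. The inner product is unchanged, hence
  so are the diagonal coefficients, and these are all that weak containment sees.\<close>

definition left_regular_rep_total :: "('a, ('a \<Rightarrow> complex) set) representation" where
  "left_regular_rep_total =
     \<lparr>rep_space = L2_total M, rep_map = rep_map (left_regular_rep G M)\<rparr>"

lemma diag_coeff_left_regular_rep_total:
  "diag_coeff left_regular_rep_total = diag_coeff (left_regular_rep G M)"
  by (simp add: fun_eq_iff diag_coeff_def left_regular_rep_total_def left_regular_rep_def)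

lemma left_regular_rep_in_unitary_group:
  assumes g: "g \<in> carrier G"
  shows "rep_map (left_regular_rep G M) g \<in> carrier (unitary_group (L2_total M))"
proof -
  let ?U = "rep_map (left_regular_rep G M)"
  have "?U g \<in> extensional (carrier (L2 M))"
    by (simp add: left_regular_rep_def)
  moreover have "bij_betw (?U g) (carrier (L2 M)) (carrier (L2 M))"
    by (rule bij_betw_byWitness[where f'="?U (inv g)"])
      (use g in \<open>auto simp: left_regular_rep_mult[symmetric] left_regular_rep_one left_regular_rep_closed\<close>)
  ultimately have "?U g \<in> Bij (carrier (L2_total M))" by (simp add: Bij_def)
  moreover have "?U g (A \<oplus>\<^bsub>L2_total M\<^esub> B) = ?U g A \<oplus>\<^bsub>L2_total M\<^esub> ?U g B"
    "?U g (c \<odot>\<^bsub>L2_total M\<^esub> A) = c \<odot>\<^bsub>L2_total M\<^esub> ?U g A"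
    "cinner (L2_total M) (?U g A) (?U g B) = cinner (L2_total M) A B"
    if AB: "A \<in> carrier (L2 M)" "B \<in> carrier (L2 M)" for A B c
  proof -
    obtain f h where f: "f \<in> square_integrable M" "A = L2_class M f"
      and h: "h \<in> square_integrable M" "B = L2_class M h" using AB by (metis L2_carrierE)
    note * = f h g left_regular_rep_class L2_total_add L2_smult L2_cinner square_integrable_add
      square_integrable_cmult square_integrable_translate
    show "?U g (A \<oplus>\<^bsub>L2_total M\<^esub> B) = ?U g A \<oplus>\<^bsub>L2_total M\<^esub> ?U g B"
      "?U g (c \<odot>\<^bsub>L2_total M\<^esub> A) = c \<odot>\<^bsub>L2_total M\<^esub> ?U g A"
      by (simp_all add: *)
    show "cinner (L2_total M) (?U g A) (?U g B) = cinner (L2_total M) A B"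
      using integral_translate[of "\<lambda>x. cnj (f x) * h x" "inv g"] integrable_cnj_mult[OF f(1) h(1)]
      by (simp add: * borel_measurable_integrable)
  qed
  ultimately show ?thesis by (simp add: unitary_group_def)
qed

text \<open>The operators are isometric, so joint continuity reduces to continuity of each orbit map
  at the identity: the distance from the g-translate of f to the h-translate of k is at most that of
  f to its translate by g^{-1}h plus that of f to k.\<close>

lemma unitary_rep_left_regular_rep_total:
  assumes T: "topological_group G T"
    and nz: "\<exists>f\<in>square_integrable M. l2norm M f \<noteq> 0"
    and cont: "\<And>f e. f \<in> square_integrable M \<Longrightarrow> e > 0 \<Longrightarrow>
      \<exists>V. openin T V \<and> \<one> \<in> V \<and> (\<forall>g\<in>V. l2norm M (\<lambda>x. f (inv g \<otimes> x) - f x) < e)"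
  shows "unitary_rep G T left_regular_rep_total"
proof -
  interpret topological_group G T by (rule T)
  interpret MS: Metric_space "carrier (L2 M)" "cdist (L2_total M)" by (rule Metric_space_L2_total)
  let ?U = "rep_map (left_regular_rep G M)"
  have "carrier (L2 M) \<noteq> {\<zero>\<^bsub>L2 M\<^esub>}"
  proof
    assume eq: "carrier (L2 M) = {\<zero>\<^bsub>L2 M\<^esub>}"
    obtain f where f: "f \<in> square_integrable M" "l2norm M f \<noteq> 0" using nz by blast
    then have "L2_class M f = L2_class M (\<lambda>x. 0)"
      using L2_class_in_carrier[OF f(1)] eq by (simp add: L2_zero)
    then show False
      using f l2norm_eq_0_iff[OF f(1)] L2_class_eq_iff[OF f(1) square_integrable_zero] by simp
  qed
  moreover have "?U \<in> hom G (unitary_group (L2_total M))"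
  proof (rule homI)
    fix g h assume g: "g \<in> carrier G" "h \<in> carrier G"
    have "?U (g \<otimes> h) = compose (carrier (L2 M)) (?U g) (?U h)"
    proof
      fix A
      show "?U (g \<otimes> h) A = compose (carrier (L2 M)) (?U g) (?U h) A"
        by (cases "A \<in> carrier (L2 M)")
          (use g in \<open>simp add: compose_def left_regular_rep_mult\<close>, simp add: compose_def left_regular_rep_def)
    qed
    moreover have "?U g \<in> Bij (carrier (L2 M))" "?U h \<in> Bij (carrier (L2 M))"
      using left_regular_rep_in_unitary_group[OF g(1)] left_regular_rep_in_unitary_group[OF g(2)]
      by (auto simp: unitary_group_def)
    ultimately show "?U (g \<otimes> h) = ?U g \<otimes>\<^bsub>unitary_group (L2_total M)\<^esub> ?U h"
      by (simp add: unitary_group_def BijGroup_def)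
  qed (rule left_regular_rep_in_unitary_group)
  moreover have "continuous_map (prod_topology T MS.mtopology) MS.mtopology (\<lambda>(g, \<xi>). ?U g \<xi>)"
    unfolding MS.continuous_map_to_metric
  proof (intro ballI allI impI)
    fix p and e :: real assume p: "p \<in> topspace (prod_topology T MS.mtopology)" and e: "e > 0"
    obtain g A where gA: "p = (g, A)" "g \<in> carrier G" "A \<in> carrier (L2 M)"
      using p topspace_eq by auto
    obtain f where f: "f \<in> square_integrable M" "A = L2_class M f" using gA(3) by (rule L2_carrierE)
    obtain V where V: "openin T V" "\<one> \<in> V"
      and Vsmall: "\<And>g. g \<in> V \<Longrightarrow> l2norm M (\<lambda>x. f (inv g \<otimes> x) - f x) < e / 2"
      using cont[OF f(1), of "e/2"] e by auto
    \<comment> \<open>The translate g V, a neighbourhood of g.\<close>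
    define W where "W = {h \<in> topspace T. inv g \<otimes> h \<in> V}"
    have "continuous_map T T (\<lambda>h. inv g \<otimes> h)"
    proof -
      have "continuous_map T (prod_topology T T) (\<lambda>h. (inv g, h))"
        using gA topspace_eq by (intro continuous_map_pairedI) auto
      from continuous_map_compose[OF this continuous_mult] show ?thesis by (simp add: o_def)
    qed
    then have W: "openin T W" using V(1) unfolding W_def by (rule openin_continuous_map_preimage)
    have gW: "g \<in> W" using gA V(2) topspace_eq by (simp add: W_def)
    let ?S = "W \<times> MS.mball A (e/2)"
    have "openin (prod_topology T MS.mtopology) ?S"
      using W by (simp add: openin_prod_Times_iff)
    moreover have "p \<in> ?S" using gA gW e by simp
    moreover have "(case q of (g, \<xi>) \<Rightarrow> ?U g \<xi>) \<in> MS.mball (case p of (g, \<xi>) \<Rightarrow> ?U g \<xi>) e"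
      if q: "q \<in> ?S" for q
    proof -
      obtain h B where hB: "q = (h, B)" "h \<in> W" "B \<in> MS.mball A (e/2)" using q by auto
      have h: "h \<in> carrier G" "inv g \<otimes> h \<in> V" using hB(2) topspace_eq by (auto simp: W_def)
      obtain k where k: "k \<in> square_integrable M" "B = L2_class M k"
        using hB(3) by (auto elim: L2_carrierE)
      let ?g = "\<lambda>x. f (inv g \<otimes> x)" and ?h = "\<lambda>x. f (inv h \<otimes> x)" and ?k = "\<lambda>x. k (inv h \<otimes> x)"
      have sq: "?g \<in> square_integrable M" "?h \<in> square_integrable M" "?k \<in> square_integrable M"
        using f k h gA by (auto intro: square_integrable_translate)
      have "l2norm M (\<lambda>x. f x - k x) < e / 2"
        using hB(3) by (simp add: f k L2_total_cdist_class)
      then have 1: "l2norm M (\<lambda>x. ?h x - ?k x) < e / 2"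
        using l2norm_translate[of "\<lambda>x. f x - k x" "inv h"] square_integrableD(1)[OF square_integrable_diff[OF f(1) k(1)]] h
        by simp
      have eq: "inv (inv g \<otimes> h) \<otimes> (inv g \<otimes> x) = inv h \<otimes> x" if "x \<in> carrier G" for x
      proof -
        have "g \<otimes> (inv g \<otimes> x) = x" using that gA by (simp add: m_assoc[symmetric])
        then show ?thesis using that h gA by (simp add: inv_mult_group m_assoc)
      qed
      \<comment> \<open>Because h^{-1}x = (g^{-1}h)^{-1}(g^{-1}x), invariance under x \<mapsto>
        g^{-1}x brings the comparison back to the identity.\<close>
      have "l2norm M (\<lambda>x. ?h x - ?g x) = l2norm M (\<lambda>x. f (inv (inv g \<otimes> h) \<otimes> (inv g \<otimes> x)) - f (inv g \<otimes> x))"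
        unfolding l2norm_def by (intro arg_cong[where f=sqrt] Bochner_Integration.integral_cong) (auto simp: eq space_eq)
      also have "\<dots> = l2norm M (\<lambda>x. f (inv (inv g \<otimes> h) \<otimes> x) - f x)"
        by (rule l2norm_translate[of "\<lambda>x. f (inv (inv g \<otimes> h) \<otimes> x) - f x"])
          (use gA h f in \<open>auto intro!: square_integrableD(1) square_integrable_diff square_integrable_translate\<close>)
      also have "\<dots> < e / 2" by (rule Vsmall[OF h(2)])
      finally have "l2norm M (\<lambda>x. ?g x - ?h x) < e / 2" by (simp add: l2norm_minus_commute[of M ?g])
      then have "l2norm M (\<lambda>x. ?g x - ?k x) < e"
        using l2norm_triangle_diff[OF sq(1,2,3)] 1 by linarith
      then show ?thesis
        using f k h gA sq hB by (simp add: left_regular_rep_class L2_class_in_carrier L2_total_cdist_class)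
    qed
    ultimately show "\<exists>S. openin (prod_topology T MS.mtopology) S \<and> p \<in> S \<and>
        (\<forall>q\<in>S. (case q of (g, \<xi>) \<Rightarrow> ?U g \<xi>) \<in> MS.mball (case p of (g, \<xi>) \<Rightarrow> ?U g \<xi>) e)"
      by blast
  qed
  ultimately show ?thesis
    by (simp add: unitary_rep_def left_regular_rep_total_def complex_hilbert_space_L2_total)
qed

end

section \<open>Borel sets of second-countable spaces\<close>

text \<open>Only the \<sigma>-algebra matters. It is packed into a measure with all values zero
  because measurability and product \<sigma>-algebras are formulated for measures.\<close>

definition borel_alg :: "'a topology \<Rightarrow> 'a measure" where
  "borel_alg S = measure_of (topspace S) {U. openin S U} (\<lambda>_. 0)"

lemma space_borel_alg [simp]: "space (borel_alg S) = topspace S"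
  by (simp add: borel_alg_def space_measure_of_conv)

lemma sets_borel_alg: "sets (borel_alg S) = sigma_sets (topspace S) {U. openin S U}"
  unfolding borel_alg_def by (rule sets_measure_of) (auto dest: openin_subset)

lemma openin_borel_alg: "openin S U \<Longrightarrow> U \<in> sets (borel_alg S)"
  by (simp add: sets_borel_alg sigma_sets.Basic)

lemma closedin_borel_alg:
  assumes "closedin S C" shows "C \<in> sets (borel_alg S)"
proof -
  have "space (borel_alg S) - (topspace S - C) \<in> sets (borel_alg S)"
    using assms by (intro sets.compl_sets openin_borel_alg) auto
  then show ?thesis using closedin_subset[OF assms] by (simp add: double_diff)
qed

lemma measurable_borel_algI:
  assumes "f \<in> space M \<rightarrow> topspace Y" "\<And>U. openin Y U \<Longrightarrow> f -` U \<inter> space M \<in> sets M"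
  shows "f \<in> measurable M (borel_alg Y)"
  unfolding borel_alg_def using assms
  by (intro measurable_measure_of) (auto dest: openin_subset)

lemma continuous_map_measurable_borel_alg:
  assumes f: "continuous_map S Y f"
  shows "f \<in> measurable (borel_alg S) (borel_alg Y)"
proof (rule measurable_borel_algI)
  show "f \<in> space (borel_alg S) \<rightarrow> topspace Y" using continuous_map_funspace[OF f] by simp
  fix U assume "openin Y U"
  then have "openin S {x \<in> topspace S. f x \<in> U}" by (rule openin_continuous_map_preimage[OF f])
  then show "f -` U \<inter> space (borel_alg S) \<in> sets (borel_alg S)"
    using openin_borel_alg[of S "{x \<in> topspace S. f x \<in> U}"] by (simp add: vimage_def Int_def conj_commute)
qed

text \<open>Countable bases make every open subset of the product a countable union of open
  rectangles. This is how second countability enters: it makes group multiplication measurable for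
  the product of the Borel \<sigma>-algebras, as Tonelli's theorem requires.\<close>

lemma openin_prod_in_sets:
  assumes S: "second_countable S" and Y: "second_countable Y" and U: "openin (prod_topology S Y) U"
  shows "U \<in> sets (borel_alg S \<Otimes>\<^sub>M borel_alg Y)"
proof -
  obtain B where B: "countable B" "\<And>V. V \<in> B \<Longrightarrow> openin S V"
    "\<And>U x. openin S U \<Longrightarrow> x \<in> U \<Longrightarrow> \<exists>V\<in>B. x \<in> V \<and> V \<subseteq> U"
    using S unfolding second_countable_def by metis
  obtain C where C: "countable C" "\<And>V. V \<in> C \<Longrightarrow> openin Y V"
    "\<And>U x. openin Y U \<Longrightarrow> x \<in> U \<Longrightarrow> \<exists>V\<in>C. x \<in> V \<and> V \<subseteq> U"
    using Y unfolding second_countable_def by metis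
  define P where "P = {p \<in> B \<times> C. fst p \<times> snd p \<subseteq> U}"
  have "U = (\<Union>p\<in>P. fst p \<times> snd p)"
  proof
    show "U \<subseteq> (\<Union>p\<in>P. fst p \<times> snd p)"
    proof
      fix z assume "z \<in> U"
      then obtain x y where z: "z = (x, y)" "(x, y) \<in> U" by (cases z) auto
      then obtain V W where "openin S V" "openin Y W" "x \<in> V" "y \<in> W" "V \<times> W \<subseteq> U"
        using U unfolding openin_prod_topology_alt by metis
      moreover obtain V' where "V' \<in> B" "x \<in> V'" "V' \<subseteq> V" using B(3) calculation by metis
      moreover obtain W' where "W' \<in> C" "y \<in> W'" "W' \<subseteq> W" using C(3) calculation by metis
      ultimately have "(V', W') \<in> P" "z \<in> V' \<times> W'" unfolding P_def z by auto
      then show "z \<in> (\<Union>p\<in>P. fst p \<times> snd p)" by force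
    qed
  qed (auto simp: P_def)
  moreover have "(\<Union>p\<in>P. fst p \<times> snd p) \<in> sets (borel_alg S \<Otimes>\<^sub>M borel_alg Y)"
  proof (rule sets.countable_UN'')
    show "countable P" unfolding P_def using B(1) C(1) by (auto intro: countable_subset[of _ "B \<times> C"])
  qed (auto simp: P_def intro!: pair_measureI openin_borel_alg B C)
  ultimately show ?thesis by simp
qed

lemma continuous_map_prod_measurable:
  assumes "second_countable S" "second_countable Y" and f: "continuous_map (prod_topology S Y) Z f"
  shows "f \<in> measurable (borel_alg S \<Otimes>\<^sub>M borel_alg Y) (borel_alg Z)"
proof (rule measurable_borel_algI)
  show "f \<in> space (borel_alg S \<Otimes>\<^sub>M borel_alg Y) \<rightarrow> topspace Z"
    using continuous_map_funspace[OF f] by (simp add: space_pair_measure)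
  fix U assume "openin Z U"
  then have "openin (prod_topology S Y) {x \<in> topspace (prod_topology S Y). f x \<in> U}"
    by (rule openin_continuous_map_preimage[OF f])
  from openin_prod_in_sets[OF assms(1,2) this]
  show "f -` U \<inter> space (borel_alg S \<Otimes>\<^sub>M borel_alg Y) \<in> sets (borel_alg S \<Otimes>\<^sub>M borel_alg Y)"
    by (simp add: vimage_def Int_def conj_commute space_pair_measure)
qed

text \<open>By local compactness, the members of a countable base that lie in compact sets still
  cover the space; \<open>U j\<close> is a finite union of them.\<close>

lemma compact_exhaustion:
  assumes S: "second_countable S" "locally_compact_space S"
  shows "\<exists>U K :: nat \<Rightarrow> 'a set. (\<forall>j. openin S (U j) \<and> U j \<subseteq> K j \<and> compactin S (K j)) \<and>
    incseq U \<and> (\<Union>j. U j) = topspace S"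
proof -
  obtain B where B: "countable B" "\<And>V. V \<in> B \<Longrightarrow> openin S V"
    "\<And>U x. openin S U \<Longrightarrow> x \<in> U \<Longrightarrow> \<exists>V\<in>B. x \<in> V \<and> V \<subseteq> U"
    using S(1) unfolding second_countable_def by metis
  \<comment> \<open>The empty set is added so that \<open>from_nat_into\<close> enumerates a
    nonempty family.\<close>
  define C where "C = insert {} {V \<in> B. \<exists>K. compactin S K \<and> V \<subseteq> K}"
  have C: "countable C" "C \<noteq> {}" using B(1) by (auto simp: C_def)
  have Copen: "openin S V" and "\<exists>K. compactin S K \<and> V \<subseteq> K" if "V \<in> C" for V
    using that B(2) by (auto simp: C_def intro: exI[of _ "{}"])
  then obtain k where k: "\<And>V. V \<in> C \<Longrightarrow> compactin S (k V)" "\<And>V. V \<in> C \<Longrightarrow> V \<subseteq> k V" by metis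
  define U K where "U = (\<lambda>j. \<Union>i\<le>j. from_nat_into C i)" and "K = (\<lambda>j. \<Union>i\<le>j. k (from_nat_into C i))"
  have i: "from_nat_into C i \<in> C" for i by (rule from_nat_into[OF C(2)])
  show ?thesis
  proof (rule exI[of _ U], rule exI[of _ K], intro conjI allI)
    show "openin S (U j)" for j unfolding U_def by (intro openin_Union) (auto intro: Copen i)
    show "U j \<subseteq> K j" for j unfolding U_def K_def using k(2)[OF i] by (intro UN_mono) auto
    show "compactin S (K j)" for j
      unfolding K_def by (intro compactin_Union) (auto intro: k(1) i)
    show "incseq U" unfolding U_def by (intro monoI UN_mono) auto
    have "topspace S \<subseteq> \<Union>C"
    proof
      fix x assume "x \<in> topspace S"
      then obtain V K where "openin S V" "compactin S K" "x \<in> V" "V \<subseteq> K"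
        using S(2) unfolding locally_compact_space_def by metis
      moreover then obtain W where "W \<in> B" "x \<in> W" "W \<subseteq> V" using B(3) by metis
      ultimately have "W \<in> C" unfolding C_def by blast
      then show "x \<in> \<Union>C" using \<open>x \<in> W\<close> by blast
    qed
    moreover have "\<Union>C = (\<Union>j. U j)"
    proof -
      have "\<Union>C = \<Union>(range (from_nat_into C))" using range_from_nat_into[OF C(2,1)] by simp
      also have "\<dots> = (\<Union>j. U j)" unfolding U_def by auto
      finally show ?thesis .
    qed
    moreover have "(\<Union>j. U j) \<subseteq> topspace S" unfolding U_def using Copen[OF i, THEN openin_subset] by blast
    ultimately show "(\<Union>j. U j) = topspace S" by blast
  qed
qed

section \<open>Haar measures on second-countable groups\<close>

locale sc_group = locally_compact_group G T for G (structure) and T +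
  assumes second_countable: "second_countable T"
begin

lemma measurable_mult [measurable (raw)]:
  assumes "f \<in> measurable M (borel_alg T)" "h \<in> measurable M (borel_alg T)"
  shows "(\<lambda>x. f x \<otimes> h x) \<in> measurable M (borel_alg T)"
  using measurable_compose[OF measurable_Pair[OF assms]
      continuous_map_prod_measurable[OF second_countable second_countable continuous_mult]]
  by simp

lemma measurable_inv [measurable (raw)]:
  assumes "f \<in> measurable M (borel_alg T)"
  shows "(\<lambda>x. inv f x) \<in> measurable M (borel_alg T)"
  using measurable_compose[OF assms continuous_map_measurable_borel_alg[OF continuous_inv]] .

lemma continuous_map_left: "g \<in> carrier G \<Longrightarrow> continuous_map T T (\<lambda>x. g \<otimes> x)"
  using continuous_map_compose[of T "prod_topology T T" "\<lambda>x. (g, x)", OF _ continuous_mult]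
  by (simp add: continuous_map_pairedI topspace_eq o_def)

lemma continuous_map_right: "g \<in> carrier G \<Longrightarrow> continuous_map T T (\<lambda>x. x \<otimes> g)"
  using continuous_map_compose[of T "prod_topology T T" "\<lambda>x. (x, g)", OF _ continuous_mult]
  by (simp add: continuous_map_pairedI topspace_eq o_def)

lemma openin_vimage_left:
  assumes "openin T U" "g \<in> carrier G"
  shows "openin T {x \<in> carrier G. g \<otimes> x \<in> U}"
  using openin_continuous_map_preimage[OF continuous_map_left[OF assms(2)] assms(1)] by (simp add: topspace_eq)

lemma openin_vimage_right:
  assumes "openin T U" "g \<in> carrier G"
  shows "openin T {x \<in> carrier G. x \<otimes> g \<in> U}"
  using openin_continuous_map_preimage[OF continuous_map_right[OF assms(2)] assms(1)] by (simp add: topspace_eq)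

lemma compactin_set_mult:
  assumes A: "compactin T A" and B: "compactin T B"
  shows "compactin T (A <#> B)"
proof -
  have "compactin (prod_topology T T) (A \<times> B)" using A B by (simp add: compactin_Times)
  moreover have "A <#> B = (\<lambda>(x, y). x \<otimes> y) ` (A \<times> B)" by (auto simp: set_mult_def)
  ultimately show ?thesis using image_compactin[OF _ continuous_mult] by simp
qed

lemma openin_carrier: "openin T U \<Longrightarrow> U \<subseteq> carrier G"
  using openin_subset topspace_eq by metis

lemma compactin_carrier: "compactin T K \<Longrightarrow> K \<subseteq> carrier G"
  using compactin_subset_topspace topspace_eq by metis

end

locale haar_group = sc_group G T for G (structure) and T +
  fixes \<mu> :: "'a measure"
  assumes haar: "left_haar_measure G T \<mu>"
begin

lemma sets_haar [measurable_cong]: "sets \<mu> = sets (borel_alg T)"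
  using haar by (simp add: left_haar_measure_def sets_borel_alg)

lemma space_haar: "space \<mu> = carrier G"
  using haar topspace_eq by (simp add: left_haar_measure_def)

lemma openin_sets_haar: "openin T U \<Longrightarrow> U \<in> sets \<mu>"
  by (simp add: sets_haar openin_borel_alg)

lemma compactin_sets_haar: "compactin T K \<Longrightarrow> K \<in> sets \<mu>"
  using compactin_imp_closedin[OF Hausdorff] by (simp add: sets_haar closedin_borel_alg)

lemma emeasure_compact: "compactin T K \<Longrightarrow> emeasure \<mu> K < \<infinity>"
  using haar by (simp add: left_haar_measure_def)

lemma haar_outer:
  "A \<in> sets \<mu> \<Longrightarrow> emeasure \<mu> A = (INF U \<in> {U. openin T U \<and> A \<subseteq> U}. emeasure \<mu> U)"
  using haar unfolding left_haar_measure_def by blast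

lemma haar_inner:
  "openin T U \<Longrightarrow> emeasure \<mu> U = (SUP K \<in> {K. compactin T K \<and> K \<subseteq> U}. emeasure \<mu> K)"
  using haar unfolding left_haar_measure_def by blast

lemma emeasure_subset_compact:
  assumes "U \<subseteq> K" "compactin T K" shows "emeasure \<mu> U < \<infinity>"
  using emeasure_mono[OF assms(1) compactin_sets_haar[OF assms(2)]] emeasure_compact[OF assms(2)]
  by (rule le_less_trans)

lemma vimage_translate_eq_coset:
  assumes "g \<in> carrier G" "A \<subseteq> carrier G"
  shows "{x \<in> carrier G. g \<otimes> x \<in> A} = inv g <# A"
  using assms by (force simp: l_coset_def m_assoc[symmetric])

sublocale left_invariant_measure G \<mu>
proof
  show "space \<mu> = carrier G" by (rule space_haar)
  fix g assume g: "g \<in> carrier G"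
  have c: "g \<in> space (borel_alg T)" using g by (simp add: topspace_eq)
  show m: "(\<lambda>x. g \<otimes> x) \<in> measurable \<mu> \<mu>"
    using c by measurable
  show "distr \<mu> \<mu> (\<lambda>x. g \<otimes> x) = \<mu>"
  proof (rule measure_eqI)
    fix A assume A: "A \<in> sets (distr \<mu> \<mu> (\<lambda>x. g \<otimes> x))"
    then have "A \<subseteq> carrier G" using sets.sets_into_space[of A \<mu>] space_haar by simp
    have "emeasure (distr \<mu> \<mu> (\<lambda>x. g \<otimes> x)) A = emeasure \<mu> ((\<lambda>x. g \<otimes> x) -` A \<inter> space \<mu>)"
      using A by (simp add: emeasure_distr[OF m])
    also have "(\<lambda>x. g \<otimes> x) -` A \<inter> space \<mu> = inv g <# A"
      unfolding vimage_translate_eq_coset[OF g \<open>A \<subseteq> carrier G\<close>, symmetric] by (auto simp: space_haar)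
    also have "emeasure \<mu> \<dots> = emeasure \<mu> A"
      using haar g A by (simp add: left_haar_measure_def)
    finally show "emeasure (distr \<mu> \<mu> (\<lambda>x. g \<otimes> x)) A = emeasure \<mu> A" .
  qed simp
qed

sublocale sigma_finite_measure \<mu>
proof
  obtain U K where UK: "\<And>j::nat. openin T (U j)" "\<And>j. U j \<subseteq> K j" "\<And>j. compactin T (K j)"
    "(\<Union>j. U j) = topspace T"
    using compact_exhaustion[OF second_countable locally_compact] by metis
  have "emeasure \<mu> (U j) \<noteq> \<infinity>" for j using emeasure_subset_compact[OF UK(2,3)[of j]] by simp
  then show "\<exists>A. countable A \<and> A \<subseteq> sets \<mu> \<and> \<Union>A = space \<mu> \<and> (\<forall>a\<in>A. emeasure \<mu> a \<noteq> \<infinity>)"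
    using UK(4) openin_sets_haar[OF UK(1)]
    by (intro exI[of _ "range U"]) (auto simp: space_haar topspace_eq)
qed

section \<open>Positivity on open sets and uniqueness up to a factor\<close>

text \<open>Finitely many translates of U cover any compact set. If U were null, all compact sets
  would be null, and inner regularity would make the whole group null.\<close>

lemma emeasure_open_pos:
  assumes U: "openin T U" "U \<noteq> {}"
  shows "emeasure \<mu> U > 0"
proof (rule ccontr)
  assume "\<not> emeasure \<mu> U > 0"
  then have U0: "emeasure \<mu> U = 0" by simp
  obtain u where u: "u \<in> U" using U(2) by blast
  then have uc: "u \<in> carrier G" using openin_carrier[OF U(1)] by blast
  \<comment> \<open>The translate g u^{-1} U, which contains g because u lies in U.\<close>
  let ?V = "\<lambda>g. {x \<in> carrier G. (u \<otimes> inv g) \<otimes> x \<in> U}"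
  have V: "openin T (?V g)" "emeasure \<mu> (?V g) = 0" if g: "g \<in> carrier G" for g
  proof -
    have k: "u \<otimes> inv g \<in> carrier G" using g uc by simp
    show "openin T (?V g)" by (rule openin_vimage_left[OF U(1) k])
    have "emeasure \<mu> (?V g) = emeasure (distr \<mu> \<mu> (\<lambda>x. (u \<otimes> inv g) \<otimes> x)) U"
      by (subst emeasure_distr[OF translate_measurable[OF k] openin_sets_haar[OF U(1)]])
        (auto simp: space_haar intro!: arg_cong[where f="emeasure \<mu>"])
    then show "emeasure \<mu> (?V g) = 0" using U0 distr_translate[OF k] by simp
  qed
  have "emeasure \<mu> K = 0" if K: "compactin T K" for K
  proof -
    have cov: "K \<subseteq> \<Union>(?V ` K)"
    proof
      fix x assume x: "x \<in> K"
      then have "x \<in> carrier G" using compactin_carrier[OF K] by blast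
      then have "x \<in> ?V x" using u uc by (simp add: m_assoc)
      then show "x \<in> \<Union>(?V ` K)" using x by blast
    qed
    have op: "openin T W" if "W \<in> ?V ` K" for W using that V(1) compactin_carrier[OF K] by blast
    obtain F where F: "finite F" "F \<subseteq> ?V ` K" "K \<subseteq> \<Union>F"
      using compactinD[OF K op cov] by blast
    have "W \<in> null_sets \<mu>" if "W \<in> F" for W
    proof -
      obtain g where "g \<in> carrier G" "W = ?V g"
        using \<open>W \<in> F\<close> F(2) compactin_carrier[OF K] by blast
      then show ?thesis using V[of g] openin_sets_haar by (auto intro!: null_setsI)
    qed
    then have "(\<Union>W\<in>F. W) \<in> null_sets \<mu>"
      using F(1) by (intro null_sets_UN') (auto intro: countable_finite)
    then show ?thesis using F(3) compactin_sets_haar[OF K] emeasure_mono[of K "\<Union>F" \<mu>] by (auto simp: null_sets_def)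
  qed
  then have "(SUP K \<in> {K. compactin T K \<and> K \<subseteq> topspace T}. emeasure \<mu> K) = 0"
    by (intro antisym SUP_least) auto
  then have "emeasure \<mu> (topspace T) = 0"
    using haar_inner[OF openin_topspace] by simp
  moreover have "emeasure \<mu> (space \<mu>) \<noteq> 0" using haar unfolding left_haar_measure_def by blast
  ultimately show False by (simp only: space_haar topspace_eq)
qed

text \<open>Tonelli and two left translations: x becomes y^{-1}x in the integral over \<nu>, which
  turns x^{-1} into x^{-1}y, and afterwards y becomes x y in the integral over \<mu>. The identity
  yields uniqueness of Haar measure and, for two copies of the same measure, the effect of
  inversion.\<close>

lemma nn_integral_right_translate:
  assumes \<nu>: "sets \<nu> = sets (borel_alg T)" "sigma_finite_measure \<nu>" "left_invariant_measure G \<nu>"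
    and f [measurable]: "f \<in> borel_measurable (borel_alg T)" and k [measurable]: "k \<in> borel_measurable (borel_alg T)"
  shows "(\<integral>\<^sup>+x. (\<integral>\<^sup>+y. f (y \<otimes> x) \<partial>\<mu>) * k (inv x) \<partial>\<nu>) = (\<integral>\<^sup>+x. f x \<partial>\<nu>) * (\<integral>\<^sup>+x. k x \<partial>\<mu>)"
proof -
  interpret nu: left_invariant_measure G \<nu> by (rule \<nu>(3))
  interpret nu: sigma_finite_measure \<nu> by (rule \<nu>(2))
  interpret P: pair_sigma_finite \<nu> \<mu> ..
  note [measurable_cong] = \<nu>(1)
  have sp: "space \<nu> = carrier G" by (rule nu.space_eq)
  have "(\<integral>\<^sup>+x. (\<integral>\<^sup>+y. f (y \<otimes> x) \<partial>\<mu>) * k (inv x) \<partial>\<nu>) = (\<integral>\<^sup>+x. (\<integral>\<^sup>+y. f (y \<otimes> x) * k (inv x) \<partial>\<mu>) \<partial>\<nu>)"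
  proof (rule nn_integral_cong)
    fix x assume "x \<in> space \<nu>"
    then have [measurable]: "x \<in> space (borel_alg T)" by (simp add: sp topspace_eq)
    show "(\<integral>\<^sup>+y. f (y \<otimes> x) \<partial>\<mu>) * k (inv x) = (\<integral>\<^sup>+y. f (y \<otimes> x) * k (inv x) \<partial>\<mu>)"
      by (rule nn_integral_multc[symmetric]) measurable
  qed
  also have "\<dots> = (\<integral>\<^sup>+y. (\<integral>\<^sup>+x. f (y \<otimes> x) * k (inv x) \<partial>\<nu>) \<partial>\<mu>)"
    by (rule P.Fubini'[symmetric]) measurable
  also have "\<dots> = (\<integral>\<^sup>+y. (\<integral>\<^sup>+x. f x * k (inv x \<otimes> y) \<partial>\<nu>) \<partial>\<mu>)"
  proof (rule nn_integral_cong)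
    fix y assume "y \<in> space \<mu>"
    then have y: "y \<in> carrier G" by (simp add: space_haar)
    then have [measurable]: "y \<in> space (borel_alg T)" by (simp add: topspace_eq)
    have "(\<integral>\<^sup>+x. f (y \<otimes> x) * k (inv x) \<partial>\<nu>) = (\<integral>\<^sup>+x. f (y \<otimes> x) * k (inv (y \<otimes> x) \<otimes> y) \<partial>\<nu>)"
      by (rule nn_integral_cong) (simp add: sp y inv_mult_group m_assoc)
    also have "\<dots> = (\<integral>\<^sup>+x. f x * k (inv x \<otimes> y) \<partial>\<nu>)"
      by (rule nu.nn_integral_translate[OF _ y, of "\<lambda>x. f x * k (inv x \<otimes> y)"]) measurable
    finally show "(\<integral>\<^sup>+x. f (y \<otimes> x) * k (inv x) \<partial>\<nu>) = (\<integral>\<^sup>+x. f x * k (inv x \<otimes> y) \<partial>\<nu>)" .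
  qed
  also have "\<dots> = (\<integral>\<^sup>+x. (\<integral>\<^sup>+y. f x * k (inv x \<otimes> y) \<partial>\<mu>) \<partial>\<nu>)"
    by (rule P.Fubini') measurable
  also have "\<dots> = (\<integral>\<^sup>+x. f x * (\<integral>\<^sup>+y. k y \<partial>\<mu>) \<partial>\<nu>)"
  proof (rule nn_integral_cong)
    fix x assume "x \<in> space \<nu>"
    then have x: "x \<in> carrier G" by (simp add: sp)
    then have [measurable]: "x \<in> space (borel_alg T)" by (simp add: topspace_eq)
    have "(\<integral>\<^sup>+y. f x * k (inv x \<otimes> y) \<partial>\<mu>) = f x * (\<integral>\<^sup>+y. k (inv x \<otimes> y) \<partial>\<mu>)"
      by (rule nn_integral_cmult) measurable
    then show "(\<integral>\<^sup>+y. f x * k (inv x \<otimes> y) \<partial>\<mu>) = f x * (\<integral>\<^sup>+y. k y \<partial>\<mu>)"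
      using nn_integral_translate[of k "inv x"] x by (simp add: measurable_cong_sets[OF sets_haar refl])
  qed
  also have "\<dots> = (\<integral>\<^sup>+x. f x \<partial>\<nu>) * (\<integral>\<^sup>+x. k x \<partial>\<mu>)"
    by (rule nn_integral_multc) measurable
  finally show ?thesis .
qed

text \<open>The set is F x^{-1}: open, nonempty and inside a compact set. Its measure may therefore
  serve as a denominator in \<open>ennreal\<close>.\<close>

lemma emeasure_right_translate_pos_finite:
  assumes F: "openin T F" "F \<noteq> {}" "F \<subseteq> K" "compactin T K" and x: "x \<in> carrier G"
  shows "0 < emeasure \<mu> {y \<in> carrier G. y \<otimes> x \<in> F}" "emeasure \<mu> {y \<in> carrier G. y \<otimes> x \<in> F} < \<infinity>"
proof -
  obtain u where u: "u \<in> F" "u \<in> carrier G" using F openin_carrier by blast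
  then have "u \<otimes> inv x \<in> {y \<in> carrier G. y \<otimes> x \<in> F}" using x by (simp add: m_assoc)
  then show "0 < emeasure \<mu> {y \<in> carrier G. y \<otimes> x \<in> F}"
    by (intro emeasure_open_pos openin_vimage_right F x) blast
  have "compactin T ((\<lambda>y. y \<otimes> inv x) ` K)"
    using image_compactin[OF F(4) continuous_map_right] x by simp
  moreover have "{y \<in> carrier G. y \<otimes> x \<in> F} \<subseteq> (\<lambda>y. y \<otimes> inv x) ` K"
  proof
    fix y assume y: "y \<in> {y \<in> carrier G. y \<otimes> x \<in> F}"
    then have "y = (y \<otimes> x) \<otimes> inv x" "y \<otimes> x \<in> K" using x F(3) by (auto simp: m_assoc)
    then show "y \<in> (\<lambda>y. y \<otimes> inv x) ` K" by blast
  qed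
  ultimately show "emeasure \<mu> {y \<in> carrier G. y \<otimes> x \<in> F} < \<infinity>"
    using emeasure_subset_compact by blast
qed

text \<open>
  Uniqueness of Haar measure: by the previous lemma, both integrals are multiples of the same
  integral \<open>\<integral> k (inv x) / h (inv x) \<partial>\<mu>\<close> with \<open>h x = \<mu> (F x\<inverse>)\<close>.
\<close>

lemma haar_unique:
  assumes \<nu>: "sets \<nu> = sets (borel_alg T)" "sigma_finite_measure \<nu>" "left_invariant_measure G \<nu>"
    and F: "openin T F" "F \<noteq> {}" "F \<subseteq> K" "compactin T K"
    and k [measurable]: "k \<in> borel_measurable (borel_alg T)"
  shows "(\<integral>\<^sup>+x. k x \<partial>\<nu>) * emeasure \<mu> F = emeasure \<nu> F * (\<integral>\<^sup>+x. k x \<partial>\<mu>)"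
proof -
  have Fs [measurable]: "F \<in> sets (borel_alg T)" using F(1) by (rule openin_borel_alg)
  define h where "h = (\<lambda>x. \<integral>\<^sup>+y. indicator F (y \<otimes> x) \<partial>\<mu>)"
  have h [measurable]: "h \<in> borel_measurable (borel_alg T)"
    unfolding h_def by measurable
  have heq: "h x = emeasure \<mu> {y \<in> carrier G. y \<otimes> x \<in> F}" if x: "x \<in> carrier G" for x
  proof -
    have "h x = (\<integral>\<^sup>+y. indicator {y \<in> carrier G. y \<otimes> x \<in> F} y \<partial>\<mu>)"
      unfolding h_def by (rule nn_integral_cong) (simp add: indicator_def space_haar)
    also have "\<dots> = emeasure \<mu> {y \<in> carrier G. y \<otimes> x \<in> F}"
      by (rule nn_integral_indicator) (rule openin_sets_haar[OF openin_vimage_right[OF F(1) x]])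
    finally show ?thesis .
  qed
  define c where "c = (\<integral>\<^sup>+x. k (inv x) / h (inv x) \<partial>\<mu>)"
  have main: "(\<integral>\<^sup>+x. k x \<partial>\<nu>') = emeasure \<nu>' F * c"
    if \<nu>': "sets \<nu>' = sets (borel_alg T)" "sigma_finite_measure \<nu>'" "left_invariant_measure G \<nu>'" for \<nu>'
  proof -
    have sp: "space \<nu>' = carrier G" by (rule left_invariant_measure.space_eq[OF \<nu>'(3)])
    have "(\<integral>\<^sup>+x. k x \<partial>\<nu>') = (\<integral>\<^sup>+x. h x * (k (inv (inv x)) / h (inv (inv x))) \<partial>\<nu>')"
    proof (rule nn_integral_cong)
      fix x assume "x \<in> space \<nu>'"
      then have x: "x \<in> carrier G" using sp by simp
      have "h x \<noteq> 0" "h x \<noteq> \<infinity>"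
        using emeasure_right_translate_pos_finite[OF F x] unfolding heq[OF x] by simp_all
      then show "k x = h x * (k (inv (inv x)) / h (inv (inv x)))"
        using x ennreal_mult_divide_eq[of "h x" "k x"] by (simp add: ennreal_times_divide mult.commute)
    qed
    also have "\<dots> = (\<integral>\<^sup>+x. indicator F x \<partial>\<nu>') * c"
      unfolding h_def c_def
      by (rule nn_integral_right_translate[OF \<nu>', where f="indicator F" and k="\<lambda>x. k (inv x) / (\<integral>\<^sup>+y. indicator F (y \<otimes> inv x) \<partial>\<mu>)"]) measurable
    also have "(\<integral>\<^sup>+x. indicator F x \<partial>\<nu>') = emeasure \<nu>' F"
      using \<nu>'(1) Fs by simp
    finally show ?thesis .
  qed
  have "(\<integral>\<^sup>+x. k x \<partial>\<mu>) = emeasure \<mu> F * c"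
    by (rule main) (rule sets_haar, unfold_locales)
  then show ?thesis using main[OF \<nu>] by (simp add: mult_ac)
qed

section \<open>Continuity of translation in the mean\<close>

text \<open>Continuity at the identity in the L1 norm. L1 rather than L2 is the form that transfers
  to the quotient: an integral there becomes an integral over G against \<open>\<beta>\<close>, and
  the function translated is the product of \<open>\<beta>\<close> with an integrable
  function.\<close>

definition translation_continuous :: "('a \<Rightarrow> 'c :: {banach, second_countable_topology}) \<Rightarrow> bool" where
  "translation_continuous u \<longleftrightarrow> (\<forall>e>0. \<exists>V. openin T V \<and> \<one> \<in> V \<and>
     (\<forall>g\<in>V. (\<integral>x. norm (u (g \<otimes> x) - u x) \<partial>\<mu>) < e))"

lemma translation_continuous_approx:
  fixes u :: "'a \<Rightarrow> 'c :: {banach, second_countable_topology}"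
  assumes u: "integrable \<mu> u"
    and ap: "\<And>e. e > 0 \<Longrightarrow> \<exists>v. integrable \<mu> v \<and> translation_continuous v \<and> (\<integral>x. norm (u x - v x) \<partial>\<mu>) < e"
  shows "translation_continuous u"
  unfolding translation_continuous_def
proof (intro allI impI)
  fix e :: real assume "e > 0"
  then obtain v where v: "integrable \<mu> v" "translation_continuous v" "(\<integral>x. norm (u x - v x) \<partial>\<mu>) < e/3"
    using ap[of "e/3"] by auto
  then obtain V where V: "openin T V" "\<one> \<in> V" "\<And>g. g \<in> V \<Longrightarrow> (\<integral>x. norm (v (g \<otimes> x) - v x) \<partial>\<mu>) < e/3"
    using \<open>e > 0\<close> unfolding translation_continuous_def by (metis divide_pos_pos zero_less_numeral)
  have "(\<integral>x. norm (u (g \<otimes> x) - u x) \<partial>\<mu>) < e" if "g \<in> V" for g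
  proof -
    have g: "g \<in> carrier G" using that openin_carrier[OF V(1)] by blast
    note i = integrable_translate[OF u g] integrable_translate[OF v(1) g] u v(1)
    have "(\<integral>x. norm (u (g \<otimes> x) - u x) \<partial>\<mu>) \<le>
       (\<integral>x. norm (u (g \<otimes> x) - v (g \<otimes> x)) + norm (v (g \<otimes> x) - v x) + norm (u x - v x) \<partial>\<mu>)"
    proof (rule integral_mono)
      show "norm (u (g \<otimes> x) - u x) \<le> norm (u (g \<otimes> x) - v (g \<otimes> x)) + norm (v (g \<otimes> x) - v x) + norm (u x - v x)" for x
        using norm_triangle_ineq[of "u (g \<otimes> x) - v (g \<otimes> x) + (v (g \<otimes> x) - v x)" "v x - u x"]
          norm_triangle_ineq[of "u (g \<otimes> x) - v (g \<otimes> x)" "v (g \<otimes> x) - v x"]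
        by (simp add: norm_minus_commute)
    qed (use i in auto)
    also have "\<dots> = (\<integral>x. norm (u (g \<otimes> x) - v (g \<otimes> x)) \<partial>\<mu>) + (\<integral>x. norm (v (g \<otimes> x) - v x) \<partial>\<mu>) + (\<integral>x. norm (u x - v x) \<partial>\<mu>)"
      using i by simp
    also have "(\<integral>x. norm (u (g \<otimes> x) - v (g \<otimes> x)) \<partial>\<mu>) = (\<integral>x. norm (u x - v x) \<partial>\<mu>)"
      using u v(1) by (intro integral_translate[of "\<lambda>x. norm (u x - v x)"] g) simp
    finally show ?thesis using v(3) V(3)[OF that] by linarith
  qed
  then show "\<exists>V. openin T V \<and> \<one> \<in> V \<and> (\<forall>g\<in>V. (\<integral>x. norm (u (g \<otimes> x) - u x) \<partial>\<mu>) < e)"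
    using V by blast
qed

lemma outer_approx:
  assumes A: "A \<in> sets \<mu>" "emeasure \<mu> A < \<infinity>" "e > 0"
  obtains V where "openin T V" "A \<subseteq> V" "emeasure \<mu> V < \<infinity>" "measure \<mu> V < measure \<mu> A + e"
proof -
  have *: "emeasure \<mu> A = ennreal (measure \<mu> A)" using A(2) by (simp add: emeasure_eq_ennreal_measure)
  have "emeasure \<mu> A < ennreal (measure \<mu> A + e)"
    using A(3) unfolding * by (simp add: ennreal_lessI add_nonneg_pos)
  then obtain V where V: "openin T V" "A \<subseteq> V" "emeasure \<mu> V < ennreal (measure \<mu> A + e)"
    unfolding haar_outer[OF A(1)] INF_less_iff by blast
  moreover have "emeasure \<mu> V < \<infinity>" using V(3) by (rule less_trans) simp
  moreover have "measure \<mu> V < measure \<mu> A + e"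
    using V(3) A(3) \<open>emeasure \<mu> V < \<infinity>\<close> by (simp add: emeasure_eq_ennreal_measure ennreal_less_iff del: ennreal_plus)
  ultimately show ?thesis using that by blast
qed

lemma inner_approx:
  assumes V: "openin T V" "emeasure \<mu> V < \<infinity>" "e > 0"
  obtains K where "compactin T K" "K \<subseteq> V" "measure \<mu> V < measure \<mu> K + e"
proof (rule ccontr)
  assume "\<not> thesis"
  with that have *: "measure \<mu> K \<le> measure \<mu> V - e" if "compactin T K" "K \<subseteq> V" for K
    using \<open>compactin T K\<close> \<open>K \<subseteq> V\<close> by force
  from this[of "{}"] have "0 \<le> measure \<mu> V - e" by simp
  have "emeasure \<mu> V \<le> ennreal (measure \<mu> V - e)"
    unfolding haar_inner[OF V(1)]
  proof (rule SUP_least)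
    fix K assume K: "K \<in> {K. compactin T K \<and> K \<subseteq> V}"
    then have "emeasure \<mu> K = ennreal (measure \<mu> K)"
      using emeasure_compact[of K] by (simp add: emeasure_eq_ennreal_measure)
    then show "emeasure \<mu> K \<le> ennreal (measure \<mu> V - e)" using *[of K] K by (simp add: ennreal_leI)
  qed
  then show False
    using V(2,3) \<open>0 \<le> measure \<mu> V - e\<close> by (simp add: emeasure_eq_ennreal_measure)
qed

text \<open>Outer regularity supplies an open V around K with little excess measure, and the tube
  lemma a neighbourhood U of the identity with U K inside V. For g in U, both K and g K have measure
  \<mu> K and lie in V, so they differ by at most twice the excess.\<close>

lemma translation_continuous_compact:
  assumes K: "compactin T K"
  shows "translation_continuous (indicator K :: 'a \<Rightarrow> real)"
  unfolding translation_continuous_def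
proof (intro allI impI)
  fix e :: real assume e: "e > 0"
  have Ks: "K \<in> sets \<mu>" "emeasure \<mu> K < \<infinity>" using K by (simp_all add: compactin_sets_haar emeasure_compact[simplified])
  obtain V where V: "openin T V" "K \<subseteq> V" "emeasure \<mu> V < \<infinity>" "measure \<mu> V < measure \<mu> K + e/2"
    using outer_approx[OF Ks, of "e/2"] e by auto
  have Vs: "V \<in> sets \<mu>" by (rule openin_sets_haar[OF V(1)])
  let ?W = "{p \<in> topspace (prod_topology T T). (case p of (x, y) \<Rightarrow> x \<otimes> y) \<in> V}"
  have "openin (prod_topology T T) ?W" by (rule openin_continuous_map_preimage[OF continuous_mult V(1)])
  moreover have "{\<one>} \<times> K \<subseteq> ?W"
    using compactin_carrier[OF K] V(2) by (auto simp: topspace_eq subset_iff)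
  ultimately obtain U U' where U: "openin T U" "\<one> \<in> U" "K \<subseteq> U'" "U \<times> U' \<subseteq> ?W"
    using tube_lemma_right[of T T ?W K \<one>] K topspace_eq by auto
  have "(\<integral>x. norm (indicator K (g \<otimes> x) - indicator K x :: real) \<partial>\<mu>) < e" if "g \<in> U" for g
  proof -
    have g: "g \<in> carrier G" using that openin_carrier[OF U(1)] by blast
    have gK: "g \<otimes> x \<in> V" if "x \<in> K" for x
    proof -
      have "(g, x) \<in> ?W" using U(3,4) that \<open>g \<in> U\<close> by blast
      then show ?thesis by simp
    qed
    let ?f = "\<lambda>x. norm (indicator K x - indicator K (inv g \<otimes> x) :: real)"
    have iK: "integrable \<mu> (indicator K :: 'a \<Rightarrow> real)" and iV: "integrable \<mu> (indicator V :: 'a \<Rightarrow> real)"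
      using Ks Vs V(3) by auto
    note iKg = integrable_translate[OF iK inv_closed[OF g]]
    \<comment> \<open>Translation by g replaces the comparison of g^{-1}K with K by that of K with g
      K; the latter is contained in V.\<close>
    have "(\<integral>x. norm (indicator K (g \<otimes> x) - indicator K x :: real) \<partial>\<mu>) = (\<integral>x. ?f (g \<otimes> x) \<partial>\<mu>)"
      by (rule Bochner_Integration.integral_cong) (simp_all add: space_haar g m_assoc[symmetric])
    also have "\<dots> = (\<integral>x. ?f x \<partial>\<mu>)"
      using iK iKg by (intro integral_translate[of ?f] g) (auto intro: borel_measurable_integrable)
    also have "\<dots> \<le> (\<integral>x. (indicator V x - indicator K x) + (indicator V x - indicator K (inv g \<otimes> x)) \<partial>\<mu>)"
    proof (rule integral_mono)
      fix x assume "x \<in> space \<mu>"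
      then have x: "x \<in> carrier G" by (simp add: space_haar)
      have "x \<in> V" if "inv g \<otimes> x \<in> K" using gK[OF that] x g by (simp add: m_assoc[symmetric])
      then show "?f x \<le> (indicator V x - indicator K x) + (indicator V x - indicator K (inv g \<otimes> x))"
        using V(2) by (auto simp: indicator_def)
    qed (use iK iV iKg in auto)
    also have "\<dots> = (measure \<mu> V - measure \<mu> K) + (measure \<mu> V - (\<integral>x. indicator K (inv g \<otimes> x) \<partial>\<mu>))"
      using iK iV iKg Ks Vs sets.sets_into_space by (simp add: Int_absorb2)
    also have "(\<integral>x. indicator K (inv g \<otimes> x) \<partial>\<mu>) = measure \<mu> K"
      using integral_translate[of "indicator K :: 'a \<Rightarrow> real" "inv g"] g iK Ks sets.sets_into_space
      by (simp add: Int_absorb2)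
    finally show ?thesis using V(4) by simp
  qed
  then show "\<exists>V. openin T V \<and> \<one> \<in> V \<and> (\<forall>g\<in>V. (\<integral>x. norm (indicator K (g \<otimes> x) - indicator K x :: real) \<partial>\<mu>) < e)"
    using U(1,2) by blast
qed

text \<open>Inner regularity is available for open sets, so the compact set K is taken inside an
  open hull V of A and not inside A. Both A and K miss less than e/2 of V, hence differ from each
  other by less than e.\<close>

lemma translation_continuous_indicator:
  assumes A: "A \<in> sets \<mu>" "emeasure \<mu> A < \<infinity>"
  shows "translation_continuous (indicator A :: 'a \<Rightarrow> real)"
proof (rule translation_continuous_approx)
  show iA: "integrable \<mu> (indicator A :: 'a \<Rightarrow> real)" using A by auto
  fix e :: real assume e: "e > 0"
  obtain V where V: "openin T V" "A \<subseteq> V" "emeasure \<mu> V < \<infinity>" "measure \<mu> V < measure \<mu> A + e/2"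
    using outer_approx[OF A, of "e/2"] e by auto
  obtain K where K: "compactin T K" "K \<subseteq> V" "measure \<mu> V < measure \<mu> K + e/2"
    using inner_approx[OF V(1,3), of "e/2"] e by auto
  have s: "V \<in> sets \<mu>" "K \<in> sets \<mu>" "emeasure \<mu> K < \<infinity>"
    using V K by (simp_all add: openin_sets_haar compactin_sets_haar emeasure_compact[simplified])
  have i: "integrable \<mu> (indicator V :: 'a \<Rightarrow> real)" "integrable \<mu> (indicator K :: 'a \<Rightarrow> real)"
    using s V by auto
  have "(\<integral>x. norm (indicator A x - indicator K x :: real) \<partial>\<mu>)
    \<le> (\<integral>x. (indicator V x - indicator A x) + (indicator V x - indicator K x) \<partial>\<mu>)"
  proof (rule integral_mono)
    show "norm (indicator A x - indicator K x :: real)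
      \<le> (indicator V x - indicator A x) + (indicator V x - indicator K x)" for x
      using V(2) K(2) by (auto simp: indicator_def)
  qed (use i iA in auto)
  also have "\<dots> = (measure \<mu> V - measure \<mu> A) + (measure \<mu> V - measure \<mu> K)"
    using i iA s A sets.sets_into_space by (simp add: Int_absorb2)
  finally have "(\<integral>x. norm (indicator A x - indicator K x :: real) \<partial>\<mu>) < e" using V(4) K(3) by linarith
  then show "\<exists>v. integrable \<mu> v \<and> translation_continuous v \<and> (\<integral>x. norm (indicator A x - v x :: real) \<partial>\<mu>) < e"
    using i translation_continuous_compact[OF K(1)] by blast
qed

lemma translation_continuous_add:
  assumes "integrable \<mu> u" "integrable \<mu> v" "translation_continuous u" "translation_continuous v"
  shows "translation_continuous (\<lambda>x. u x + v x)"
  unfolding translation_continuous_def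
proof (intro allI impI)
  fix e :: real assume "e > 0"
  then have "e/2 > 0" by simp
  obtain U where U: "openin T U" "\<one> \<in> U" "\<And>g. g \<in> U \<Longrightarrow> (\<integral>x. norm (u (g \<otimes> x) - u x) \<partial>\<mu>) < e/2"
    using assms(3) \<open>e/2 > 0\<close> unfolding translation_continuous_def by metis
  obtain V where V: "openin T V" "\<one> \<in> V" "\<And>g. g \<in> V \<Longrightarrow> (\<integral>x. norm (v (g \<otimes> x) - v x) \<partial>\<mu>) < e/2"
    using assms(4) \<open>e/2 > 0\<close> unfolding translation_continuous_def by metis
  have "(\<integral>x. norm (u (g \<otimes> x) + v (g \<otimes> x) - (u x + v x)) \<partial>\<mu>) < e" if "g \<in> U \<inter> V" for g
  proof -
    have g: "g \<in> carrier G" using that openin_carrier[OF V(1)] by blast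
    note i = assms(1,2) integrable_translate[OF assms(1) g] integrable_translate[OF assms(2) g]
    have "(\<integral>x. norm (u (g \<otimes> x) + v (g \<otimes> x) - (u x + v x)) \<partial>\<mu>)
      \<le> (\<integral>x. norm (u (g \<otimes> x) - u x) + norm (v (g \<otimes> x) - v x) \<partial>\<mu>)"
      by (rule integral_mono) (use i in \<open>auto intro: norm_diff_triangle_ineq\<close>)
    also have "\<dots> = (\<integral>x. norm (u (g \<otimes> x) - u x) \<partial>\<mu>) + (\<integral>x. norm (v (g \<otimes> x) - v x) \<partial>\<mu>)"
      using i by simp
    finally show ?thesis using U(3)[of g] V(3)[of g] that by simp
  qed
  then show "\<exists>V. openin T V \<and> \<one> \<in> V \<and> (\<forall>g\<in>V. (\<integral>x. norm (u (g \<otimes> x) + v (g \<otimes> x) - (u x + v x)) \<partial>\<mu>) < e)"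
    using U(1,2) V(1,2) by (intro exI[of _ "U \<inter> V"]) (auto intro: openin_Int)
qed

theorem integrable_translation_continuous:
  fixes u :: "'a \<Rightarrow> 'c :: {banach, second_countable_topology}"
  assumes "integrable \<mu> u"
  shows "translation_continuous u"
  using assms
proof (induction rule: integrable_induct)
  case (base A c)
  show ?case unfolding translation_continuous_def
  proof (intro allI impI)
    fix e :: real assume "e > 0"
    \<comment> \<open>The summand 1 covers the case c = 0.\<close>
    then have "e / (norm c + 1) > 0" by (simp add: add_nonneg_pos)
    then obtain V where V: "openin T V" "\<one> \<in> V"
      "\<And>g. g \<in> V \<Longrightarrow> (\<integral>x. norm (indicator A (g \<otimes> x) - indicator A x :: real) \<partial>\<mu>) < e / (norm c + 1)"
      using translation_continuous_indicator[OF base] unfolding translation_continuous_def by metis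
    have "(\<integral>x. norm (indicator A (g \<otimes> x) *\<^sub>R c - indicator A x *\<^sub>R c) \<partial>\<mu>) < e" if "g \<in> V" for g
    proof -
      have "(\<integral>x. norm (indicator A (g \<otimes> x) *\<^sub>R c - indicator A x *\<^sub>R c) \<partial>\<mu>)
        = (\<integral>x. norm (indicator A (g \<otimes> x) - indicator A x :: real) \<partial>\<mu>) * norm c"
        by (simp add: scaleR_diff_left[symmetric])
      also have "\<dots> \<le> (\<integral>x. norm (indicator A (g \<otimes> x) - indicator A x :: real) \<partial>\<mu>) * (norm c + 1)"
        by (intro mult_left_mono) auto
      also have "\<dots> < e" using V(3)[OF that] by (simp add: pos_less_divide_eq add_nonneg_pos)
      finally show ?thesis .
    qed
    then show "\<exists>V. openin T V \<and> \<one> \<in> V \<and> (\<forall>g\<in>V. (\<integral>x. norm (indicator A (g \<otimes> x) *\<^sub>R c - indicator A x *\<^sub>R c) \<partial>\<mu>) < e)"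
      using V(1,2) by blast
  qed
next
  case (add f g)
  then show ?case by (intro translation_continuous_add)
next
  case (lim f s)
  show ?case
  proof (rule translation_continuous_approx[OF lim(4)])
    fix e :: real assume e: "e > 0"
    have "(\<lambda>i. \<integral>x. norm (f x - s i x) \<partial>\<mu>) \<longlonglongrightarrow> (\<integral>x. norm (f x - f x) \<partial>\<mu>)"
    proof (rule integral_dominated_convergence)
      \<comment> \<open>The approximants satisfy |s i x| \<le> 2 |f x|, so |f - s i| is at most 3
        |f|.\<close>
      show "integrable \<mu> (\<lambda>x. 3 * norm (f x))" using lim by simp
      show "AE x in \<mu>. (\<lambda>i. norm (f x - s i x)) \<longlonglongrightarrow> norm (f x - f x)"
        using lim(2) by (intro AE_I2 tendsto_intros) auto
      show "AE x in \<mu>. norm (norm (f x - s i x)) \<le> 3 * norm (f x)" for i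
      proof (rule AE_I2)
        fix x assume "x \<in> space \<mu>"
        then show "norm (norm (f x - s i x)) \<le> 3 * norm (f x)"
          using lim(3)[of x i] norm_triangle_ineq4[of "f x" "s i x"] by simp
      qed
    qed (use lim in \<open>auto intro: borel_measurable_integrable\<close>)
    then have "\<forall>\<^sub>F i in sequentially. (\<integral>x. norm (f x - s i x) \<partial>\<mu>) < e"
      using e by (intro order_tendstoD(2)) auto
    then obtain i where "(\<integral>x. norm (f x - s i x) \<partial>\<mu>) < e" by (meson eventually_happens trivial_limit_sequentially)
    then show "\<exists>v. integrable \<mu> v \<and> translation_continuous v \<and> (\<integral>x. norm (f x - v x) \<partial>\<mu>) < e"
      using lim by blast
  qed
qed

end

section \<open>Integration along the cosets of a normal subgroup\<close>

locale haar_pair = haar_group G T \<mu> for G (structure) and T \<mu> +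
  fixes N :: "'a set" and \<nu> :: "'a measure"
  assumes normal: "N \<lhd> G" and closedin: "closedin T N"
    and haar_N: "left_haar_measure (G\<lparr>carrier := N\<rparr>) (subtopology T N) \<nu>"
begin

lemma N_subgroup: "subgroup N G"
  using normal by (rule normal_imp_subgroup)

lemma N_carrier: "n \<in> N \<Longrightarrow> n \<in> carrier G"
  using subgroup.mem_carrier[OF N_subgroup] .

lemma N_subset: "N \<subseteq> carrier G"
  using N_carrier by blast

lemma N_mult: "m \<in> N \<Longrightarrow> n \<in> N \<Longrightarrow> m \<otimes> n \<in> N"
  using subgroup.m_closed[OF N_subgroup] .

lemma N_inv: "n \<in> N \<Longrightarrow> inv n \<in> N"
  using subgroup.m_inv_closed[OF N_subgroup] .

lemma N_conj: "x \<in> carrier G \<Longrightarrow> n \<in> N \<Longrightarrow> inv x \<otimes> n \<otimes> x \<in> N"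
  using normal.inv_op_closed1[OF normal] .

lemma N_conj': "x \<in> carrier G \<Longrightarrow> n \<in> N \<Longrightarrow> x \<otimes> n \<otimes> inv x \<in> N"
  using normal.inv_op_closed2[OF normal] .

lemma inv_N: "n \<in> N \<Longrightarrow> inv\<^bsub>G\<lparr>carrier := N\<rparr>\<^esub> n = inv n"
  using m_inv_consistent[OF N_subgroup] by simp

lemma topspace_N: "topspace (subtopology T N) = N"
  using N_subset topspace_eq by auto

sublocale N: haar_group "G\<lparr>carrier := N\<rparr>" "subtopology T N" \<nu>
proof (intro haar_group.intro sc_group.intro locally_compact_group.intro topological_group.intro
    haar_group_axioms.intro sc_group_axioms.intro locally_compact_group_axioms.intro topological_group_axioms.intro)
  show "group (G\<lparr>carrier := N\<rparr>)" by (rule subgroup_imp_group[OF N_subgroup])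
  show "topspace (subtopology T N) = carrier (G\<lparr>carrier := N\<rparr>)" using topspace_N by simp
  show "continuous_map (prod_topology (subtopology T N) (subtopology T N)) (subtopology T N)
     (\<lambda>(x, y). x \<otimes>\<^bsub>G\<lparr>carrier := N\<rparr>\<^esub> y)"
    using continuous_map_from_subtopology[OF continuous_mult, of "N \<times> N"] N_mult topspace_N
    by (auto simp: continuous_map_in_subtopology subtopology_Times)
  have "continuous_map (subtopology T N) (subtopology T N) (\<lambda>x. inv x)"
    using continuous_map_from_subtopology[OF continuous_inv, of N] N_inv topspace_N
    by (auto simp: continuous_map_in_subtopology)
  then show "continuous_map (subtopology T N) (subtopology T N) (\<lambda>x. inv\<^bsub>G\<lparr>carrier := N\<rparr>\<^esub> x)"
    by (rule continuous_map_eq) (simp add: topspace_N inv_N)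
  show "Hausdorff_space (subtopology T N)" by (rule Hausdorff_space_subtopology[OF Hausdorff])
  show "locally_compact_space (subtopology T N)" by (rule locally_compact_space_closed_subset[OF locally_compact closedin])
  show "second_countable (subtopology T N)" by (rule second_countable_subtopology[OF second_countable])
  show "left_haar_measure (G\<lparr>carrier := N\<rparr>) (subtopology T N) \<nu>" by (rule haar_N)
qed

abbreviation BG :: "'a measure" where "BG \<equiv> borel_alg T"
abbreviation BN :: "'a measure" where "BN \<equiv> borel_alg (subtopology T N)"

lemma space_nu: "space \<nu> = N" using N.space_haar by simp

lemma measurable_N_to_G [measurable (raw)]:
  "f \<in> measurable M BN \<Longrightarrow> f \<in> measurable M BG"
  using measurable_compose[OF _ continuous_map_measurable_borel_alg[OF continuous_map_from_subtopology[OF continuous_map_id, of T N]]]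
  by (auto simp: o_def id_def)

lemma measurable_G_to_N:
  assumes f: "f \<in> measurable M BG" "\<And>x. x \<in> space M \<Longrightarrow> f x \<in> N"
  shows "f \<in> measurable M BN"
proof (rule measurable_borel_algI)
  show "f \<in> space M \<rightarrow> topspace (subtopology T N)" using f(2) unfolding topspace_N by blast
  fix U assume "openin (subtopology T N) U"
  then obtain V where V: "openin T V" "U = V \<inter> N" by (auto simp: openin_subtopology)
  have "f -` U \<inter> space M = f -` V \<inter> space M" using f(2) V by auto
  then show "f -` U \<inter> space M \<in> sets M" using measurable_sets[OF f(1) openin_borel_alg[OF V(1)]] by simp
qed

lemma space_BG: "x \<in> carrier G \<Longrightarrow> x \<in> space BG" by (simp add: topspace_eq)

section \<open>Conjugation on N and its modulus\<close>

lemma measurable_conj: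
  assumes "x \<in> carrier G"
  shows "(\<lambda>m. inv x \<otimes> m \<otimes> x) \<in> measurable BN BN"
proof (rule measurable_G_to_N)
  have [measurable]: "x \<in> space BG" using assms by (rule space_BG)
  show "(\<lambda>m. inv x \<otimes> m \<otimes> x) \<in> measurable BN BG" by measurable
qed (use assms N_conj topspace_N in auto)

text \<open>By normality this is again left invariant on N, hence a multiple of \<nu>; the factor
  will be \<open>modulus x\<close>.\<close>

definition conj_measure :: "'a \<Rightarrow> 'a measure" where
  "conj_measure x = distr \<nu> BN (\<lambda>m. inv x \<otimes> m \<otimes> x)"

lemma conj_cancel:
  assumes "x \<in> carrier G" "m \<in> carrier G"
  shows "inv x \<otimes> (x \<otimes> m \<otimes> inv x) \<otimes> x = m" "x \<otimes> (inv x \<otimes> m \<otimes> x) \<otimes> inv x = m"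
proof -
  have "inv x \<otimes> (x \<otimes> m \<otimes> inv x) \<otimes> x = (inv x \<otimes> x) \<otimes> m \<otimes> (inv x \<otimes> x)"
    using assms by (simp only: m_assoc m_closed inv_closed)
  then show "inv x \<otimes> (x \<otimes> m \<otimes> inv x) \<otimes> x = m" using assms by simp
  have "x \<otimes> (inv x \<otimes> m \<otimes> x) \<otimes> inv x = (x \<otimes> inv x) \<otimes> m \<otimes> (x \<otimes> inv x)"
    using assms by (simp only: m_assoc m_closed inv_closed)
  then show "x \<otimes> (inv x \<otimes> m \<otimes> x) \<otimes> inv x = m" using assms by simp
qed

text \<open>Translating by n after the conjugation amounts to translating by k = x n x^{-1} before
  it, and k lies in N because N is normal.\<close>

lemma conj_measure_invariant:
  assumes x: "x \<in> carrier G"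
  shows "left_invariant_measure (G\<lparr>carrier := N\<rparr>) (conj_measure x)"
proof (intro left_invariant_measure.intro left_invariant_measure_axioms.intro)
  show "group (G\<lparr>carrier := N\<rparr>)" by (rule N.is_group)
  show "space (conj_measure x) = carrier (G\<lparr>carrier := N\<rparr>)" by (simp add: conj_measure_def topspace_N[simplified])
  fix n assume "n \<in> carrier (G\<lparr>carrier := N\<rparr>)"
  then have n: "n \<in> N" by simp
  have nm: "(\<lambda>m. n \<otimes> m) \<in> measurable BN BN"
    using N.translate_measurable[of n] n by (simp add: measurable_cong_sets[OF N.sets_haar N.sets_haar])
  then show "(\<lambda>m. n \<otimes>\<^bsub>G\<lparr>carrier := N\<rparr>\<^esub> m) \<in> measurable (conj_measure x) (conj_measure x)"
    by (simp add: conj_measure_def)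
  define k where "k = x \<otimes> n \<otimes> inv x"
  have k: "k \<in> N" unfolding k_def by (rule N_conj'[OF x n])
  have c: "(\<lambda>m. inv x \<otimes> m \<otimes> x) \<in> measurable \<nu> BN"
    using measurable_conj[OF x] by (simp add: measurable_cong_sets[OF N.sets_haar refl])
  have km: "(\<lambda>m. k \<otimes> m) \<in> measurable \<nu> \<nu>" using N.translate_measurable[of k] k by simp
  have eq: "n \<otimes> (inv x \<otimes> m \<otimes> x) = inv x \<otimes> (k \<otimes> m) \<otimes> x" if "m \<in> N" for m
  proof -
    have "inv x \<otimes> (k \<otimes> m) \<otimes> x = (inv x \<otimes> x) \<otimes> n \<otimes> (inv x \<otimes> m \<otimes> x)"
      unfolding k_def using x n N_carrier that by (simp only: m_assoc m_closed inv_closed N_carrier)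
    then show ?thesis using x n N_carrier that by simp
  qed
  have "distr (conj_measure x) (conj_measure x) (\<lambda>m. n \<otimes> m) = distr \<nu> BN ((\<lambda>m. n \<otimes> m) \<circ> (\<lambda>m. inv x \<otimes> m \<otimes> x))"
    unfolding conj_measure_def using nm c by (subst distr_distr[symmetric]) (auto intro!: distr_cong)
  also have "\<dots> = distr \<nu> BN ((\<lambda>m. inv x \<otimes> m \<otimes> x) \<circ> (\<lambda>m. k \<otimes> m))"
    by (rule distr_cong) (simp_all add: space_nu eq)
  also have "\<dots> = distr (distr \<nu> \<nu> (\<lambda>m. k \<otimes> m)) BN (\<lambda>m. inv x \<otimes> m \<otimes> x)"
    by (rule distr_distr[symmetric, OF c km])
  also have "distr \<nu> \<nu> (\<lambda>m. k \<otimes> m) = \<nu>" using N.distr_translate[of k] k by simp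
  finally show "distr (conj_measure x) (conj_measure x) (\<lambda>m. n \<otimes>\<^bsub>G\<lparr>carrier := N\<rparr>\<^esub> m) = conj_measure x"
    by (simp add: conj_measure_def)
qed

text \<open>Conjugation is a bijection of N, so a countable cover by sets of finite measure can be
  carried over by the inverse conjugation.\<close>

lemma conj_measure_sigma_finite:
  assumes x: "x \<in> carrier G"
  shows "sigma_finite_measure (conj_measure x)"
proof
  obtain A where A: "countable A" "A \<subseteq> sets \<nu>" "\<Union>A = space \<nu>" "\<forall>a\<in>A. emeasure \<nu> a \<noteq> \<infinity>"
    using N.sigma_finite_countable by blast
  let ?d = "\<lambda>m. x \<otimes> m \<otimes> inv x"
  have d: "?d \<in> measurable BN BN"
    using measurable_conj[of "inv x"] x by simp
  have c: "(\<lambda>m. inv x \<otimes> m \<otimes> x) \<in> measurable \<nu> BN"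
    using measurable_conj[OF x] by (simp add: measurable_cong_sets[OF N.sets_haar refl])
  define B where "B = (\<lambda>a. ?d -` a \<inter> N) ` A"
  have "?d -` a \<inter> N \<in> sets BN" if "a \<in> A" for a
    using measurable_sets[OF d, of a] that A(2) by (auto simp: N.sets_haar topspace_N[simplified])
  moreover have "emeasure (conj_measure x) (?d -` a \<inter> N) = emeasure \<nu> a" if "a \<in> A" for a
  proof -
    have sub: "a \<subseteq> N" using that A(3) space_nu by blast
    have "emeasure (conj_measure x) (?d -` a \<inter> N)
      = emeasure \<nu> ((\<lambda>m. inv x \<otimes> m \<otimes> x) -` (?d -` a \<inter> N) \<inter> space \<nu>)"
      unfolding conj_measure_def by (rule emeasure_distr[OF c]) (use calculation that in blast)
    also have "(\<lambda>m. inv x \<otimes> m \<otimes> x) -` (?d -` a \<inter> N) \<inter> space \<nu> = a"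
      using sub x N_carrier by (auto simp: space_nu conj_cancel N_conj)
    finally show ?thesis .
  qed
  moreover have "\<Union>B = N"
  proof
    show "N \<subseteq> \<Union>B"
    proof
      fix m assume m: "m \<in> N"
      then have "?d m \<in> \<Union>A" using A(3) space_nu N_conj'[OF x] by simp
      then show "m \<in> \<Union>B" using m unfolding B_def by blast
    qed
  qed (auto simp: B_def)
  ultimately show "\<exists>A. countable A \<and> A \<subseteq> sets (conj_measure x) \<and> \<Union>A = space (conj_measure x) \<and>
      (\<forall>a\<in>A. emeasure (conj_measure x) a \<noteq> \<infinity>)"
    using A(1,4) by (intro exI[of _ B]) (auto simp: B_def conj_measure_def topspace_N[simplified])
qed

lemma rel_compact_open_N:
  obtains F K where "openin (subtopology T N) F" "F \<noteq> {}" "F \<subseteq> K" "compactin (subtopology T N) K"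
proof -
  have "\<one> \<in> topspace (subtopology T N)" using topspace_N subgroup.one_closed[OF N_subgroup] by simp
  then obtain F K where "openin (subtopology T N) F" "compactin (subtopology T N) K" "\<one> \<in> F" "F \<subseteq> K"
    using N.locally_compact unfolding locally_compact_space_def by metis
  then show ?thesis using that by blast
qed

text \<open>The choice of \<open>F\<close> is immaterial, by uniqueness of Haar measure.\<close>

definition modulus :: "'a \<Rightarrow> ennreal" where
  "modulus x = (let F = (SOME F. openin (subtopology T N) F \<and> F \<noteq> {} \<and> (\<exists>K. F \<subseteq> K \<and> compactin (subtopology T N) K))
     in (\<integral>\<^sup>+m. indicator F (inv x \<otimes> m \<otimes> x) \<partial>\<nu>) / emeasure \<nu> F)"

lemma modulusE:
  obtains F K where "openin (subtopology T N) F" "F \<noteq> {}" "F \<subseteq> K" "compactin (subtopology T N) K"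
    "modulus = (\<lambda>x. (\<integral>\<^sup>+m. indicator F (inv x \<otimes> m \<otimes> x) \<partial>\<nu>) / emeasure \<nu> F)"
proof -
  let ?P = "\<lambda>F. openin (subtopology T N) F \<and> F \<noteq> {} \<and> (\<exists>K. F \<subseteq> K \<and> compactin (subtopology T N) K)"
  have "?P (SOME F. ?P F)" by (rule someI_ex) (use rel_compact_open_N in metis)
  then show ?thesis using that unfolding modulus_def Let_def by blast
qed

text \<open>Uniqueness of Haar measure on N for \<open>conj_measure x\<close>, divided by the
  measure of the reference set F, which is neither 0 nor infinite.\<close>

lemma nn_integral_conj:
  assumes x: "x \<in> carrier G" and k [measurable]: "k \<in> borel_measurable BN"
  shows "(\<integral>\<^sup>+m. k (inv x \<otimes> m \<otimes> x) \<partial>\<nu>) = modulus x * (\<integral>\<^sup>+m. k m \<partial>\<nu>)"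
proof -
  obtain F K where F: "openin (subtopology T N) F" "F \<noteq> {}" "F \<subseteq> K" "compactin (subtopology T N) K"
    and mod: "modulus = (\<lambda>x. (\<integral>\<^sup>+m. indicator F (inv x \<otimes> m \<otimes> x) \<partial>\<nu>) / emeasure \<nu> F)"
    by (rule modulusE)
  have Fs [measurable]: "F \<in> sets BN" using F(1) by (rule openin_borel_alg)
  have c: "(\<lambda>m. inv x \<otimes> m \<otimes> x) \<in> measurable \<nu> BN"
    using measurable_conj[OF x] by (simp add: measurable_cong_sets[OF N.sets_haar refl])
  have int: "(\<integral>\<^sup>+m. f m \<partial>conj_measure x) = (\<integral>\<^sup>+m. f (inv x \<otimes> m \<otimes> x) \<partial>\<nu>)" if "f \<in> borel_measurable BN" for f
    unfolding conj_measure_def using that by (intro nn_integral_distr c) simp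
  have pos: "emeasure \<nu> F \<noteq> 0" "emeasure \<nu> F \<noteq> \<infinity>"
    using N.emeasure_open_pos[OF F(1,2)] N.emeasure_subset_compact[OF F(3,4)] by auto
  have "(\<integral>\<^sup>+m. k m \<partial>conj_measure x) * emeasure \<nu> F = emeasure (conj_measure x) F * (\<integral>\<^sup>+m. k m \<partial>\<nu>)"
    by (rule N.haar_unique[OF _ conj_measure_sigma_finite[OF x] conj_measure_invariant[OF x] F k])
      (simp add: conj_measure_def)
  moreover have "emeasure (conj_measure x) F = (\<integral>\<^sup>+m. indicator F (inv x \<otimes> m \<otimes> x) \<partial>\<nu>)"
    using int[of "indicator F"] Fs by (simp add: conj_measure_def)
  moreover have modF: "modulus x * emeasure \<nu> F = (\<integral>\<^sup>+m. indicator F (inv x \<otimes> m \<otimes> x) \<partial>\<nu>)"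
    using pos ennreal_mult_divide_eq[of "emeasure \<nu> F" 1] by (simp add: mod ennreal_divide_times)
  ultimately have "(\<integral>\<^sup>+m. k (inv x \<otimes> m \<otimes> x) \<partial>\<nu>) * emeasure \<nu> F = modulus x * (\<integral>\<^sup>+m. k m \<partial>\<nu>) * emeasure \<nu> F"
    unfolding int[OF k] modF[symmetric] by (simp add: mult_ac)
  then show ?thesis using pos by (simp add: ennreal_mult_cancel_left mult.commute[of _ "emeasure \<nu> F"])
qed

lemma nn_integral_translate_N:
  assumes f: "f \<in> borel_measurable BN" and m: "m \<in> N"
  shows "(\<integral>\<^sup>+n. f (m \<otimes> n) \<partial>\<nu>) = (\<integral>\<^sup>+n. f n \<partial>\<nu>)"
  using N.nn_integral_translate[of f m] f m by (simp add: measurable_cong_sets[OF N.sets_haar refl])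

text \<open>A test function whose integral may be cancelled in \<open>ennreal\<close>: identities
  between integrals over N turn into identities for \<open>modulus\<close>.\<close>

lemma pos_finite_function_N:
  obtains k where "k \<in> borel_measurable BN" "(\<integral>\<^sup>+m. k m \<partial>\<nu>) \<noteq> 0" "(\<integral>\<^sup>+m. k m \<partial>\<nu>) \<noteq> \<infinity>"
proof -
  obtain F K where F: "openin (subtopology T N) F" "F \<noteq> {}" "F \<subseteq> K" "compactin (subtopology T N) K"
    by (rule rel_compact_open_N)
  have "F \<in> sets \<nu>" using N.openin_sets_haar[OF F(1)] .
  then show ?thesis
    using that[of "indicator F"] N.emeasure_open_pos[OF F(1,2)] N.emeasure_subset_compact[OF F(3,4)]
      openin_borel_alg[OF F(1)] by auto
qed

lemma modulus_mult:
  assumes x: "x \<in> carrier G" and y: "y \<in> carrier G"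
  shows "modulus (x \<otimes> y) = modulus x * modulus y"
proof -
  obtain k where k [measurable]: "k \<in> borel_measurable BN" and pos: "(\<integral>\<^sup>+m. k m \<partial>\<nu>) \<noteq> 0" "(\<integral>\<^sup>+m. k m \<partial>\<nu>) \<noteq> \<infinity>"
    by (rule pos_finite_function_N)
  have "modulus (x \<otimes> y) * (\<integral>\<^sup>+m. k m \<partial>\<nu>) = (\<integral>\<^sup>+m. k (inv (x \<otimes> y) \<otimes> m \<otimes> (x \<otimes> y)) \<partial>\<nu>)"
    by (rule nn_integral_conj[symmetric]) (use x y k in auto)
  also have "\<dots> = (\<integral>\<^sup>+m. k (inv y \<otimes> (inv x \<otimes> m \<otimes> x) \<otimes> y) \<partial>\<nu>)"
    by (rule nn_integral_cong) (simp add: space_nu x y inv_mult_group m_assoc N_carrier)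
  also have "\<dots> = modulus x * (\<integral>\<^sup>+m. k (inv y \<otimes> m \<otimes> y) \<partial>\<nu>)"
    using measurable_compose[OF measurable_conj[OF y] k] by (rule nn_integral_conj[OF x])
  also have "\<dots> = modulus x * modulus y * (\<integral>\<^sup>+m. k m \<partial>\<nu>)"
    by (simp add: nn_integral_conj[OF y k] mult.assoc)
  finally show ?thesis using pos by (simp add: ennreal_mult_cancel_left mult.commute[of _ "\<integral>\<^sup>+m. k m \<partial>\<nu>"])
qed

lemma modulus_one: "modulus \<one> = 1"
proof -
  obtain k where k [measurable]: "k \<in> borel_measurable BN" and pos: "(\<integral>\<^sup>+m. k m \<partial>\<nu>) \<noteq> 0" "(\<integral>\<^sup>+m. k m \<partial>\<nu>) \<noteq> \<infinity>"
    by (rule pos_finite_function_N)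
  have "modulus \<one> * (\<integral>\<^sup>+m. k m \<partial>\<nu>) = (\<integral>\<^sup>+m. k (inv \<one> \<otimes> m \<otimes> \<one>) \<partial>\<nu>)"
    by (rule nn_integral_conj[symmetric]) (use k in auto)
  also have "\<dots> = 1 * (\<integral>\<^sup>+m. k m \<partial>\<nu>)"
    by (simp, rule nn_integral_cong) (simp add: space_nu N_carrier)
  finally show ?thesis using pos by (simp only: ennreal_mult_cancel_left mult.commute[of _ "\<integral>\<^sup>+m. k m \<partial>\<nu>"]) auto
qed

lemma modulus_inv: "x \<in> carrier G \<Longrightarrow> modulus x * modulus (inv x) = 1"
  using modulus_mult[of x "inv x"] modulus_one by simp

lemma measurable_modulus [measurable]: "modulus \<in> borel_measurable BG"
proof -
  obtain F K where F: "openin (subtopology T N) F"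
    and mod: "modulus = (\<lambda>x. (\<integral>\<^sup>+m. indicator F (inv x \<otimes> m \<otimes> x) \<partial>\<nu>) / emeasure \<nu> F)"
    by (rule modulusE)
  \<comment> \<open>F is open only in N. Since conjugates of elements of N stay in N, it may be
    replaced by an open set of G, whose indicator is jointly measurable in x and m.\<close>
  obtain V where V: "openin T V" "F = V \<inter> N" using F by (auto simp: openin_subtopology)
  have [measurable]: "V \<in> sets BG" using V(1) by (rule openin_borel_alg)
  have "(\<integral>\<^sup>+m. indicator F (inv x \<otimes> m \<otimes> x) \<partial>\<nu>) = (\<integral>\<^sup>+m. indicator V (inv x \<otimes> m \<otimes> x) \<partial>\<nu>)"
    if "x \<in> space BG" for x
    by (rule nn_integral_cong) (use that N_conj V(2) space_nu topspace_eq in \<open>auto simp: indicator_def\<close>)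
  moreover have "(\<lambda>x. (\<integral>\<^sup>+m. indicator V (inv x \<otimes> m \<otimes> x) \<partial>\<nu>) / emeasure \<nu> F) \<in> borel_measurable BG"
    by measurable
  ultimately show ?thesis unfolding mod by (subst measurable_cong) auto
qed

text \<open>Since m n = n^{-1}(n m)n, right translation by n multiplies integrals over N by
  \<open>modulus n\<close>: on N itself, \<open>modulus\<close> is the modular function. The
  identity for right translates, with \<nu> in both roles, then becomes the inversion
  formula.\<close>

lemma nn_integral_inv_N:
  assumes k [measurable]: "k \<in> borel_measurable BN"
  shows "(\<integral>\<^sup>+m. modulus m * k (inv m) \<partial>\<nu>) = (\<integral>\<^sup>+m. k m \<partial>\<nu>)"
proof -
  obtain f where f [measurable]: "f \<in> borel_measurable BN" and pos: "(\<integral>\<^sup>+m. f m \<partial>\<nu>) \<noteq> 0" "(\<integral>\<^sup>+m. f m \<partial>\<nu>) \<noteq> \<infinity>"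
    by (rule pos_finite_function_N)
  have right: "(\<integral>\<^sup>+m. f (m \<otimes> n) \<partial>\<nu>) = modulus n * (\<integral>\<^sup>+m. f m \<partial>\<nu>)" if n: "n \<in> N" for n
  proof -
    have "(\<integral>\<^sup>+m. f (m \<otimes> n) \<partial>\<nu>) = (\<integral>\<^sup>+m. f (inv n \<otimes> (n \<otimes> m) \<otimes> n) \<partial>\<nu>)"
      by (rule nn_integral_cong) (simp add: space_nu N_carrier n m_assoc[symmetric])
    also have "\<dots> = (\<integral>\<^sup>+m. f (inv n \<otimes> m \<otimes> n) \<partial>\<nu>)"
      using N.nn_integral_translate[of "\<lambda>m. f (inv n \<otimes> m \<otimes> n)" n] n measurable_compose[OF measurable_conj[OF N_carrier[OF n]] f]
      by (simp add: measurable_cong_sets[OF N.sets_haar refl])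
    also have "\<dots> = modulus n * (\<integral>\<^sup>+m. f m \<partial>\<nu>)" by (rule nn_integral_conj[OF N_carrier[OF n] f])
    finally show ?thesis .
  qed
  have "(\<integral>\<^sup>+n. (\<integral>\<^sup>+m. f (m \<otimes> n) \<partial>\<nu>) * k (inv\<^bsub>G\<lparr>carrier := N\<rparr>\<^esub> n) \<partial>\<nu>) = (\<integral>\<^sup>+m. f m \<partial>\<nu>) * (\<integral>\<^sup>+m. k m \<partial>\<nu>)"
    using N.nn_integral_right_translate[OF N.sets_haar N.sigma_finite_measure_axioms N.left_invariant_measure_axioms f k] by simp
  also have "(\<integral>\<^sup>+n. (\<integral>\<^sup>+m. f (m \<otimes> n) \<partial>\<nu>) * k (inv\<^bsub>G\<lparr>carrier := N\<rparr>\<^esub> n) \<partial>\<nu>)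
     = (\<integral>\<^sup>+n. (\<integral>\<^sup>+m. f m \<partial>\<nu>) * (modulus n * k (inv n)) \<partial>\<nu>)"
    by (rule nn_integral_cong) (simp add: space_nu right inv_N mult_ac)
  also have "\<dots> = (\<integral>\<^sup>+m. f m \<partial>\<nu>) * (\<integral>\<^sup>+n. modulus n * k (inv n) \<partial>\<nu>)"
  proof (rule nn_integral_cmult)
    have "(\<lambda>n. inv n) \<in> measurable BN BN"
      by (rule measurable_G_to_N) (use N_inv topspace_N in auto)
    then have [measurable]: "(\<lambda>n. k (inv n)) \<in> borel_measurable BN" using k by (rule measurable_compose)
    show "(\<lambda>n. modulus n * k (inv n)) \<in> borel_measurable \<nu>" by measurable
  qed
  finally show ?thesis using pos by (simp add: ennreal_mult_cancel_left)
qed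

text \<open>In other words, the modular function of \<open>G\<close> extends that of \<open>N\<close>.\<close>

theorem nn_integral_N_symmetric:
  assumes f [measurable]: "f \<in> borel_measurable BG" and h [measurable]: "h \<in> borel_measurable BG"
  shows "(\<integral>\<^sup>+x. f x * (\<integral>\<^sup>+n. h (x \<otimes> n) \<partial>\<nu>) \<partial>\<mu>) = (\<integral>\<^sup>+x. (\<integral>\<^sup>+n. f (x \<otimes> n) \<partial>\<nu>) * h x \<partial>\<mu>)"
proof -
  interpret P: pair_sigma_finite \<mu> \<nu> ..
  have sp: "x \<in> carrier G" "x \<in> space BG" if "x \<in> space \<mu>" for x using that by (simp_all add: space_haar topspace_eq)
  have "(\<integral>\<^sup>+x. f x * (\<integral>\<^sup>+n. h (x \<otimes> n) \<partial>\<nu>) \<partial>\<mu>) = (\<integral>\<^sup>+x. (\<integral>\<^sup>+m. f x * modulus (inv x) * h (m \<otimes> x) \<partial>\<nu>) \<partial>\<mu>)"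
  \<comment> \<open>The coset x N is rewritten as N x, at the cost of the factor
    \<open>modulus (inv x)\<close>. With m on the left, left invariance of \<mu> can be used after
    exchanging the integrals.\<close>
  proof (rule nn_integral_cong)
    fix x assume "x \<in> space \<mu>"
    note x = sp[OF this]
    note [measurable] = x(2)
    have "(\<integral>\<^sup>+m. f x * modulus (inv x) * h (m \<otimes> x) \<partial>\<nu>) = f x * modulus (inv x) * (\<integral>\<^sup>+m. h (m \<otimes> x) \<partial>\<nu>)"
      by (rule nn_integral_cmult) measurable
    also have "(\<integral>\<^sup>+m. h (m \<otimes> x) \<partial>\<nu>) = (\<integral>\<^sup>+m. h (x \<otimes> (inv x \<otimes> m \<otimes> x)) \<partial>\<nu>)"
      by (rule nn_integral_cong) (simp add: space_nu x N_carrier m_assoc[symmetric])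
    also have "\<dots> = modulus x * (\<integral>\<^sup>+m. h (x \<otimes> m) \<partial>\<nu>)"
      by (rule nn_integral_conj[OF x(1), of "\<lambda>m. h (x \<otimes> m)"]) measurable
    also have "f x * modulus (inv x) * (modulus x * (\<integral>\<^sup>+m. h (x \<otimes> m) \<partial>\<nu>))
        = f x * (modulus x * modulus (inv x)) * (\<integral>\<^sup>+m. h (x \<otimes> m) \<partial>\<nu>)" by (simp add: mult_ac)
    finally show "f x * (\<integral>\<^sup>+n. h (x \<otimes> n) \<partial>\<nu>) = (\<integral>\<^sup>+m. f x * modulus (inv x) * h (m \<otimes> x) \<partial>\<nu>)"
      by (simp add: modulus_inv x)
  qed
  also have "\<dots> = (\<integral>\<^sup>+m. (\<integral>\<^sup>+x. f x * modulus (inv x) * h (m \<otimes> x) \<partial>\<mu>) \<partial>\<nu>)"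
    by (rule P.Fubini'[symmetric]) measurable
  also have "\<dots> = (\<integral>\<^sup>+m. (\<integral>\<^sup>+x. f (inv m \<otimes> x) * modulus (inv (inv m \<otimes> x)) * h x \<partial>\<mu>) \<partial>\<nu>)"
  proof (rule nn_integral_cong)
    fix m assume "m \<in> space \<nu>"
    then have m: "m \<in> N" "m \<in> carrier G" by (simp_all add: space_nu N_carrier)
    have [measurable]: "m \<in> space BG" "inv m \<in> space BG" using m(2) by (simp_all add: topspace_eq)
    have "(\<integral>\<^sup>+x. f x * modulus (inv x) * h (m \<otimes> x) \<partial>\<mu>)
      = (\<integral>\<^sup>+x. f (inv m \<otimes> (m \<otimes> x)) * modulus (inv (inv m \<otimes> (m \<otimes> x))) * h (m \<otimes> x) \<partial>\<mu>)"
      by (rule nn_integral_cong) (simp add: sp m m_assoc[symmetric])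
    also have "\<dots> = (\<integral>\<^sup>+x. f (inv m \<otimes> x) * modulus (inv (inv m \<otimes> x)) * h x \<partial>\<mu>)"
    proof (rule nn_integral_translate[OF _ m(2), of "\<lambda>x. f (inv m \<otimes> x) * modulus (inv (inv m \<otimes> x)) * h x"])
      have "(\<lambda>x. f (inv m \<otimes> x) * modulus (inv (inv m \<otimes> x)) * h x) \<in> borel_measurable BG" by measurable
      then show "(\<lambda>x. f (inv m \<otimes> x) * modulus (inv (inv m \<otimes> x)) * h x) \<in> borel_measurable \<mu>"
        by (simp add: measurable_cong_sets[OF sets_haar refl])
    qed
    finally show "(\<integral>\<^sup>+x. f x * modulus (inv x) * h (m \<otimes> x) \<partial>\<mu>)
      = (\<integral>\<^sup>+x. f (inv m \<otimes> x) * modulus (inv (inv m \<otimes> x)) * h x \<partial>\<mu>)" .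
  qed
  also have "\<dots> = (\<integral>\<^sup>+x. (\<integral>\<^sup>+m. f (inv m \<otimes> x) * modulus (inv (inv m \<otimes> x)) * h x \<partial>\<nu>) \<partial>\<mu>)"
    by (rule P.Fubini') measurable
  also have "\<dots> = (\<integral>\<^sup>+x. (\<integral>\<^sup>+n. f (x \<otimes> n) \<partial>\<nu>) * h x \<partial>\<mu>)"
  \<comment> \<open>The way back from N x to x N: conjugation by x produces a factor
    \<open>modulus x\<close>, which cancels against that of x^{-1}, and the remaining factor
    \<open>modulus m\<close> is absorbed by inversion on N.\<close>
  proof (rule nn_integral_cong)
    fix x assume "x \<in> space \<mu>"
    note x = sp[OF this]
    note [measurable] = x(2)
    have m1: "(\<lambda>m. f (x \<otimes> m)) \<in> borel_measurable BN" by measurable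
    have m2: "(\<lambda>m. f (x \<otimes> inv m) * modulus (m \<otimes> inv x)) \<in> borel_measurable BN" by measurable
    have "(\<integral>\<^sup>+m. f (inv m \<otimes> x) * modulus (inv (inv m \<otimes> x)) \<partial>\<nu>)
      = (\<integral>\<^sup>+m. f (x \<otimes> inv (inv x \<otimes> m \<otimes> x)) * modulus ((inv x \<otimes> m \<otimes> x) \<otimes> inv x) \<partial>\<nu>)"
      by (rule nn_integral_cong) (simp add: space_nu x N_carrier inv_mult_group m_assoc[symmetric], simp add: m_assoc x N_carrier)
    also have "\<dots> = modulus x * (\<integral>\<^sup>+m. f (x \<otimes> inv m) * modulus (m \<otimes> inv x) \<partial>\<nu>)"
      by (rule nn_integral_conj[OF x(1) m2])
    also have "\<dots> = (\<integral>\<^sup>+m. modulus x * (f (x \<otimes> inv m) * modulus (m \<otimes> inv x)) \<partial>\<nu>)"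
      by (rule nn_integral_cmult[symmetric]) measurable
    also have "\<dots> = (\<integral>\<^sup>+m. modulus m * f (x \<otimes> inv m) \<partial>\<nu>)"
    proof (rule nn_integral_cong)
      fix m assume "m \<in> space \<nu>"
      then have m: "m \<in> carrier G" by (simp add: space_nu N_carrier)
      have "modulus x * (f (x \<otimes> inv m) * modulus (m \<otimes> inv x))
        = (modulus x * modulus (inv x)) * (modulus m * f (x \<otimes> inv m))"
        by (simp add: modulus_mult m x mult_ac)
      then show "modulus x * (f (x \<otimes> inv m) * modulus (m \<otimes> inv x)) = modulus m * f (x \<otimes> inv m)"
        by (simp add: modulus_inv x)
    qed
    also have "\<dots> = (\<integral>\<^sup>+m. f (x \<otimes> m) \<partial>\<nu>)" by (rule nn_integral_inv_N[OF m1])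
    finally have "(\<integral>\<^sup>+m. f (inv m \<otimes> x) * modulus (inv (inv m \<otimes> x)) \<partial>\<nu>) = (\<integral>\<^sup>+m. f (x \<otimes> m) \<partial>\<nu>)" .
    moreover have "(\<integral>\<^sup>+m. f (inv m \<otimes> x) * modulus (inv (inv m \<otimes> x)) * h x \<partial>\<nu>)
      = (\<integral>\<^sup>+m. f (inv m \<otimes> x) * modulus (inv (inv m \<otimes> x)) \<partial>\<nu>) * h x"
      by (rule nn_integral_multc) measurable
    ultimately show "(\<integral>\<^sup>+m. f (inv m \<otimes> x) * modulus (inv (inv m \<otimes> x)) * h x \<partial>\<nu>)
      = (\<integral>\<^sup>+n. f (x \<otimes> n) \<partial>\<nu>) * h x" by simp
  qed
  finally show ?thesis .
qed

end

section \<open>The representation on the quotient\<close>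

context haar_pair
begin

text \<open>
  Cover \<open>G\<close> by increasing relatively compact open sets \<open>U j\<close> and keep from each coset \<open>x N\<close> the
  part in the first \<open>U j\<close> that it meets; \<open>\<beta>\<close> is the indicator of the union of these parts, normalised
  on each coset.
\<close>

lemma Bruhat_function:
  obtains \<beta> :: "'a \<Rightarrow> ennreal" and U K :: "nat \<Rightarrow> 'a set" where
    "\<beta> \<in> borel_measurable BG" "\<And>x. x \<in> carrier G \<Longrightarrow> \<beta> x < \<infinity>"
    "\<And>x. x \<in> carrier G \<Longrightarrow> (\<integral>\<^sup>+n. \<beta> (x \<otimes> n) \<partial>\<nu>) = 1"
    "\<And>j. openin T (U j)" "\<And>j. U j \<subseteq> K j" "\<And>j. compactin T (K j)" "incseq U" "(\<Union>j. U j) = carrier G"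
    "\<And>x n j. x \<in> carrier G \<Longrightarrow> n \<in> N \<Longrightarrow> x \<otimes> n \<in> U j \<Longrightarrow> \<beta> x \<noteq> 0 \<Longrightarrow> x \<in> U j"
proof -
  obtain U K where U: "\<And>j::nat. openin T (U j)" "\<And>j. U j \<subseteq> K j" "\<And>j. compactin T (K j)"
    "incseq U" "(\<Union>j. U j) = carrier G"
    using compact_exhaustion[OF second_countable locally_compact] topspace_eq by metis
  note [measurable] = openin_borel_alg[OF U(1)]
  define S where "S = (\<lambda>i. {x \<in> carrier G. \<exists>n\<in>N. x \<otimes> n \<in> U i})"
  have "S i = (\<Union>n\<in>N. {x \<in> carrier G. x \<otimes> n \<in> U i})" for i by (auto simp: S_def)
  then have "openin T (S i)" for i
    using openin_vimage_right[OF U(1)] N_carrier by (auto intro!: openin_Union)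
  note [measurable] = openin_borel_alg[OF this]
  define E where "E = (\<Union>j. U j - (\<Union>i<j. S i))"
  have [measurable]: "E \<in> sets BG" unfolding E_def by measurable
  define \<theta> where "\<theta> = (\<lambda>x. \<integral>\<^sup>+n. indicator E (x \<otimes> n) \<partial>\<nu>)"
  have [measurable]: "\<theta> \<in> borel_measurable BG" unfolding \<theta>_def by measurable
  have S_N: "x \<otimes> n \<in> S i \<longleftrightarrow> x \<in> S i" if "x \<in> carrier G" "n \<in> N" for x n i
  proof
    assume "x \<otimes> n \<in> S i"
    then obtain m where "m \<in> N" "x \<otimes> n \<otimes> m \<in> U i" unfolding S_def by blast
    then show "x \<in> S i" using that N_mult N_carrier unfolding S_def by (auto simp: m_assoc intro!: bexI[of _ "n \<otimes> m"])
  next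
    assume "x \<in> S i"
    then obtain m where m: "m \<in> N" "x \<otimes> m \<in> U i" unfolding S_def by blast
    have "x \<otimes> n \<otimes> (inv n \<otimes> m) = x \<otimes> m" using that m N_carrier by (simp add: m_assoc) (simp add: m_assoc[symmetric])
    then show "x \<otimes> n \<in> S i" using m that N_mult N_inv N_carrier unfolding S_def by (auto intro!: bexI[of _ "inv n \<otimes> m"])
  qed
  have U_sub_S: "x \<in> S i" if "x \<in> U i" for x i
  proof -
    have "x \<in> carrier G" using that openin_carrier[OF U(1)] by blast
    then show ?thesis using that subgroup.one_closed[OF N_subgroup] unfolding S_def by force
  qed
  \<comment> \<open>On a coset whose first encounter is with \<open>U j\<close>, the set E coincides
    with \<open>U j\<close>.\<close>
  have E_iff: "x \<in> E \<longleftrightarrow> x \<in> U j" if x: "x \<in> S j" "\<And>i. i < j \<Longrightarrow> x \<notin> S i" for x j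
  proof
    assume "x \<in> E"
    then obtain l where l: "x \<in> U l" "\<And>i. i < l \<Longrightarrow> x \<notin> S i" unfolding E_def by blast
    have "\<not> j < l" using l(2) x(1) by blast
    moreover have "\<not> l < j" using x(2) U_sub_S[OF l(1)] by blast
    ultimately have "l = j" by simp
    then show "x \<in> U j" using l by simp
  qed (use x in \<open>auto simp: E_def\<close>)
  have first: "\<exists>j. x \<in> S j \<and> (\<forall>i<j. x \<notin> S i)" if x: "x \<in> carrier G" for x
  proof -
    have "\<exists>j. x \<in> S j" using x U(5) U_sub_S by blast
    then show ?thesis using exists_least_iff[of "\<lambda>j. x \<in> S j"] by blast
  qed
  have \<theta>: "\<theta> x \<noteq> 0" "\<theta> x \<noteq> \<infinity>" if x: "x \<in> carrier G" for x
  proof -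
    obtain j where j: "x \<in> S j" "\<And>i. i < j \<Longrightarrow> x \<notin> S i" using first[OF x] by blast
    \<comment> \<open>The part of the coset that E keeps, seen in N: open and nonempty, so \<theta>
      x is positive, and inside a compact set, so \<theta> x is finite.\<close>
    let ?O = "{n \<in> carrier G. x \<otimes> n \<in> U j} \<inter> N"
    have O: "openin (subtopology T N) ?O"
      using openin_vimage_left[OF U(1) x] by (auto simp: openin_subtopology)
    have "\<theta> x = (\<integral>\<^sup>+n. indicator ?O n \<partial>\<nu>)"
      unfolding \<theta>_def
    proof (rule nn_integral_cong)
      fix n assume "n \<in> space \<nu>"
      then have n: "n \<in> N" "n \<in> carrier G" by (simp_all add: space_nu N_carrier)
      have "x \<otimes> n \<in> E \<longleftrightarrow> x \<otimes> n \<in> U j" by (rule E_iff) (use j S_N[OF x n(1)] in auto)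
      then show "indicator E (x \<otimes> n) = (indicator ?O n :: ennreal)" using n by (simp add: indicator_def)
    qed
    then have eq: "\<theta> x = emeasure \<nu> ?O" using N.openin_sets_haar[OF O] by simp
    have "?O \<noteq> {}" using j(1) N_carrier unfolding S_def by blast
    then show "\<theta> x \<noteq> 0" using N.emeasure_open_pos[OF O] eq by simp
    let ?L = "((\<lambda>y. inv x \<otimes> y) ` K j) \<inter> N"
    have L: "compactin (subtopology T N) ?L"
      using image_compactin[OF U(3) continuous_map_left[OF inv_closed[OF x]]] closedin
      by (simp add: compactin_subtopology compact_Int_closedin)
    have "?O \<subseteq> ?L"
    proof
      fix n assume n: "n \<in> ?O"
      then have "n = inv x \<otimes> (x \<otimes> n)" using x by (simp add: m_assoc[symmetric])
      then show "n \<in> ?L" using n U(2) by blast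
    qed
    then show "\<theta> x \<noteq> \<infinity>" using N.emeasure_subset_compact[OF _ L, of ?O] eq by simp
  qed
  have \<theta>_N: "\<theta> (x \<otimes> n) = \<theta> x" if x: "x \<in> carrier G" and n: "n \<in> N" for x n
  proof -
    have [measurable]: "x \<in> space BG" using x by (rule space_BG)
    have "(\<lambda>m. indicator E (x \<otimes> m) :: ennreal) \<in> borel_measurable \<nu>" by measurable
    from N.nn_integral_translate[OF this, of n] show ?thesis
      unfolding \<theta>_def using n x N_carrier
      by (simp add: m_assoc space_nu cong: nn_integral_cong_simp)
  qed
  define \<beta> where "\<beta> = (\<lambda>x. indicator E x / \<theta> x)"
  have b1: "\<beta> \<in> borel_measurable BG" unfolding \<beta>_def by measurable
  have b2: "\<beta> x < \<infinity>" if "x \<in> carrier G" for x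
    using \<theta>[OF that] by (auto simp: \<beta>_def indicator_def ennreal_divide_eq_top_iff less_top[symmetric])
  have b3: "(\<integral>\<^sup>+n. \<beta> (x \<otimes> n) \<partial>\<nu>) = 1" if x: "x \<in> carrier G" for x
  proof -
    have [measurable]: "x \<in> space BG" using x by (rule space_BG)
    have "(\<integral>\<^sup>+n. \<beta> (x \<otimes> n) \<partial>\<nu>) = (\<integral>\<^sup>+n. indicator E (x \<otimes> n) / \<theta> x \<partial>\<nu>)"
      by (rule nn_integral_cong) (simp add: \<beta>_def space_nu \<theta>_N x)
    also have "\<dots> = \<theta> x / \<theta> x" unfolding \<theta>_def by (rule nn_integral_divide) measurable
    also have "\<dots> = 1" using \<theta>[OF x] ennreal_mult_divide_eq[of "\<theta> x" 1] by simp
    finally show ?thesis .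
  qed
  \<comment> \<open>If the coset of x meets \<open>U j\<close>, its first encounter has an index i
    \<le> j, and the part kept lies in \<open>U i\<close>, a subset of \<open>U j\<close>.\<close>
  have b4: "x \<in> U j" if x: "x \<in> carrier G" "n \<in> N" "x \<otimes> n \<in> U j" "\<beta> x \<noteq> 0" for x n j
  proof -
    have xE: "x \<in> E" using x(4) by (rule contrapos_np) (simp add: \<beta>_def)
    obtain i where i: "x \<in> S i" "\<And>l. l < i \<Longrightarrow> x \<notin> S l" using first[OF x(1)] by blast
    have xU: "x \<in> U i" using E_iff[OF i] xE by simp
    have "x \<in> S j" using x(1-3) unfolding S_def by blast
    then have "i \<le> j" using i(2)[of j] by linarith
    then show ?thesis using xU incseqD[OF U(4), of i j] by blast
  qed
  show ?thesis by (rule that[OF b1 b2 b3 U b4])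
qed

end

locale Bruhat = haar_pair G T \<mu> N \<nu> for G (structure) and T \<mu> N \<nu> +
  fixes \<beta> :: "'a \<Rightarrow> ennreal" and U K :: "nat \<Rightarrow> 'a set"
  assumes beta_measurable [measurable]: "\<beta> \<in> borel_measurable BG"
    and beta_finite: "x \<in> carrier G \<Longrightarrow> \<beta> x < \<infinity>"
    and beta_integral: "x \<in> carrier G \<Longrightarrow> (\<integral>\<^sup>+n. \<beta> (x \<otimes> n) \<partial>\<nu>) = 1"
    and U_open: "openin T (U j)" and U_K: "U j \<subseteq> K j" and K_compact: "compactin T (K j)"
    and U_incseq: "incseq U" and U_cover: "(\<Union>j. U j) = carrier G"
    and beta_support: "x \<in> carrier G \<Longrightarrow> n \<in> N \<Longrightarrow> x \<otimes> n \<in> U j \<Longrightarrow> \<beta> x \<noteq> 0 \<Longrightarrow> x \<in> U j"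
begin

section \<open>The quotient as a \<sigma>-algebra and a measure on G\<close>

definition saturated :: "'a set set" where
  "saturated = {A \<in> sets BG. \<forall>x\<in>A. \<forall>n\<in>N. x \<otimes> n \<in> A}"

text \<open>\<open>L2\<close> of \<open>G / N\<close> is realised by \<open>N\<close>-invariant functions on \<open>G\<close>, that is, with the saturated sets
  as measurable sets.\<close>

definition quot_alg :: "'a measure" where
  "quot_alg = measure_of (carrier G) saturated (\<lambda>_. 0)"

text \<open>The Haar measure of G/N, as the image of \<mu> weighted by \<open>\<beta>\<close>. The
  weight gives every coset mass one; without it, Weil's formula would leave saturated sets only the
  measures 0 and \<infinity> as soon as \<nu> N is infinite.\<close>

definition quot_measure :: "'a measure" where
  "quot_measure = distr (density \<mu> \<beta>) quot_alg (\<lambda>x. x)"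

lemma saturatedD:
  assumes "A \<in> saturated"
  shows "A \<in> sets BG" "A \<subseteq> carrier G" "x \<in> A \<Longrightarrow> n \<in> N \<Longrightarrow> x \<otimes> n \<in> A"
proof -
  show A: "A \<in> sets BG" using assms unfolding saturated_def by blast
  show "A \<subseteq> carrier G" using sets.sets_into_space[OF A] by (simp add: topspace_eq)
  show "x \<in> A \<Longrightarrow> n \<in> N \<Longrightarrow> x \<otimes> n \<in> A" using assms unfolding saturated_def by blast
qed

lemma saturated_iff:
  assumes "A \<in> saturated" "x \<in> carrier G" "n \<in> N"
  shows "x \<otimes> n \<in> A \<longleftrightarrow> x \<in> A"
proof
  assume "x \<otimes> n \<in> A"
  then have "(x \<otimes> n) \<otimes> inv n \<in> A" using assms N_inv saturatedD(3) by blast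
  then show "x \<in> A" using assms N_carrier by (simp add: m_assoc)
qed (rule saturatedD(3)[OF assms(1) _ assms(3)])

lemma sigma_algebra_saturated: "sigma_algebra (carrier G) saturated"
proof (rule sigma_algebra_iff2[THEN iffD2], intro conjI ballI allI impI)
  show "saturated \<subseteq> Pow (carrier G)" using saturatedD(2) by blast
  show "{} \<in> saturated" by (simp add: saturated_def)
  fix A assume A: "A \<in> saturated"
  have "carrier G - A \<in> sets BG" using sets.compl_sets[OF saturatedD(1)[OF A]] by (simp add: topspace_eq)
  then show "carrier G - A \<in> saturated" using saturated_iff[OF A] N_carrier unfolding saturated_def by auto
next
  fix A :: "nat \<Rightarrow> 'a set" assume "range A \<subseteq> saturated"
  then have A: "A i \<in> saturated" for i by blast
  then have "(\<Union>i. A i) \<in> sets BG" using saturatedD(1) by (intro sets.countable_UN) blast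
  moreover have "x \<otimes> n \<in> (\<Union>i. A i)" if "x \<in> (\<Union>i. A i)" "n \<in> N" for x n
    using that saturatedD(3)[OF A] by blast
  ultimately show "(\<Union>i. A i) \<in> saturated" unfolding saturated_def by simp
qed

lemma sets_quot_alg: "sets quot_alg = saturated"
  unfolding quot_alg_def by (rule sigma_algebra.sets_measure_of_eq[OF sigma_algebra_saturated])

lemma space_quot_alg [simp]: "space quot_alg = carrier G"
  by (simp add: quot_alg_def space_measure_of_conv)

lemma measurable_id_quot_alg [measurable]: "(\<lambda>x. x) \<in> measurable BG quot_alg"
proof (rule measurableI)
  fix A assume "A \<in> sets quot_alg"
  then have "A \<in> saturated" by (simp add: sets_quot_alg)
  then show "(\<lambda>x. x) -` A \<inter> space BG \<in> sets BG" using saturatedD(1,2) by (simp add: topspace_eq Int_absorb2)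
qed (simp add: topspace_eq)

lemma measurable_quot_alg_BG:
  assumes f: "f \<in> measurable quot_alg L"
  shows "f \<in> measurable BG L"
  by (rule measurable_compose[OF measurable_id_quot_alg f])

lemma measurable_quot_algI:
  assumes f: "f \<in> measurable BG L" and inv: "\<And>x n. x \<in> carrier G \<Longrightarrow> n \<in> N \<Longrightarrow> f (x \<otimes> n) = f x"
  shows "f \<in> measurable quot_alg L"
proof (rule measurableI)
  show "f x \<in> space L" if "x \<in> space quot_alg" for x
    using measurable_space[OF f, of x] that by (simp add: topspace_eq)
  fix A assume "A \<in> sets L"
  then have "f -` A \<inter> carrier G \<in> sets BG" using measurable_sets[OF f] by (simp add: topspace_eq)
  then show "f -` A \<inter> space quot_alg \<in> sets quot_alg"
    using inv N_carrier by (auto simp: sets_quot_alg saturated_def)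
qed

text \<open>Singletons are Borel in a T1 space, so the preimage of {f x} is saturated. Measurable
  functions are thus constant on cosets at every point, not just almost everywhere.\<close>

lemma quot_alg_invariant:
  assumes f: "f \<in> borel_measurable quot_alg" and x: "x \<in> carrier G" "n \<in> N"
  shows "f (x \<otimes> n) = (f x :: 'c :: t1_space)"
proof -
  have "f -` {f x} \<inter> space quot_alg \<in> sets quot_alg"
    by (rule measurable_sets[OF f]) simp
  then have "f -` {f x} \<inter> carrier G \<in> saturated" by (simp add: sets_quot_alg)
  then have "x \<otimes> n \<in> f -` {f x} \<inter> carrier G" using x by (intro saturatedD(3)) simp_all
  then show ?thesis by blast
qed

lemma sets_quot_measure [measurable_cong]: "sets quot_measure = sets quot_alg"
  by (simp add: quot_measure_def)

lemma space_quot_measure: "space quot_measure = carrier G"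
  by (simp add: quot_measure_def)

lemma measurable_mu: "f \<in> measurable BG L \<Longrightarrow> f \<in> measurable \<mu> L"
  by (simp add: measurable_cong_sets[OF sets_haar refl])

lemma measurable_id_density: "(\<lambda>x. x) \<in> measurable (density \<mu> w) quot_alg"
  using measurable_id_quot_alg by (simp add: measurable_cong_sets[OF sets_haar refl])

lemma nn_integral_quot_measure:
  assumes f: "f \<in> borel_measurable quot_alg"
  shows "(\<integral>\<^sup>+x. f x \<partial>quot_measure) = (\<integral>\<^sup>+x. \<beta> x * f x \<partial>\<mu>)"
proof -
  have [measurable]: "f \<in> borel_measurable BG" by (rule measurable_quot_alg_BG[OF f])
  have "(\<integral>\<^sup>+x. f x \<partial>quot_measure) = (\<integral>\<^sup>+x. f x \<partial>density \<mu> \<beta>)"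
    unfolding quot_measure_def by (rule nn_integral_distr[OF measurable_id_density]) (use f in simp)
  also have "\<dots> = (\<integral>\<^sup>+x. \<beta> x * f x \<partial>\<mu>)"
    by (rule nn_integral_density[OF measurable_mu[OF beta_measurable] measurable_mu[OF measurable_quot_alg_BG[OF f]]])
  finally show ?thesis .
qed

lemma fibre_integral_measurable:
  assumes [measurable]: "F \<in> borel_measurable BG"
  shows "(\<lambda>x. \<integral>\<^sup>+n. F (x \<otimes> n) \<partial>\<nu>) \<in> borel_measurable quot_alg"
proof (rule measurable_quot_algI)
  show "(\<lambda>x. \<integral>\<^sup>+n. F (x \<otimes> n) \<partial>\<nu>) \<in> borel_measurable BG" by measurable
  fix x n assume x: "x \<in> carrier G" and n: "n \<in> N"
  have [measurable]: "x \<in> space BG" using x by (rule space_BG)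
  have "(\<lambda>m. F (x \<otimes> m)) \<in> borel_measurable \<nu>" by measurable
  from N.nn_integral_translate[OF this, of n] show "(\<integral>\<^sup>+m. F (x \<otimes> n \<otimes> m) \<partial>\<nu>) = (\<integral>\<^sup>+m. F (x \<otimes> m) \<partial>\<nu>)"
    using n x N_carrier by (simp add: m_assoc space_nu cong: nn_integral_cong_simp)
qed

section \<open>Weil's formula and invariance of the quotient measure\<close>

text \<open>Insert 1 as the integral of \<open>\<beta>\<close> over the coset of x, and let the
  symmetry of integration along N move that integral from \<open>\<beta>\<close> to F.\<close>

theorem Weil_formula:
  assumes F [measurable]: "F \<in> borel_measurable BG"
  shows "(\<integral>\<^sup>+x. F x \<partial>\<mu>) = (\<integral>\<^sup>+x. (\<integral>\<^sup>+n. F (x \<otimes> n) \<partial>\<nu>) \<partial>quot_measure)"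
proof -
  have "(\<integral>\<^sup>+x. F x \<partial>\<mu>) = (\<integral>\<^sup>+x. (\<integral>\<^sup>+n. \<beta> (x \<otimes> n) \<partial>\<nu>) * F x \<partial>\<mu>)"
    by (rule nn_integral_cong) (simp add: beta_integral space_haar)
  also have "\<dots> = (\<integral>\<^sup>+x. \<beta> x * (\<integral>\<^sup>+n. F (x \<otimes> n) \<partial>\<nu>) \<partial>\<mu>)"
    by (rule nn_integral_N_symmetric[symmetric]) (rule beta_measurable, rule F)
  finally show ?thesis
    by (simp add: nn_integral_quot_measure[OF fibre_integral_measurable[OF F]])
qed

text \<open>In Weil's formula the indicator of a saturated set leaves the inner integral, and only
  the coset integrals of w remain. This converts coefficients over G into coefficients over the
  quotient with an extra factor.\<close>

lemma distr_density_quot: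
  assumes w [measurable]: "w \<in> borel_measurable BG"
  shows "distr (density \<mu> w) quot_alg (\<lambda>x. x) = density quot_measure (\<lambda>x. \<integral>\<^sup>+n. w (x \<otimes> n) \<partial>\<nu>)"
proof (rule measure_eqI)
  show "sets (distr (density \<mu> w) quot_alg (\<lambda>x. x)) = sets (density quot_measure (\<lambda>x. \<integral>\<^sup>+n. w (x \<otimes> n) \<partial>\<nu>))"
    by (simp add: sets_quot_measure)
  fix A assume "A \<in> sets (distr (density \<mu> w) quot_alg (\<lambda>x. x))"
  then have A [measurable]: "A \<in> sets quot_alg" and As: "A \<in> saturated" by (simp_all add: sets_quot_alg)
  have [measurable]: "A \<in> sets BG" using saturatedD(1)[OF As] .
  then have A\<mu>: "A \<in> sets \<mu>" by (simp add: sets_haar)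
  have "emeasure (distr (density \<mu> w) quot_alg (\<lambda>x. x)) A = emeasure (density \<mu> w) A"
    using saturatedD(2)[OF As] by (subst emeasure_distr[OF measurable_id_density A]) (simp add: space_haar Int_absorb2)
  also have "\<dots> = (\<integral>\<^sup>+x. w x * indicator A x \<partial>\<mu>)" by (rule emeasure_density[OF measurable_mu[OF w] A\<mu>])
  also have "\<dots> = (\<integral>\<^sup>+x. (\<integral>\<^sup>+n. w (x \<otimes> n) * indicator A (x \<otimes> n) \<partial>\<nu>) \<partial>quot_measure)"
    by (rule Weil_formula) measurable
  also have "\<dots> = (\<integral>\<^sup>+x. (\<integral>\<^sup>+n. w (x \<otimes> n) \<partial>\<nu>) * indicator A x \<partial>quot_measure)"
  proof (rule nn_integral_cong)
    fix x assume "x \<in> space quot_measure"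
    then have x: "x \<in> carrier G" by (simp add: space_quot_measure)
    have [measurable]: "x \<in> space BG" using x by (rule space_BG)
    have "(\<integral>\<^sup>+n. w (x \<otimes> n) * indicator A (x \<otimes> n) \<partial>\<nu>) = (\<integral>\<^sup>+n. w (x \<otimes> n) * indicator A x \<partial>\<nu>)"
      by (rule nn_integral_cong) (simp add: space_nu saturated_iff[OF As x] indicator_def)
    also have "\<dots> = (\<integral>\<^sup>+n. w (x \<otimes> n) \<partial>\<nu>) * indicator A x"
      by (rule nn_integral_multc) measurable
    finally show "(\<integral>\<^sup>+n. w (x \<otimes> n) * indicator A (x \<otimes> n) \<partial>\<nu>) = (\<integral>\<^sup>+n. w (x \<otimes> n) \<partial>\<nu>) * indicator A x" .
  qed
  also have "\<dots> = emeasure (density quot_measure (\<lambda>x. \<integral>\<^sup>+n. w (x \<otimes> n) \<partial>\<nu>)) A"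
    using fibre_integral_measurable[OF w] A
    by (intro emeasure_density[symmetric]) (simp_all add: measurable_cong_sets[OF sets_quot_measure refl] sets_quot_measure)
  finally show "emeasure (distr (density \<mu> w) quot_alg (\<lambda>x. x)) A
    = emeasure (density quot_measure (\<lambda>x. \<integral>\<^sup>+n. w (x \<otimes> n) \<partial>\<nu>)) A" .
qed

lemma translate_quot_alg:
  assumes g: "g \<in> carrier G"
  shows "(\<lambda>x. g \<otimes> x) \<in> measurable quot_alg quot_alg"
proof (rule measurableI)
  fix A assume "A \<in> sets quot_alg"
  then have A: "A \<in> saturated" by (simp add: sets_quot_alg)
  have [measurable]: "g \<in> space BG" using g by (rule space_BG)
  have "(\<lambda>x. g \<otimes> x) -` A \<inter> space BG \<in> sets BG"
    using saturatedD(1)[OF A] by measurable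
  then show "(\<lambda>x. g \<otimes> x) -` A \<inter> space quot_alg \<in> sets quot_alg"
    using saturated_iff[OF A] g N_carrier by (auto simp: sets_quot_alg saturated_def topspace_eq m_assoc[symmetric])
qed (use g in simp)

text \<open>Translation by g replaces \<open>\<beta>\<close> by its translate, whose integral over
  every coset is still 1; by Weil's formula, any such weight gives the same measure of a saturated
  set.\<close>

sublocale Q: left_invariant_measure G quot_measure
proof
  show "space quot_measure = carrier G" by (rule space_quot_measure)
  fix g assume g: "g \<in> carrier G"
  show m: "(\<lambda>x. g \<otimes> x) \<in> measurable quot_measure quot_measure"
    using translate_quot_alg[OF g] by (simp add: measurable_cong_sets[OF sets_quot_measure sets_quot_measure])
  show "distr quot_measure quot_measure (\<lambda>x. g \<otimes> x) = quot_measure"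
  proof (rule measure_eqI)
    fix A assume "A \<in> sets (distr quot_measure quot_measure (\<lambda>x. g \<otimes> x))"
    then have A: "A \<in> sets quot_measure" by simp
    then have A': "A \<in> sets quot_alg" and As: "A \<in> saturated" by (simp_all add: sets_quot_measure sets_quot_alg)
    have [measurable]: "A \<in> sets BG" using saturatedD(1)[OF As] .
    have [measurable]: "g \<in> space BG" "inv g \<in> space BG" using g by (simp_all add: topspace_eq)
    have meas: "(\<lambda>x. indicator A (g \<otimes> x) :: ennreal) \<in> borel_measurable quot_alg"
      using measurable_compose[OF translate_quot_alg[OF g], of "indicator A :: 'a \<Rightarrow> ennreal"] A' by simp
    have "emeasure (distr quot_measure quot_measure (\<lambda>x. g \<otimes> x)) A = (\<integral>\<^sup>+x. indicator A (g \<otimes> x) \<partial>quot_measure)"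
      using A by (subst nn_integral_distr[OF m, symmetric]) auto
    also have "\<dots> = (\<integral>\<^sup>+x. \<beta> x * indicator A (g \<otimes> x) \<partial>\<mu>)"
      by (rule nn_integral_quot_measure[OF meas])
    also have "\<dots> = (\<integral>\<^sup>+x. \<beta> (inv g \<otimes> (g \<otimes> x)) * indicator A (g \<otimes> x) \<partial>\<mu>)"
      by (rule nn_integral_cong) (simp add: space_haar g m_assoc[symmetric])
    also have "\<dots> = (\<integral>\<^sup>+x. \<beta> (inv g \<otimes> x) * indicator A x \<partial>\<mu>)"
    proof (rule nn_integral_translate[OF _ g, of "\<lambda>x. \<beta> (inv g \<otimes> x) * indicator A x"])
      have "(\<lambda>x. \<beta> (inv g \<otimes> x) * indicator A x) \<in> borel_measurable BG" by measurable
      then show "(\<lambda>x. \<beta> (inv g \<otimes> x) * indicator A x) \<in> borel_measurable \<mu>"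
        by (simp add: measurable_cong_sets[OF sets_haar refl])
    qed
    also have "\<dots> = (\<integral>\<^sup>+x. (\<integral>\<^sup>+n. \<beta> (inv g \<otimes> (x \<otimes> n)) * indicator A (x \<otimes> n) \<partial>\<nu>) \<partial>quot_measure)"
      by (rule Weil_formula) measurable
    also have "\<dots> = (\<integral>\<^sup>+x. indicator A x \<partial>quot_measure)"
    proof (rule nn_integral_cong)
      fix x assume "x \<in> space quot_measure"
      then have x: "x \<in> carrier G" by (simp add: space_quot_measure)
      have [measurable]: "inv g \<otimes> x \<in> space BG" using x g by (simp add: topspace_eq)
      have "(\<integral>\<^sup>+n. \<beta> (inv g \<otimes> (x \<otimes> n)) * indicator A (x \<otimes> n) \<partial>\<nu>)
        = (\<integral>\<^sup>+n. \<beta> ((inv g \<otimes> x) \<otimes> n) * indicator A x \<partial>\<nu>)"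
        by (rule nn_integral_cong) (simp add: space_nu saturated_iff[OF As x] indicator_def m_assoc x g N_carrier)
      also have "\<dots> = (\<integral>\<^sup>+n. \<beta> ((inv g \<otimes> x) \<otimes> n) \<partial>\<nu>) * indicator A x"
        by (rule nn_integral_multc) measurable
      finally show "(\<integral>\<^sup>+n. \<beta> (inv g \<otimes> (x \<otimes> n)) * indicator A (x \<otimes> n) \<partial>\<nu>) = indicator A x"
        using x g by (simp add: beta_integral)
    qed
    also have "\<dots> = emeasure quot_measure A" using A by simp
    finally show "emeasure (distr quot_measure quot_measure (\<lambda>x. g \<otimes> x)) A = emeasure quot_measure A" .
  qed simp
qed

lemma integral_distr_density:
  fixes f :: "'a \<Rightarrow> 'c :: {banach, second_countable_topology}"
  assumes w [measurable]: "w \<in> borel_measurable BG" and fin: "AE x in \<mu>. w x < \<infinity>"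
    and f: "f \<in> borel_measurable quot_alg"
  shows "(\<integral>x. f x \<partial>distr (density \<mu> w) quot_alg (\<lambda>x. x)) = (\<integral>x. enn2real (w x) *\<^sub>R f x \<partial>\<mu>)"
    "integrable (distr (density \<mu> w) quot_alg (\<lambda>x. x)) f \<longleftrightarrow> integrable \<mu> (\<lambda>x. enn2real (w x) *\<^sub>R f x)"
proof -
  have w': "(\<lambda>x. enn2real (w x)) \<in> borel_measurable \<mu>" by (rule measurable_mu) measurable
  have "AE x in \<mu>. w x = ennreal (enn2real (w x))" using fin by eventually_elim simp
  then have d: "density \<mu> w = density \<mu> (\<lambda>x. ennreal (enn2real (w x)))"
    using w' measurable_mu[OF w] by (intro density_cong) auto
  have f': "f \<in> borel_measurable \<mu>" by (rule measurable_mu[OF measurable_quot_alg_BG[OF f]])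
  show "(\<integral>x. f x \<partial>distr (density \<mu> w) quot_alg (\<lambda>x. x)) = (\<integral>x. enn2real (w x) *\<^sub>R f x \<partial>\<mu>)"
    using integral_distr[OF measurable_id_density f] integral_density[OF f' w'] by (simp add: d)
  show "integrable (distr (density \<mu> w) quot_alg (\<lambda>x. x)) f \<longleftrightarrow> integrable \<mu> (\<lambda>x. enn2real (w x) *\<^sub>R f x)"
    using integrable_distr_eq[OF measurable_id_density f] integrable_density[OF f' w'] by (simp add: d)
qed

lemma beta_AE_finite: "AE x in \<mu>. \<beta> x < \<infinity>"
  by (rule AE_I2) (use beta_finite in \<open>simp add: space_haar\<close>)

lemma measurable_Q: "f \<in> measurable quot_measure L \<longleftrightarrow> f \<in> measurable quot_alg L"
  by (simp add: measurable_cong_sets[OF sets_quot_measure refl])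

lemma integral_quot:
  fixes f :: "'a \<Rightarrow> 'c :: {banach, second_countable_topology}"
  assumes "f \<in> borel_measurable quot_alg"
  shows "(\<integral>x. f x \<partial>quot_measure) = (\<integral>x. enn2real (\<beta> x) *\<^sub>R f x \<partial>\<mu>)"
    "integrable quot_measure f \<longleftrightarrow> integrable \<mu> (\<lambda>x. enn2real (\<beta> x) *\<^sub>R f x)"
  unfolding quot_measure_def using integral_distr_density[OF beta_measurable beta_AE_finite assms] .

lemma saturation_open:
  "openin T {x \<in> carrier G. \<exists>n\<in>N. x \<otimes> n \<in> U j}"
proof -
  have "{x \<in> carrier G. \<exists>n\<in>N. x \<otimes> n \<in> U j} = (\<Union>n\<in>N. {x \<in> carrier G. x \<otimes> n \<in> U j})" by auto
  then show ?thesis using openin_vimage_right[OF U_open] N_carrier by (auto intro!: openin_Union)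
qed

section \<open>The quotient representation is nonzero and continuous\<close>

text \<open>A saturated set of positive finite measure is needed. The sets where the coset integral
  of the indicator of \<open>U j\<close> is at least 1/k cover G, and Markov's inequality with
  Weil's formula bounds their measures by k times \<mu> (\<open>U j\<close>). They cannot all be
  null.\<close>

lemma quot_nonzero: "\<exists>f\<in>square_integrable quot_measure. l2norm quot_measure f \<noteq> 0"
proof -
  define \<theta> where "\<theta> = (\<lambda>j x. \<integral>\<^sup>+n. indicator (U j) (x \<otimes> n) \<partial>\<nu>)"
  have Us [measurable]: "U j \<in> sets BG" for j by (rule openin_borel_alg[OF U_open])
  have thA [measurable]: "\<theta> j \<in> borel_measurable quot_alg" for j
    unfolding \<theta>_def by (rule fibre_integral_measurable) measurable
  define S where "S = (\<lambda>j k. {x \<in> space quot_alg. 1 \<le> of_nat k * \<theta> j x})"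
  have S: "S j k \<in> sets quot_alg" for j k unfolding S_def by measurable
  then have SQ: "S j k \<in> sets quot_measure" for j k by (simp add: sets_quot_measure)
  have thQ: "\<theta> j \<in> borel_measurable quot_measure" for j using thA by (simp add: measurable_Q)
  have fin: "emeasure quot_measure (S j k) < \<infinity>" for j k
  proof -
    have "emeasure quot_measure (S j k) = (\<integral>\<^sup>+x. indicator (S j k) x \<partial>quot_measure)" using SQ by simp
    also have "\<dots> \<le> (\<integral>\<^sup>+x. of_nat k * \<theta> j x \<partial>quot_measure)"
      by (rule nn_integral_mono) (auto simp: S_def indicator_def)
    also have "\<dots> = of_nat k * (\<integral>\<^sup>+x. \<theta> j x \<partial>quot_measure)"
      by (rule nn_integral_cmult[OF thQ])
    also have "(\<integral>\<^sup>+x. \<theta> j x \<partial>quot_measure) = (\<integral>\<^sup>+x. indicator (U j) x \<partial>\<mu>)"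
      unfolding \<theta>_def by (rule Weil_formula[symmetric]) measurable
    also have "\<dots> = emeasure \<mu> (U j)" using openin_sets_haar[OF U_open] by simp
    finally have "emeasure quot_measure (S j k) \<le> of_nat k * emeasure \<mu> (U j)" .
    also have "\<dots> < \<infinity>" using emeasure_subset_compact[OF U_K K_compact] by (simp add: ennreal_mult_less_top ennreal_of_nat_eq_real_of_nat)
    finally show ?thesis .
  qed
  have cover: "(\<Union>j. \<Union>k. S j k) = carrier G"
  proof
    show "carrier G \<subseteq> (\<Union>j. \<Union>k. S j k)"
    proof
      fix x assume x: "x \<in> carrier G"
      then obtain j where j: "x \<in> U j" using U_cover by blast
      let ?O = "{n \<in> carrier G. x \<otimes> n \<in> U j} \<inter> N"
      have O: "openin (subtopology T N) ?O"
        using openin_vimage_left[OF U_open x] by (auto simp: openin_subtopology)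
      have "\<theta> j x = (\<integral>\<^sup>+n. indicator ?O n \<partial>\<nu>)"
        unfolding \<theta>_def by (rule nn_integral_cong) (simp add: space_nu N_carrier indicator_def)
      then have "\<theta> j x = emeasure \<nu> ?O" using N.openin_sets_haar[OF O] by simp
      moreover have "\<one> \<in> ?O" using x j subgroup.one_closed[OF N_subgroup] by simp
      ultimately have pos: "\<theta> j x > 0" using N.emeasure_open_pos[OF O] by auto
      have "\<exists>k. 1 \<le> of_nat k * \<theta> j x"
      proof (cases "\<theta> j x" rule: ennreal_cases)
        case (real r)
        then have r: "r > 0" using pos by simp
        obtain k :: nat where "1 / r < real k" using reals_Archimedean2 by blast
        then have "1 \<le> real k * r" using r by (simp add: field_simps)
        then have "ennreal 1 \<le> ennreal (real k * r)" by (rule ennreal_leI)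
        also have "\<dots> = of_nat k * \<theta> j x" using real by (simp add: ennreal_mult ennreal_of_nat_eq_real_of_nat)
        finally show ?thesis by auto
      next
        case top
        then show ?thesis by (intro exI[of _ 1]) simp
      qed
      then show "x \<in> (\<Union>j. \<Union>k. S j k)" using x by (auto simp: S_def)
    qed
  qed (auto simp: S_def)
  have "\<exists>j k. emeasure quot_measure (S j k) \<noteq> 0"
  proof (rule ccontr)
    assume "\<not> (\<exists>j k. emeasure quot_measure (S j k) \<noteq> 0)"
    then have "S j k \<in> null_sets quot_measure" for j k using SQ by (auto intro: null_setsI)
    then have "(\<Union>j. \<Union>k. S j k) \<in> null_sets quot_measure" by (intro null_sets_UN) auto
    then have null: "AE x in quot_measure. False"
      unfolding cover by (intro AE_I'[of "carrier G"]) (auto simp: space_quot_measure)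
    \<comment> \<open>If the quotient measure vanished, Weil's formula for the constant 1 would make
      \<mu> vanish.\<close>
    have "emeasure \<mu> (space \<mu>) = (\<integral>\<^sup>+x. 1 \<partial>\<mu>)" by simp
    also have "\<dots> = (\<integral>\<^sup>+x. (\<integral>\<^sup>+n. 1 \<partial>\<nu>) \<partial>quot_measure)" by (rule Weil_formula) simp
    also have "\<dots> = (\<integral>\<^sup>+x. 0 \<partial>quot_measure)" by (rule nn_integral_cong_AE) (use null in eventually_elim, simp)
    also have "\<dots> = 0" by simp
    finally have "emeasure \<mu> (topspace T) = 0" by (simp only: space_haar topspace_eq)
    moreover have "topspace T \<noteq> {}" unfolding topspace_eq using one_closed by blast
    ultimately show False using emeasure_open_pos[OF openin_topspace] by (metis less_irrefl)
  qed
  then obtain j k where jk: "emeasure quot_measure (S j k) \<noteq> 0" by blast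
  let ?f = "\<lambda>x. complex_of_real (indicator (S j k) x)"
  have eq: "(cmod (?f x))\<^sup>2 = indicator (S j k) x" for x by (simp add: indicator_def)
  have int: "integrable quot_measure (indicator (S j k) :: 'a \<Rightarrow> real)" using SQ fin by simp
  have "?f \<in> square_integrable quot_measure"
    by (rule square_integrableI) (use SQ int in \<open>simp_all only: eq, measurable\<close>)
  moreover have "l2norm quot_measure ?f = sqrt (measure quot_measure (S j k))"
    unfolding l2norm_def eq using SQ sets.sets_into_space[OF SQ] by (simp add: Int_absorb2)
  moreover have "measure quot_measure (S j k) \<noteq> 0"
    using jk fin[of j k] by (simp add: emeasure_eq_ennreal_measure)
  ultimately show ?thesis by (intro bexI[of _ ?f]) simp_all
qed

text \<open>For an isometric translation, the squared distance of h to its translate is 2 (|h|^2 -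
  Re c) with L2 norms and c the coefficient. That coefficient is an integral over G in which the
  translation can be shifted to u, the product of \<open>\<beta>\<close> and the conjugate of h. Now
  u is integrable and h bounded, so continuity in L1 suffices.\<close>

lemma quot_continuous_bounded:
  assumes h: "h \<in> square_integrable quot_measure" "integrable quot_measure h" "\<And>x. cmod (h x) \<le> C"
    and e: "e > 0"
  shows "\<exists>V. openin T V \<and> \<one> \<in> V \<and> (\<forall>g\<in>V. l2norm quot_measure (\<lambda>x. h (inv g \<otimes> x) - h x) < e)"
proof -
  have C: "C \<ge> 0" using h(3)[of undefined] norm_ge_zero order_trans by blast
  have hq: "h \<in> borel_measurable quot_alg" using square_integrableD(1)[OF h(1)] by (simp add: measurable_Q)
  have h\<mu> [measurable]: "h \<in> borel_measurable \<mu>" by (rule measurable_mu[OF measurable_quot_alg_BG[OF hq]])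
  define u where "u = (\<lambda>x. enn2real (\<beta> x) *\<^sub>R cnj (h x))"
  have "integrable \<mu> (\<lambda>x. enn2real (\<beta> x) *\<^sub>R h x)" using h(2) integral_quot(2)[OF hq] by simp
  then have "integrable \<mu> (\<lambda>x. cnj (enn2real (\<beta> x) *\<^sub>R h x))" by (rule integrable_cnj)
  then have u: "integrable \<mu> u" by (simp add: u_def scaleR_conv_of_real)
  have uh: "integrable \<mu> (\<lambda>x. v x * h x)" if "integrable \<mu> v" for v
  proof (rule Bochner_Integration.integrable_bound)
    show "integrable \<mu> (\<lambda>x. C * cmod (v x))" using that by simp
    show "AE x in \<mu>. cmod (v x * h x) \<le> norm (C * cmod (v x))"
      using h(3) C by (auto simp: norm_mult abs_mult mult.commute intro!: mult_mono)
  qed (use that in \<open>auto intro: borel_measurable_integrable\<close>)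
  \<comment> \<open>The final bound is 2 e' C, which has to stay below e^2 also when C = 0.\<close>
  define e' where "e' = e\<^sup>2 / (2 * C + 1)"
  have "e' > 0" using e C by (simp add: e'_def)
  with integrable_translation_continuous[OF u]
  have "\<exists>V. openin T V \<and> \<one> \<in> V \<and> (\<forall>g\<in>V. (\<integral>x. norm (u (g \<otimes> x) - u x) \<partial>\<mu>) < e')"
    unfolding translation_continuous_def by (elim allE impE)
  then obtain V where V: "openin T V" "\<one> \<in> V" "\<And>g. g \<in> V \<Longrightarrow> (\<integral>x. norm (u (g \<otimes> x) - u x) \<partial>\<mu>) < e'"
    by auto
  have "l2norm quot_measure (\<lambda>x. h (inv g \<otimes> x) - h x) < e" if "g \<in> V" for g
  proof -
    have g: "g \<in> carrier G" using that openin_carrier[OF V(1)] by blast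
    let ?hg = "\<lambda>x. h (inv g \<otimes> x)"
    have hg: "?hg \<in> square_integrable quot_measure" by (rule Q.square_integrable_translate[OF h(1)]) (use g in simp)
    note ug = integrable_translate[OF u g]
    have coef: "(\<integral>x. cnj (h x) * k x \<partial>quot_measure) = (\<integral>x. u x * k x \<partial>\<mu>)" if "k \<in> square_integrable quot_measure" for k
    proof -
      have "(\<lambda>x. cnj (h x) * k x) \<in> borel_measurable quot_alg"
        using borel_measurable_integrable[OF integrable_cnj_mult[OF h(1) that]] by (simp add: measurable_Q)
      from integral_quot(1)[OF this] show ?thesis by (simp add: u_def)
    qed
    \<comment> \<open>Invariance of \<mu> under x \<mapsto> g x moves the translation from h to
      u.\<close>
    have "(\<integral>x. u x * ?hg x \<partial>\<mu>) = (\<integral>x. u (g \<otimes> x) * ?hg (g \<otimes> x) \<partial>\<mu>)"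
    proof (rule integral_translate[symmetric, OF _ g])
      have "?hg \<in> borel_measurable \<mu>" using measurable_translate[OF h\<mu>, of "inv g"] g by simp
      then show "(\<lambda>x. u x * ?hg x) \<in> borel_measurable \<mu>" using borel_measurable_integrable[OF u] by measurable
    qed
    also have "\<dots> = (\<integral>x. u (g \<otimes> x) * h x \<partial>\<mu>)"
      by (rule Bochner_Integration.integral_cong) (simp_all add: space_haar g m_assoc[symmetric])
    finally have 1: "(\<integral>x. cnj (h x) * ?hg x \<partial>quot_measure) = (\<integral>x. u (g \<otimes> x) * h x \<partial>\<mu>)"
      using coef[OF hg] by simp
    have "cmod ((\<integral>x. cnj (h x) * ?hg x \<partial>quot_measure) - (\<integral>x. cnj (h x) * h x \<partial>quot_measure))
      = cmod (\<integral>x. (u (g \<otimes> x) - u x) * h x \<partial>\<mu>)"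
      unfolding 1 coef[OF h(1)] using uh[OF ug] uh[OF u] by (simp add: left_diff_distrib)
    also have "\<dots> \<le> (\<integral>x. cmod ((u (g \<otimes> x) - u x) * h x) \<partial>\<mu>)" by (rule integral_norm_bound)
    also have "\<dots> \<le> (\<integral>x. cmod (u (g \<otimes> x) - u x) * C \<partial>\<mu>)"
    proof (rule integral_mono)
      show "integrable \<mu> (\<lambda>x. cmod ((u (g \<otimes> x) - u x) * h x))"
        using uh[of "\<lambda>x. u (g \<otimes> x) - u x"] u ug by auto
      show "cmod ((u (g \<otimes> x) - u x) * h x) \<le> cmod (u (g \<otimes> x) - u x) * C" for x
        unfolding norm_mult by (intro mult_left_mono h(3)) simp
    qed (use u ug in auto)
    also have "\<dots> = (\<integral>x. cmod (u (g \<otimes> x) - u x) \<partial>\<mu>) * C" by simp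
    also have "\<dots> \<le> e' * C" using V(3)[OF that] C by (intro mult_right_mono) auto
    finally have small: "cmod ((\<integral>x. cnj (h x) * ?hg x \<partial>quot_measure) - (\<integral>x. cnj (h x) * h x \<partial>quot_measure)) \<le> e' * C" .
    have "l2norm quot_measure ?hg = l2norm quot_measure h"
      by (rule Q.l2norm_translate) (use g square_integrableD(1)[OF h(1)] in auto)
    then have "(l2norm quot_measure (\<lambda>x. h x - ?hg x))\<^sup>2
       = 2 * ((l2norm quot_measure h)\<^sup>2 - Re (\<integral>x. cnj (h x) * ?hg x \<partial>quot_measure))"
      by (simp add: l2norm_diff_power2[OF h(1) hg])
    also have "(l2norm quot_measure h)\<^sup>2 = Re (\<integral>x. cnj (h x) * h x \<partial>quot_measure)"
      by (simp add: integral_cnj_mult_self l2norm_power2)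
    also have "2 * (Re (\<integral>x. cnj (h x) * h x \<partial>quot_measure) - Re (\<integral>x. cnj (h x) * ?hg x \<partial>quot_measure)) \<le> 2 * (e' * C)"
      using abs_Re_le_cmod[of "(\<integral>x. cnj (h x) * ?hg x \<partial>quot_measure) - (\<integral>x. cnj (h x) * h x \<partial>quot_measure)"] small by simp
    also have "\<dots> < e\<^sup>2" using e C by (simp add: e'_def field_simps)
    finally have "(l2norm quot_measure (\<lambda>x. h x - ?hg x))\<^sup>2 < e\<^sup>2" .
    then have "l2norm quot_measure (\<lambda>x. h x - ?hg x) < e" using e by (simp add: power2_less_imp_less)
    then show ?thesis by (simp add: l2norm_minus_commute[of _ h])
  qed
  then show ?thesis using V(1,2) by blast
qed

lemma quot_continuous:
  assumes f: "f \<in> square_integrable quot_measure" and e: "e > 0"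
  shows "\<exists>V. openin T V \<and> \<one> \<in> V \<and> (\<forall>g\<in>V. l2norm quot_measure (\<lambda>x. f (inv g \<otimes> x) - f x) < e)"
proof -
  obtain h C where h: "h \<in> square_integrable quot_measure" "integrable quot_measure h" "\<And>x. cmod (h x) \<le> C"
    and fh: "l2norm quot_measure (\<lambda>x. f x - h x) < e/3"
    using bounded_integrable_approx[OF f, of "e/3"] e by auto
  obtain V where V: "openin T V" "\<one> \<in> V"
    "\<And>g. g \<in> V \<Longrightarrow> l2norm quot_measure (\<lambda>x. h (inv g \<otimes> x) - h x) < e/3"
    using quot_continuous_bounded[OF h, of "e/3"] e by auto
  have "l2norm quot_measure (\<lambda>x. f (inv g \<otimes> x) - f x) < e" if "g \<in> V" for g
  proof -
    have g: "inv g \<in> carrier G" using that openin_carrier[OF V(1)] by blast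
    note sq = Q.square_integrable_translate[OF f g] Q.square_integrable_translate[OF h(1) g] h(1) f
    have "l2norm quot_measure (\<lambda>x. f (inv g \<otimes> x) - h (inv g \<otimes> x)) = l2norm quot_measure (\<lambda>x. f x - h x)"
      by (rule Q.l2norm_translate[OF square_integrableD(1)[OF square_integrable_diff[OF f h(1)]] g])
    then show ?thesis
      using l2norm_triangle_diff[OF sq(1,2,4)] l2norm_triangle_diff[OF sq(2,3,4)] V(3)[OF that] fh
        l2norm_minus_commute[of quot_measure f h] by linarith
  qed
  then show ?thesis using V(1,2) by blast
qed

lemma unitary_rep_quot: "unitary_rep G T Q.left_regular_rep_total"
  by (rule Q.unitary_rep_left_regular_rep_total[OF topological_group_axioms quot_nonzero quot_continuous])

end

section \<open>Weak containment\<close>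

context Bruhat
begin

text \<open>On the coset \<open>x N\<close>, \<open>smear a\<close> is a weighted average of left translates of \<open>a\<close>.\<close>

definition smear :: "('a \<Rightarrow> ennreal) \<Rightarrow> 'a \<Rightarrow> ennreal" where
  "smear a x = (\<integral>\<^sup>+n. \<beta> (x \<otimes> n) * a (inv n) \<partial>\<nu>)"

text \<open>For nonnegative a and l in N, the diagonal coefficient of a at l in the regular
  representation of N, with the value \<infinity> allowed.\<close>

definition corr :: "('a \<Rightarrow> ennreal) \<Rightarrow> 'a \<Rightarrow> ennreal" where
  "corr a l = (\<integral>\<^sup>+m. a m * a (inv l \<otimes> m) \<partial>\<nu>)"

lemma smear_measurable [measurable]:
  assumes [measurable]: "a \<in> borel_measurable BG"
  shows "smear a \<in> borel_measurable BG"
  unfolding smear_def by measurable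

lemma corr_measurable [measurable]:
  assumes [measurable]: "a \<in> borel_measurable BG"
  shows "corr a \<in> borel_measurable BG"
  unfolding corr_def by measurable

text \<open>Replacing n by m n, which \<nu> permits, exposes the left translates of a by n as
  functions of m, with weights that do not involve m.\<close>

lemma smear_right:
  assumes a [measurable]: "a \<in> borel_measurable BG" and x: "x \<in> carrier G" and m: "m \<in> N"
  shows "smear a (x \<otimes> m) = (\<integral>\<^sup>+n. \<beta> (x \<otimes> n) * a (inv n \<otimes> m) \<partial>\<nu>)"
proof -
  have [measurable]: "x \<in> space BG" "m \<in> space BG" using x m N_carrier by (simp_all add: topspace_eq)
  have "smear a (x \<otimes> m) = (\<integral>\<^sup>+n. \<beta> (x \<otimes> (m \<otimes> n)) * a (inv (m \<otimes> n) \<otimes> m) \<partial>\<nu>)"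
    unfolding smear_def using x m
    by (intro nn_integral_cong) (simp add: space_nu N_carrier m_assoc inv_mult_group)
  also have "\<dots> = (\<integral>\<^sup>+n. \<beta> (x \<otimes> n) * a (inv n \<otimes> m) \<partial>\<nu>)"
    by (rule nn_integral_translate_N[OF _ m, of "\<lambda>n. \<beta> (x \<otimes> n) * a (inv n \<otimes> m)"]) measurable
  finally show ?thesis .
qed

text \<open>Both factors are averages of translates of a. By Tonelli the product is integrated over
  m before the weights, and left invariance makes the integral of a(n^{-1}m) a(k^{-1}m) depend on
  n^{-1}k alone. The inner product of two fibres is therefore an average of correlations.\<close>

lemma smear_corr:
  assumes a [measurable]: "a \<in> borel_measurable BG" and x: "x \<in> carrier G" and y: "y \<in> carrier G"
  shows "(\<integral>\<^sup>+m. smear a (x \<otimes> m) * smear a (y \<otimes> m) \<partial>\<nu>)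
    = (\<integral>\<^sup>+n. (\<integral>\<^sup>+k. \<beta> (x \<otimes> n) * \<beta> (y \<otimes> k) * corr a (inv n \<otimes> k) \<partial>\<nu>) \<partial>\<nu>)"
proof -
  interpret P: pair_sigma_finite \<nu> \<nu> ..
  have [measurable]: "x \<in> space BG" "y \<in> space BG" using x y by (simp_all add: topspace_eq)
  let ?H = "\<lambda>m. \<integral>\<^sup>+k. \<beta> (y \<otimes> k) * a (inv k \<otimes> m) \<partial>\<nu>"
  have "(\<integral>\<^sup>+m. smear a (x \<otimes> m) * smear a (y \<otimes> m) \<partial>\<nu>)
    = (\<integral>\<^sup>+m. (\<integral>\<^sup>+n. \<beta> (x \<otimes> n) * a (inv n \<otimes> m) * ?H m \<partial>\<nu>) \<partial>\<nu>)"
  proof (rule nn_integral_cong)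
    fix m assume "m \<in> space \<nu>"
    then have m: "m \<in> N" by (simp add: space_nu)
    then have [measurable]: "m \<in> space BG" using N_carrier by (simp add: topspace_eq)
    have "(\<integral>\<^sup>+n. \<beta> (x \<otimes> n) * a (inv n \<otimes> m) * ?H m \<partial>\<nu>) = (\<integral>\<^sup>+n. \<beta> (x \<otimes> n) * a (inv n \<otimes> m) \<partial>\<nu>) * ?H m"
      by (rule nn_integral_multc) measurable
    then show "smear a (x \<otimes> m) * smear a (y \<otimes> m) = (\<integral>\<^sup>+n. \<beta> (x \<otimes> n) * a (inv n \<otimes> m) * ?H m \<partial>\<nu>)"
      by (simp add: smear_right[OF a _ m] x y)
  qed
  also have "\<dots> = (\<integral>\<^sup>+n. (\<integral>\<^sup>+m. \<beta> (x \<otimes> n) * a (inv n \<otimes> m) * ?H m \<partial>\<nu>) \<partial>\<nu>)"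
    by (rule P.Fubini') measurable
  also have "\<dots> = (\<integral>\<^sup>+n. (\<integral>\<^sup>+k. \<beta> (x \<otimes> n) * \<beta> (y \<otimes> k) * corr a (inv n \<otimes> k) \<partial>\<nu>) \<partial>\<nu>)"
  proof (rule nn_integral_cong)
    fix n assume "n \<in> space \<nu>"
    then have n: "n \<in> N" by (simp add: space_nu)
    then have [measurable]: "n \<in> space BG" using N_carrier by (simp add: topspace_eq)
    have "(\<integral>\<^sup>+m. \<beta> (x \<otimes> n) * a (inv n \<otimes> m) * ?H m \<partial>\<nu>)
      = (\<integral>\<^sup>+m. (\<integral>\<^sup>+k. \<beta> (x \<otimes> n) * a (inv n \<otimes> m) * (\<beta> (y \<otimes> k) * a (inv k \<otimes> m)) \<partial>\<nu>) \<partial>\<nu>)"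
    proof (rule nn_integral_cong)
      fix m assume "m \<in> space \<nu>"
      then have [measurable]: "m \<in> space BG" using N_carrier by (simp add: space_nu topspace_eq)
      show "\<beta> (x \<otimes> n) * a (inv n \<otimes> m) * ?H m
        = (\<integral>\<^sup>+k. \<beta> (x \<otimes> n) * a (inv n \<otimes> m) * (\<beta> (y \<otimes> k) * a (inv k \<otimes> m)) \<partial>\<nu>)"
        by (rule nn_integral_cmult[symmetric]) measurable
    qed
    also have "\<dots> = (\<integral>\<^sup>+k. (\<integral>\<^sup>+m. \<beta> (x \<otimes> n) * a (inv n \<otimes> m) * (\<beta> (y \<otimes> k) * a (inv k \<otimes> m)) \<partial>\<nu>) \<partial>\<nu>)"
      by (rule P.Fubini') measurable
    also have "\<dots> = (\<integral>\<^sup>+k. \<beta> (x \<otimes> n) * \<beta> (y \<otimes> k) * corr a (inv n \<otimes> k) \<partial>\<nu>)"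
    proof (rule nn_integral_cong)
      fix k assume "k \<in> space \<nu>"
      then have k: "k \<in> N" by (simp add: space_nu)
      then have [measurable]: "k \<in> space BG" using N_carrier by (simp add: topspace_eq)
      have "(\<integral>\<^sup>+m. \<beta> (x \<otimes> n) * a (inv n \<otimes> m) * (\<beta> (y \<otimes> k) * a (inv k \<otimes> m)) \<partial>\<nu>)
        = (\<integral>\<^sup>+m. \<beta> (x \<otimes> n) * \<beta> (y \<otimes> k) * (a (inv n \<otimes> m) * a (inv k \<otimes> m)) \<partial>\<nu>)"
        by (simp add: mult_ac)
      also have "\<dots> = \<beta> (x \<otimes> n) * \<beta> (y \<otimes> k) * (\<integral>\<^sup>+m. a (inv n \<otimes> m) * a (inv k \<otimes> m) \<partial>\<nu>)"
        by (rule nn_integral_cmult) measurable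
      also have "(\<integral>\<^sup>+m. a (inv n \<otimes> m) * a (inv k \<otimes> m) \<partial>\<nu>)
        = (\<integral>\<^sup>+m. a (inv n \<otimes> (n \<otimes> m)) * a (inv k \<otimes> (n \<otimes> m)) \<partial>\<nu>)"
        by (rule nn_integral_translate_N[OF _ n, symmetric, of "\<lambda>m. a (inv n \<otimes> m) * a (inv k \<otimes> m)"]) measurable
      also have "\<dots> = corr a (inv n \<otimes> k)"
        unfolding corr_def using n k N_carrier
        by (intro nn_integral_cong) (simp add: space_nu m_assoc[symmetric] inv_mult_group)
      finally show "(\<integral>\<^sup>+m. \<beta> (x \<otimes> n) * a (inv n \<otimes> m) * (\<beta> (y \<otimes> k) * a (inv k \<otimes> m)) \<partial>\<nu>)
        = \<beta> (x \<otimes> n) * \<beta> (y \<otimes> k) * corr a (inv n \<otimes> k)" .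
    qed
    finally show "(\<integral>\<^sup>+m. \<beta> (x \<otimes> n) * a (inv n \<otimes> m) * ?H m \<partial>\<nu>)
      = (\<integral>\<^sup>+k. \<beta> (x \<otimes> n) * \<beta> (y \<otimes> k) * corr a (inv n \<otimes> k) \<partial>\<nu>)" .
  qed
  finally show ?thesis .
qed

text \<open>The two sets of weights multiply to a probability on N \<times> N, so uniform bounds
  pass unchanged through the average.\<close>

lemma double_beta_integral:
  assumes x: "x \<in> carrier G" and y: "y \<in> carrier G"
  shows "(\<integral>\<^sup>+n. (\<integral>\<^sup>+k. \<beta> (x \<otimes> n) * \<beta> (y \<otimes> k) * c \<partial>\<nu>) \<partial>\<nu>) = c"
proof -
  have [measurable]: "x \<in> space BG" "y \<in> space BG" using x y by (simp_all add: topspace_eq)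
  have "(\<integral>\<^sup>+k. \<beta> (x \<otimes> n) * \<beta> (y \<otimes> k) * c \<partial>\<nu>) = c * \<beta> (x \<otimes> n)" for n
  proof -
    have "(\<integral>\<^sup>+k. \<beta> (x \<otimes> n) * \<beta> (y \<otimes> k) * c \<partial>\<nu>) = (\<integral>\<^sup>+k. (c * \<beta> (x \<otimes> n)) * \<beta> (y \<otimes> k) \<partial>\<nu>)"
      by (simp add: mult_ac)
    also have "\<dots> = (c * \<beta> (x \<otimes> n)) * (\<integral>\<^sup>+k. \<beta> (y \<otimes> k) \<partial>\<nu>)"
      by (rule nn_integral_cmult) measurable
    finally show ?thesis using beta_integral[OF y] by simp
  qed
  moreover have "(\<integral>\<^sup>+n. c * \<beta> (x \<otimes> n) \<partial>\<nu>) = c * (\<integral>\<^sup>+n. \<beta> (x \<otimes> n) \<partial>\<nu>)"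
    by (rule nn_integral_cmult) measurable
  ultimately show ?thesis using beta_integral[OF x] by simp
qed

lemma smear_corr_le:
  assumes a: "a \<in> borel_measurable BG" and x: "x \<in> carrier G" and y: "y \<in> carrier G"
    and le: "\<And>l. l \<in> N \<Longrightarrow> corr a l \<le> c"
  shows "(\<integral>\<^sup>+m. smear a (x \<otimes> m) * smear a (y \<otimes> m) \<partial>\<nu>) \<le> c"
proof -
  have "(\<integral>\<^sup>+m. smear a (x \<otimes> m) * smear a (y \<otimes> m) \<partial>\<nu>)
    \<le> (\<integral>\<^sup>+n. (\<integral>\<^sup>+k. \<beta> (x \<otimes> n) * \<beta> (y \<otimes> k) * c \<partial>\<nu>) \<partial>\<nu>)"
    unfolding smear_corr[OF a x y]
    by (intro nn_integral_mono mult_left_mono le) (simp_all add: space_nu N_mult N_inv)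
  then show ?thesis by (simp add: double_beta_integral[OF x y])
qed

text \<open>With y = x the fibre bound says that the square of \<open>smear a\<close> is integrable
  along every coset, so it is infinite on a null part of each; Weil's formula assembles these into a
  \<mu>-null set. Finiteness matters because \<open>enn2real\<close> sends \<infinity> to 0.\<close>

lemma smear_AE_finite:
  assumes a [measurable]: "a \<in> borel_measurable BG"
    and le: "\<And>l. l \<in> N \<Longrightarrow> corr a l \<le> c" and c: "c < \<infinity>"
  shows "AE x in \<mu>. smear a x < \<infinity>"
proof -
  let ?Z = "{x \<in> space BG. smear a x = \<infinity>}"
  have Z [measurable]: "?Z \<in> sets BG" by measurable
  have "emeasure \<mu> ?Z = (\<integral>\<^sup>+x. indicator ?Z x \<partial>\<mu>)" using Z by (simp add: sets_haar)
  also have "\<dots> = (\<integral>\<^sup>+x. (\<integral>\<^sup>+n. indicator ?Z (x \<otimes> n) \<partial>\<nu>) \<partial>quot_measure)"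
    by (rule Weil_formula) measurable
  also have "\<dots> = (\<integral>\<^sup>+x. 0 \<partial>quot_measure)"
  proof (rule nn_integral_cong)
    fix x assume "x \<in> space quot_measure"
    then have x: "x \<in> carrier G" by (simp add: space_quot_measure)
    then have [measurable]: "x \<in> space BG" by (simp add: topspace_eq)
    have m: "(\<lambda>m. smear a (x \<otimes> m) * smear a (x \<otimes> m)) \<in> borel_measurable \<nu>" by measurable
    have "(\<integral>\<^sup>+m. smear a (x \<otimes> m) * smear a (x \<otimes> m) \<partial>\<nu>) \<noteq> \<infinity>"
      using le_less_trans[OF smear_corr_le[OF a x x le] c] by simp
    then have "AE m in \<nu>. smear a (x \<otimes> m) * smear a (x \<otimes> m) \<noteq> \<infinity>" by (rule nn_integral_noteq_infinite[OF m])
    then have "AE m in \<nu>. indicator ?Z (x \<otimes> m) = (0 :: ennreal)"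
      by eventually_elim (auto simp: indicator_def)
    from nn_integral_cong_AE[OF this] show "(\<integral>\<^sup>+n. indicator ?Z (x \<otimes> n) \<partial>\<nu>) = 0" by simp
  qed
  also have "\<dots> = 0" by simp
  finally have "?Z \<in> null_sets \<mu>" using Z by (auto simp: sets_haar intro: null_setsI)
  then show ?thesis by (rule AE_I') (auto simp: space_haar topspace_eq not_less top_unique)
qed

section \<open>From square-integrable functions on N to bounds on correlations\<close>

text \<open>The correlation of |z| at l lies between the modulus of the coefficient of z and the
  squared norm of z, by the triangle inequality and by Cauchy-Schwarz. Extension by zero from the
  closed set N gives a Borel function on G, as \<open>smear\<close> and \<open>corr\<close>
  expect.\<close>

definition extend_norm :: "('a \<Rightarrow> complex) \<Rightarrow> 'a \<Rightarrow> ennreal" where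
  "extend_norm z x = ennreal (cmod (z x)) * indicator N x"

lemma extend_norm_measurable:
  assumes z: "z \<in> borel_measurable \<nu>"
  shows "extend_norm z \<in> borel_measurable BG"
proof -
  have "(\<lambda>x. x) \<in> measurable (restrict_space BG N) BN"
    by (rule measurable_G_to_N) (auto simp: space_restrict_space intro: measurable_restrict_space1)
  moreover have "(\<lambda>x. ennreal (cmod (z x))) \<in> borel_measurable BN"
    using z by (simp add: measurable_cong_sets[OF N.sets_haar refl])
  ultimately have m: "(\<lambda>x. ennreal (cmod (z x))) \<in> borel_measurable (restrict_space BG N)"
    by (rule measurable_compose)
  have "N \<inter> space BG \<in> sets BG"
    using closedin_borel_alg[OF closedin] N_subset by (simp add: topspace_eq Int_absorb2)
  from borel_measurable_restrict_space_iff_ennreal[OF this, THEN iffD1, OF m] show ?thesis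
    unfolding extend_norm_def[abs_def] .
qed

lemma corr_extend_norm:
  assumes z: "z \<in> square_integrable \<nu>" and l: "l \<in> N"
  shows "corr (extend_norm z) l = ennreal (\<integral>m. cmod (z m) * cmod (z (inv l \<otimes> m)) \<partial>\<nu>)"
proof -
  have z': "(\<lambda>m. z (inv l \<otimes> m)) \<in> square_integrable \<nu>"
    using N.square_integrable_translate[OF z, of "inv l"] l N_inv by simp
  have "corr (extend_norm z) l = (\<integral>\<^sup>+m. ennreal (cmod (z m) * cmod (z (inv l \<otimes> m))) \<partial>\<nu>)"
    unfolding corr_def extend_norm_def using l
    by (intro nn_integral_cong) (simp add: space_nu N_mult N_inv ennreal_mult)
  also have "\<dots> = ennreal (\<integral>m. cmod (z m) * cmod (z (inv l \<otimes> m)) \<partial>\<nu>)"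
    by (rule nn_integral_eq_integral[OF integrable_norm_mult[OF z z']]) simp
  finally show ?thesis .
qed

lemma corr_extend_norm_le:
  assumes z: "z \<in> square_integrable \<nu>" and l: "l \<in> N"
  shows "corr (extend_norm z) l \<le> ennreal ((l2norm \<nu> z)\<^sup>2)"
proof -
  have z': "(\<lambda>m. z (inv l \<otimes> m)) \<in> square_integrable \<nu>" "l2norm \<nu> (\<lambda>m. z (inv l \<otimes> m)) = l2norm \<nu> z"
    using N.square_integrable_translate[OF z, of "inv l"] N.l2norm_translate[OF square_integrableD(1)[OF z], of "inv l"] l N_inv
    by simp_all
  show ?thesis
    unfolding corr_extend_norm[OF z l] using Cauchy_Schwarz_l2norm[OF z z'(1)]
    by (intro ennreal_leI) (simp add: z'(2) power2_eq_square)
qed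

lemma corr_extend_norm_ge:
  assumes z: "z \<in> square_integrable \<nu>" and l: "l \<in> N"
  shows "ennreal (cmod (\<integral>m. cnj (z m) * z (inv l \<otimes> m) \<partial>\<nu>)) \<le> corr (extend_norm z) l"
proof -
  have "cmod (\<integral>m. cnj (z m) * z (inv l \<otimes> m) \<partial>\<nu>) \<le> (\<integral>m. cmod (cnj (z m) * z (inv l \<otimes> m)) \<partial>\<nu>)"
    by (rule integral_norm_bound)
  then show ?thesis unfolding corr_extend_norm[OF z l] by (intro ennreal_leI) (simp add: norm_mult)
qed

text \<open>
  The coefficients of \<open>f * smear (a i)\<close> in \<open>L2 \<mu>\<close> add up to the coefficient of \<open>f\<close> in \<open>L2\<close> of
  \<open>G / N\<close> with this factor under the integral; amenability brings it close to \<open>1\<close>.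
\<close>

definition bracket :: "nat \<Rightarrow> (nat \<Rightarrow> 'a \<Rightarrow> ennreal) \<Rightarrow> 'a \<Rightarrow> 'a \<Rightarrow> ennreal" where
  "bracket p a x y = (\<integral>\<^sup>+m. (\<Sum>i<p. smear (a i) (x \<otimes> m) * smear (a i) (y \<otimes> m)) \<partial>\<nu>)"

lemma bracket_eq:
  assumes a: "\<And>i. a i \<in> borel_measurable BG" and x: "x \<in> carrier G" and y: "y \<in> carrier G"
  shows "bracket p a x y = (\<integral>\<^sup>+n. (\<integral>\<^sup>+k. \<beta> (x \<otimes> n) * \<beta> (y \<otimes> k) * (\<Sum>i<p. corr (a i) (inv n \<otimes> k)) \<partial>\<nu>) \<partial>\<nu>)"
proof -
  note [measurable] = a
  have [measurable]: "x \<in> space BG" "y \<in> space BG" using x y by (simp_all add: topspace_eq)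
  have "bracket p a x y = (\<Sum>i<p. \<integral>\<^sup>+m. smear (a i) (x \<otimes> m) * smear (a i) (y \<otimes> m) \<partial>\<nu>)"
    unfolding bracket_def by (rule nn_integral_sum) measurable
  also have "\<dots> = (\<Sum>i<p. \<integral>\<^sup>+n. (\<integral>\<^sup>+k. \<beta> (x \<otimes> n) * \<beta> (y \<otimes> k) * corr (a i) (inv n \<otimes> k) \<partial>\<nu>) \<partial>\<nu>)"
    by (simp add: smear_corr[OF a x y])
  also have "\<dots> = (\<integral>\<^sup>+n. (\<Sum>i<p. \<integral>\<^sup>+k. \<beta> (x \<otimes> n) * \<beta> (y \<otimes> k) * corr (a i) (inv n \<otimes> k) \<partial>\<nu>) \<partial>\<nu>)"
    by (rule nn_integral_sum[symmetric]) measurable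
  also have "\<dots> = (\<integral>\<^sup>+n. (\<integral>\<^sup>+k. \<beta> (x \<otimes> n) * \<beta> (y \<otimes> k) * (\<Sum>i<p. corr (a i) (inv n \<otimes> k)) \<partial>\<nu>) \<partial>\<nu>)"
  proof (rule nn_integral_cong)
    fix n assume "n \<in> space \<nu>"
    then have [measurable]: "n \<in> space BG" using N_carrier by (simp add: space_nu topspace_eq)
    show "(\<Sum>i<p. \<integral>\<^sup>+k. \<beta> (x \<otimes> n) * \<beta> (y \<otimes> k) * corr (a i) (inv n \<otimes> k) \<partial>\<nu>)
      = (\<integral>\<^sup>+k. \<beta> (x \<otimes> n) * \<beta> (y \<otimes> k) * (\<Sum>i<p. corr (a i) (inv n \<otimes> k)) \<partial>\<nu>)"
      by (subst nn_integral_sum[symmetric]) (measurable, simp add: sum_distrib_left)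
  qed
  finally show ?thesis .
qed

lemma bracket_le:
  assumes a: "\<And>i. a i \<in> borel_measurable BG" and x: "x \<in> carrier G" and y: "y \<in> carrier G"
    and le: "\<And>l. l \<in> N \<Longrightarrow> (\<Sum>i<p. corr (a i) l) \<le> c"
  shows "bracket p a x y \<le> c"
proof -
  have "bracket p a x y \<le> (\<integral>\<^sup>+n. (\<integral>\<^sup>+k. \<beta> (x \<otimes> n) * \<beta> (y \<otimes> k) * c \<partial>\<nu>) \<partial>\<nu>)"
    unfolding bracket_eq[OF a x y]
    by (intro nn_integral_mono mult_left_mono le) (simp_all add: space_nu N_mult N_inv)
  then show ?thesis by (simp add: double_beta_integral[OF x y])
qed

text \<open>The lower bound on correlations is asked for only where both weights are nonzero. There
  n^{-1}k is confined to a compact subset of N, the only place where amenability provides it; the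
  matching upper bound holds on all of N.\<close>

lemma bracket_ge:
  assumes a: "\<And>i. a i \<in> borel_measurable BG" and x: "x \<in> carrier G" and y: "y \<in> carrier G"
    and ge: "\<And>n k. n \<in> N \<Longrightarrow> k \<in> N \<Longrightarrow> \<beta> (x \<otimes> n) \<noteq> 0 \<Longrightarrow> \<beta> (y \<otimes> k) \<noteq> 0 \<Longrightarrow> c \<le> (\<Sum>i<p. corr (a i) (inv n \<otimes> k))"
  shows "c \<le> bracket p a x y"
proof -
  have "(\<integral>\<^sup>+n. (\<integral>\<^sup>+k. \<beta> (x \<otimes> n) * \<beta> (y \<otimes> k) * c \<partial>\<nu>) \<partial>\<nu>) \<le> bracket p a x y"
    unfolding bracket_eq[OF a x y]
  proof (intro nn_integral_mono)
    fix n k assume "n \<in> space \<nu>" "k \<in> space \<nu>"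
    then have "n \<in> N" "k \<in> N" by (simp_all add: space_nu)
    from ge[OF this]
    show "\<beta> (x \<otimes> n) * \<beta> (y \<otimes> k) * c \<le> \<beta> (x \<otimes> n) * \<beta> (y \<otimes> k) * (\<Sum>i<p. corr (a i) (inv n \<otimes> k))"
      by (cases "\<beta> (x \<otimes> n) = 0 \<or> \<beta> (y \<otimes> k) = 0") (auto intro: mult_left_mono)
  qed
  then show ?thesis by (simp add: double_beta_integral[OF x y])
qed

text \<open>By Weil's formula the coefficients of the products of f with the smeared functions add
  up to the integral of B H, where H is the integrand of the coefficient of f and B the
  \<open>bracket\<close> of x and g^{-1}x. As B is within \<delta> of 1 wherever H is nonzero, the
  error is at most \<delta> times the integral of |H|, and Cauchy-Schwarz finishes.\<close>

lemma coefficient_approx: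
  fixes p :: nat
  assumes f: "f \<in> square_integrable quot_measure"
    and supp: "\<And>x. x \<in> carrier G \<Longrightarrow> f x \<noteq> 0 \<Longrightarrow> \<exists>n\<in>N. x \<otimes> n \<in> U j"
    and z: "\<And>i. i < p \<Longrightarrow> z i \<in> square_integrable \<nu>" and \<delta>: "\<delta> > 0"
    and upper: "(\<Sum>i<p. (l2norm \<nu> (z i))\<^sup>2) \<le> 1 + \<delta>"
    and C: "C \<subseteq> carrier G"
    and lower: "\<And>u v g. u \<in> U j \<Longrightarrow> v \<in> U j \<Longrightarrow> g \<in> C \<Longrightarrow> inv u \<otimes> g \<otimes> v \<in> N \<Longrightarrow>
      1 - \<delta> \<le> (\<Sum>i<p. cmod (\<integral>m. cnj (z i m) * z i (inv (inv u \<otimes> g \<otimes> v) \<otimes> m) \<partial>\<nu>))"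
  shows "\<exists>\<eta>. (\<forall>i<p. \<eta> i \<in> square_integrable \<mu>) \<and>
    (\<forall>g\<in>C. cmod ((\<integral>x. cnj (f x) * f (inv g \<otimes> x) \<partial>quot_measure)
      - (\<Sum>i<p. \<integral>x. cnj (\<eta> i x) * \<eta> i (inv g \<otimes> x) \<partial>\<mu>)) \<le> \<delta> * (l2norm quot_measure f)\<^sup>2)"
proof -
  define a where "a = (\<lambda>i. if i < p then extend_norm (z i) else (\<lambda>_. 0))"
  have a [measurable]: "a i \<in> borel_measurable BG" for i
    unfolding a_def using extend_norm_measurable[OF square_integrableD(1)[OF z]] by simp
  define w where "w = (\<lambda>i. smear (a i))"
  have w [measurable]: "w i \<in> borel_measurable BG" for i unfolding w_def by measurable
  have corr_le: "corr (a i) l \<le> ennreal ((l2norm \<nu> (z i))\<^sup>2)" if "i < p" "l \<in> N" for i l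
    using corr_extend_norm_le[OF z[OF that(1)] that(2)] that by (simp add: a_def)
  have wfin: "AE x in \<mu>. w i x < \<infinity>" if "i < p" for i
    unfolding w_def by (rule smear_AE_finite[OF a corr_le[OF that]]) simp_all
  have sum_corr_le: "(\<Sum>i<p. corr (a i) l) \<le> ennreal (1 + \<delta>)" if "l \<in> N" for l
  proof -
    have "(\<Sum>i<p. corr (a i) l) \<le> (\<Sum>i<p. ennreal ((l2norm \<nu> (z i))\<^sup>2))"
      by (intro sum_mono corr_le that) simp
    also have "\<dots> = ennreal (\<Sum>i<p. (l2norm \<nu> (z i))\<^sup>2)" by (rule sum_ennreal) simp
    also have "\<dots> \<le> ennreal (1 + \<delta>)" by (rule ennreal_leI[OF upper])
    finally show ?thesis .
  qed
  have fq [measurable]: "f \<in> borel_measurable quot_alg" using square_integrableD(1)[OF f] by (simp add: measurable_Q)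
  have fB [measurable]: "f \<in> borel_measurable BG" by (rule measurable_quot_alg_BG[OF fq])
  have finv: "f (x \<otimes> n) = f x" if "x \<in> carrier G" "n \<in> N" for x n using quot_alg_invariant[OF fq that] .
  define \<eta> where "\<eta> = (\<lambda>i x. f x * complex_of_real (enn2real (w i x)))"
  \<comment> \<open>Along each coset f is constant and the square of \<open>w i\<close> integrates
    to at most the squared norm of \<open>z i\<close>; Weil's formula bounds the norm by the product
    of the two norms.\<close>
  have \<eta>: "\<eta> i \<in> square_integrable \<mu>" if i: "i < p" for i
  proof (rule square_integrableI)
    have "\<eta> i \<in> borel_measurable BG" unfolding \<eta>_def by measurable
    then show \<eta>m: "\<eta> i \<in> borel_measurable \<mu>" by (rule measurable_mu)
    have "(\<integral>\<^sup>+x. ennreal (norm ((cmod (\<eta> i x))\<^sup>2)) \<partial>\<mu>) \<le> (\<integral>\<^sup>+x. ennreal ((cmod (f x))\<^sup>2) * (w i x * w i x) \<partial>\<mu>)"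
    proof (rule nn_integral_mono)
      fix x
      have "ennreal (enn2real (w i x)) \<le> w i x" by (cases "w i x") auto
      then have "ennreal (enn2real (w i x)) * ennreal (enn2real (w i x)) \<le> w i x * w i x" by (intro mult_mono) auto
      then have "ennreal ((cmod (f x))\<^sup>2) * ennreal (enn2real (w i x) * enn2real (w i x)) \<le> ennreal ((cmod (f x))\<^sup>2) * (w i x * w i x)"
        by (intro mult_left_mono) (simp_all add: ennreal_mult)
      then show "ennreal (norm ((cmod (\<eta> i x))\<^sup>2)) \<le> ennreal ((cmod (f x))\<^sup>2) * (w i x * w i x)"
        by (simp add: \<eta>_def norm_mult power_mult_distrib ennreal_mult power2_eq_square[of "enn2real (w i x)"])
    qed
    also have "\<dots> = (\<integral>\<^sup>+x. (\<integral>\<^sup>+n. ennreal ((cmod (f (x \<otimes> n)))\<^sup>2) * (w i (x \<otimes> n) * w i (x \<otimes> n)) \<partial>\<nu>) \<partial>quot_measure)"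
      by (rule Weil_formula) measurable
    also have "\<dots> \<le> (\<integral>\<^sup>+x. ennreal ((l2norm \<nu> (z i))\<^sup>2) * ennreal ((cmod (f x))\<^sup>2) \<partial>quot_measure)"
    proof (rule nn_integral_mono)
      fix x assume "x \<in> space quot_measure"
      then have x: "x \<in> carrier G" by (simp add: space_quot_measure)
      then have [measurable]: "x \<in> space BG" by (simp add: topspace_eq)
      have "(\<integral>\<^sup>+n. ennreal ((cmod (f (x \<otimes> n)))\<^sup>2) * (w i (x \<otimes> n) * w i (x \<otimes> n)) \<partial>\<nu>)
        = (\<integral>\<^sup>+n. ennreal ((cmod (f x))\<^sup>2) * (w i (x \<otimes> n) * w i (x \<otimes> n)) \<partial>\<nu>)"
        by (rule nn_integral_cong) (simp add: space_nu finv x)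
      also have "\<dots> = ennreal ((cmod (f x))\<^sup>2) * (\<integral>\<^sup>+n. w i (x \<otimes> n) * w i (x \<otimes> n) \<partial>\<nu>)"
        by (rule nn_integral_cmult) measurable
      also have "\<dots> \<le> ennreal ((cmod (f x))\<^sup>2) * ennreal ((l2norm \<nu> (z i))\<^sup>2)"
        unfolding w_def by (intro mult_left_mono smear_corr_le[OF a x x] corr_le i) simp_all
      finally show "(\<integral>\<^sup>+n. ennreal ((cmod (f (x \<otimes> n)))\<^sup>2) * (w i (x \<otimes> n) * w i (x \<otimes> n)) \<partial>\<nu>)
        \<le> ennreal ((l2norm \<nu> (z i))\<^sup>2) * ennreal ((cmod (f x))\<^sup>2)" by (simp add: mult.commute)
    qed
    also have "\<dots> = ennreal ((l2norm \<nu> (z i))\<^sup>2) * ennreal ((l2norm quot_measure f)\<^sup>2)"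
      using nn_integral_l2norm[OF f] square_integrableD(1)[OF f] by (subst nn_integral_cmult) auto
    also have "\<dots> < \<infinity>" by (simp add: ennreal_mult_less_top)
    finally show "integrable \<mu> (\<lambda>x. (cmod (\<eta> i x))\<^sup>2)"
      using \<eta>m by (intro integrableI_bounded) auto
  qed
  have "cmod ((\<integral>x. cnj (f x) * f (inv g \<otimes> x) \<partial>quot_measure)
      - (\<Sum>i<p. \<integral>x. cnj (\<eta> i x) * \<eta> i (inv g \<otimes> x) \<partial>\<mu>)) \<le> \<delta> * (l2norm quot_measure f)\<^sup>2"
    if gC: "g \<in> C" for g
  proof -
    have g: "g \<in> carrier G" "inv g \<in> carrier G" using gC C by auto
    have [measurable]: "inv g \<in> space BG" using g by (simp add: topspace_eq)
    define H where "H = (\<lambda>x. cnj (f x) * f (inv g \<otimes> x))"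
    have fg: "(\<lambda>x. f (inv g \<otimes> x)) \<in> square_integrable quot_measure"
      by (rule Q.square_integrable_translate[OF f g(2)])
    have Hint: "integrable quot_measure H" unfolding H_def by (rule integrable_cnj_mult[OF f fg])
    have Hq: "H \<in> borel_measurable quot_alg" using borel_measurable_integrable[OF Hint] by (simp add: measurable_Q)
    define W where "W = (\<lambda>x. \<Sum>i<p. w i x * w i (inv g \<otimes> x))"
    have W [measurable]: "W \<in> borel_measurable BG" unfolding W_def by measurable
    have wfin': "AE x in \<mu>. \<forall>i\<in>{..<p}. w i x < \<infinity> \<and> w i (inv g \<otimes> x) < \<infinity>"
    proof (rule AE_ball_countable')
      fix i assume "i \<in> {..<p}"
      then have "i < p" by simp
      from wfin[OF this] AE_translate[OF wfin[OF this] g(2)]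
      show "AE x in \<mu>. w i x < \<infinity> \<and> w i (inv g \<otimes> x) < \<infinity>" by eventually_elim simp
    qed simp
    then have Wfin: "AE x in \<mu>. W x < \<infinity>"
      by eventually_elim (auto simp: W_def ennreal_mult_less_top)
    define B where "B = (\<lambda>x. \<integral>\<^sup>+n. W (x \<otimes> n) \<partial>\<nu>)"
    have Bq: "B \<in> borel_measurable quot_alg" unfolding B_def by (rule fibre_integral_measurable[OF W])
    have Beq: "B x = bracket p a x (inv g \<otimes> x)" if "x \<in> carrier G" for x
      unfolding B_def bracket_def W_def w_def using that g
      by (intro nn_integral_cong) (simp add: space_nu m_assoc N_carrier)
    have Ble: "B x \<le> ennreal (1 + \<delta>)" if "x \<in> carrier G" for x
      unfolding Beq[OF that] by (rule bracket_le[OF a that _ sum_corr_le]) (use that g in auto)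
    have Bge: "ennreal (1 - \<delta>) \<le> B x" if x: "x \<in> carrier G" and nz: "H x \<noteq> 0" for x
      unfolding Beq[OF x]
    proof (rule bracket_ge[OF a x])
      show gx: "inv g \<otimes> x \<in> carrier G" using x g by simp
      obtain r where r: "r \<in> N" "x \<otimes> r \<in> U j" using supp[OF x] nz by (auto simp: H_def)
      obtain s where s: "s \<in> N" "(inv g \<otimes> x) \<otimes> s \<in> U j" using supp[OF gx] nz by (auto simp: H_def)
      \<comment> \<open>The point y t shows that the coset of y meets \<open>U j\<close>, so the
        weights on this coset are supported in \<open>U j\<close>.\<close>
      have inU: "y \<otimes> n \<in> U j" if "y \<in> carrier G" "n \<in> N" "t \<in> N" "y \<otimes> t \<in> U j" "\<beta> (y \<otimes> n) \<noteq> 0" for y n t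
      proof (rule beta_support[OF _ _ _ that(5)])
        have "(y \<otimes> n) \<otimes> (inv n \<otimes> t) = y \<otimes> ((n \<otimes> inv n) \<otimes> t)"
          using that N_carrier by (simp only: m_assoc m_closed inv_closed)
        then show "(y \<otimes> n) \<otimes> (inv n \<otimes> t) \<in> U j" using that N_carrier by simp
      qed (use that N_carrier N_inv N_mult in auto)
      fix n k assume nk: "n \<in> N" "k \<in> N" "\<beta> (x \<otimes> n) \<noteq> 0" "\<beta> (inv g \<otimes> x \<otimes> k) \<noteq> 0"
      let ?u = "x \<otimes> n" and ?v = "inv g \<otimes> x \<otimes> k"
      have uv: "?u \<in> U j" "?v \<in> U j" using inU[OF x nk(1) r nk(3)] inU[OF gx nk(2) s nk(4)] by simp_all
      \<comment> \<open>For the two chosen points u = x n and v = g^{-1}x k this is the element of N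
        at which the hypothesis on coefficients is invoked.\<close>
      have l: "inv ?u \<otimes> g \<otimes> ?v = inv n \<otimes> k"
      proof -
        have "inv ?u \<otimes> g \<otimes> ?v = inv n \<otimes> (inv x \<otimes> ((g \<otimes> inv g) \<otimes> x)) \<otimes> k"
          using x g nk N_carrier by (simp only: inv_mult_group m_assoc m_closed inv_closed N_carrier)
        then show ?thesis using x g nk N_carrier by simp
      qed
      have lN: "inv n \<otimes> k \<in> N" using nk N_inv N_mult by simp
      have "1 - \<delta> \<le> (\<Sum>i<p. cmod (\<integral>m. cnj (z i m) * z i (inv (inv n \<otimes> k) \<otimes> m) \<partial>\<nu>))"
        using lower[OF uv gC] lN unfolding l by simp
      then have "ennreal (1 - \<delta>) \<le> (\<Sum>i<p. ennreal (cmod (\<integral>m. cnj (z i m) * z i (inv (inv n \<otimes> k) \<otimes> m) \<partial>\<nu>)))"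
        by (subst sum_ennreal) (auto intro: ennreal_leI)
      also have "\<dots> \<le> (\<Sum>i<p. corr (a i) (inv n \<otimes> k))"
        using corr_extend_norm_ge[OF z lN] by (intro sum_mono) (simp add: a_def)
      finally show "ennreal (1 - \<delta>) \<le> (\<Sum>i<p. corr (a i) (inv n \<otimes> k))" .
    qed
    have \<eta>g: "(\<lambda>x. \<eta> i (inv g \<otimes> x)) \<in> square_integrable \<mu>" if "i < p" for i
      by (rule square_integrable_translate[OF \<eta>[OF that] g(2)])
    have "(\<Sum>i<p. \<integral>x. cnj (\<eta> i x) * \<eta> i (inv g \<otimes> x) \<partial>\<mu>) = (\<integral>x. (\<Sum>i<p. cnj (\<eta> i x) * \<eta> i (inv g \<otimes> x)) \<partial>\<mu>)"
      by (rule Bochner_Integration.integral_sum[symmetric]) (simp add: integrable_cnj_mult \<eta> \<eta>g)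
    also have "\<dots> = (\<integral>x. enn2real (W x) *\<^sub>R H x \<partial>\<mu>)"
    proof (rule integral_cong_AE)
      show "(\<lambda>x. \<Sum>i<p. cnj (\<eta> i x) * \<eta> i (inv g \<otimes> x)) \<in> borel_measurable \<mu>"
        by (rule borel_measurable_sum) (simp add: borel_measurable_integrable integrable_cnj_mult \<eta> \<eta>g)
      show "(\<lambda>x. enn2real (W x) *\<^sub>R H x) \<in> borel_measurable \<mu>"
        using measurable_mu[OF measurable_quot_alg_BG[OF Hq]] measurable_mu[OF W] by measurable
      show "AE x in \<mu>. (\<Sum>i<p. cnj (\<eta> i x) * \<eta> i (inv g \<otimes> x)) = enn2real (W x) *\<^sub>R H x"
        \<comment> \<open>Off a null set all weights are finite, so \<open>enn2real\<close> respects
          the sum of products that defines W.\<close>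
        using wfin'
      proof eventually_elim
        case (elim x)
        have "W x = (\<Sum>i<p. ennreal (enn2real (w i x) * enn2real (w i (inv g \<otimes> x))))"
          unfolding W_def using elim by (intro sum.cong) (simp_all add: ennreal_mult)
        then have "W x = ennreal (\<Sum>i<p. enn2real (w i x) * enn2real (w i (inv g \<otimes> x)))"
          by simp
        then have "enn2real (W x) = (\<Sum>i<p. enn2real (w i x) * enn2real (w i (inv g \<otimes> x)))"
          by (simp add: sum_nonneg)
        then show ?case
          by (simp add: \<eta>_def H_def scaleR_conv_of_real sum_distrib_left mult_ac)
      qed
    qed
    \<comment> \<open>H is constant on cosets, so W enters only through its coset integrals
      B.\<close>
    also have "\<dots> = (\<integral>x. H x \<partial>density quot_measure B)"
      unfolding integral_distr_density(1)[OF W Wfin Hq, symmetric] distr_density_quot[OF W] B_def ..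
    also have "density quot_measure B = density quot_measure (\<lambda>x. ennreal (enn2real (B x)))"
    proof (rule density_cong)
      show "AE x in quot_measure. B x = ennreal (enn2real (B x))"
      proof (rule AE_I2)
        fix x assume "x \<in> space quot_measure"
        then have "B x \<le> ennreal (1 + \<delta>)" by (intro Ble) (simp add: space_quot_measure)
        then have "B x < \<infinity>" by (rule le_less_trans) simp
        then show "B x = ennreal (enn2real (B x))" by simp
      qed
    qed (use Bq in \<open>simp_all add: measurable_Q\<close>)
    also have "(\<integral>x. H x \<partial>density quot_measure (\<lambda>x. ennreal (enn2real (B x)))) = (\<integral>x. enn2real (B x) *\<^sub>R H x \<partial>quot_measure)"
      using Bq Hq by (intro integral_density) (simp_all add: measurable_Q)
    finally have sum_eq: "(\<Sum>i<p. \<integral>x. cnj (\<eta> i x) * \<eta> i (inv g \<otimes> x) \<partial>\<mu>) = (\<integral>x. enn2real (B x) *\<^sub>R H x \<partial>quot_measure)" .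
    have near: "\<bar>1 - enn2real (B x)\<bar> * cmod (H x) \<le> \<delta> * cmod (H x)" if x: "x \<in> carrier G" for x
    proof (cases "H x = 0")
      case False
      obtain b where b: "B x = ennreal b" "b \<ge> 0" using Ble[OF x] by (cases "B x") (auto simp: top_unique)
      have "b \<le> 1 + \<delta>" using Ble[OF x] \<delta> b by (simp add: ennreal_le_iff del: ennreal_plus)
      \<comment> \<open>When \<delta> > 1, \<open>ennreal (1 - \<delta>)\<close> is truncated to 0,
        but then the claim follows from b \<ge> 0.\<close>
      moreover have "1 - \<delta> \<le> b" using Bge[OF x False] b by (cases "1 - \<delta> \<ge> 0") (simp_all add: ennreal_le_iff)
      ultimately have "\<bar>1 - enn2real (B x)\<bar> \<le> \<delta>" using b by simp
      then show ?thesis by (intro mult_right_mono) simp_all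
    qed simp
    have BHint: "integrable quot_measure (\<lambda>x. (1 - enn2real (B x)) *\<^sub>R H x)"
    proof (rule Bochner_Integration.integrable_bound)
      show "integrable quot_measure (\<lambda>x. \<delta> * cmod (H x))" using Hint by simp
      show "(\<lambda>x. (1 - enn2real (B x)) *\<^sub>R H x) \<in> borel_measurable quot_measure"
        using Bq Hq unfolding measurable_Q by measurable
      show "AE x in quot_measure. norm ((1 - enn2real (B x)) *\<^sub>R H x) \<le> norm (\<delta> * cmod (H x))"
        using near \<delta> by (intro AE_I2) (simp add: space_quot_measure abs_mult)
    qed
    have "integrable quot_measure (\<lambda>x. H x - (1 - enn2real (B x)) *\<^sub>R H x)" using Hint BHint by simp
    then have BH: "integrable quot_measure (\<lambda>x. enn2real (B x) *\<^sub>R H x)" by (simp add: scaleR_diff_left)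
    have "cmod ((\<integral>x. H x \<partial>quot_measure) - (\<integral>x. enn2real (B x) *\<^sub>R H x \<partial>quot_measure))
      = cmod (\<integral>x. (1 - enn2real (B x)) *\<^sub>R H x \<partial>quot_measure)"
      using Hint BH by (simp add: scaleR_diff_left)
    also have "\<dots> \<le> (\<integral>x. cmod ((1 - enn2real (B x)) *\<^sub>R H x) \<partial>quot_measure)" by (rule integral_norm_bound)
    also have "\<dots> \<le> (\<integral>x. \<delta> * (cmod (f x) * cmod (f (inv g \<otimes> x))) \<partial>quot_measure)"
    proof (rule integral_mono)
      show "integrable quot_measure (\<lambda>x. cmod ((1 - enn2real (B x)) *\<^sub>R H x))" using BHint by (rule integrable_norm)
      show "integrable quot_measure (\<lambda>x. \<delta> * (cmod (f x) * cmod (f (inv g \<otimes> x))))"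
        using integrable_norm_mult[OF f fg] by simp
      fix x assume "x \<in> space quot_measure"
      then show "cmod ((1 - enn2real (B x)) *\<^sub>R H x) \<le> \<delta> * (cmod (f x) * cmod (f (inv g \<otimes> x)))"
        using near[of x] by (simp add: space_quot_measure H_def norm_mult)
    qed
    also have "\<dots> = \<delta> * (\<integral>x. cmod (f x) * cmod (f (inv g \<otimes> x)) \<partial>quot_measure)" by simp
    also have "\<dots> \<le> \<delta> * (l2norm quot_measure f * l2norm quot_measure (\<lambda>x. f (inv g \<otimes> x)))"
      using \<delta> by (intro mult_left_mono Cauchy_Schwarz_l2norm f fg) simp
    also have "l2norm quot_measure (\<lambda>x. f (inv g \<otimes> x)) = l2norm quot_measure f"
      by (rule Q.l2norm_translate[OF square_integrableD(1)[OF f] g(2)])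
    finally show ?thesis unfolding sum_eq H_def by (simp add: power2_eq_square)
  qed
  then show ?thesis using \<eta> by blast
qed

text \<open>A vector h is replaced by its restriction f to the cosets that meet some
  \<open>U j\<close>. For f, the elements of N that occur form a compact set, on which amenability
  approximates 1. Half of \<epsilon> pays for the restriction and half for the
  approximation.\<close>

lemma weakly_contained_quot:
  assumes amen: "weakly_contained (subtopology T N) unit_rep (left_regular_rep (G\<lparr>carrier := N\<rparr>) \<nu>)"
  shows "weakly_contained T Q.left_regular_rep_total (left_regular_rep G \<mu>)"
  unfolding weakly_contained_def
proof (intro ballI allI impI)
  fix \<xi> C and \<epsilon> :: real
  assume "\<xi> \<in> carrier (rep_space Q.left_regular_rep_total)" and C: "compactin T C" and e: "\<epsilon> > 0"
  then have "\<xi> \<in> carrier (L2 quot_measure)" by (simp add: Q.left_regular_rep_total_def)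
  then obtain h where h: "h \<in> square_integrable quot_measure" "\<xi> = L2_class quot_measure h" by (rule L2_carrierE)
  have hq: "h \<in> borel_measurable quot_alg" using square_integrableD(1)[OF h(1)] by (simp add: measurable_Q)
  define D where "D = l2norm quot_measure h"
  have D: "D \<ge> 0" by (simp add: D_def l2norm_nonneg)
  let ?S = "\<lambda>j. {x \<in> carrier G. \<exists>n\<in>N. x \<otimes> n \<in> U j}"
  have S: "?S j \<in> sets quot_alg" for j
  proof -
    have "x \<otimes> n \<in> ?S j" if x: "x \<in> ?S j" and n: "n \<in> N" for x n
    proof -
      obtain m where m: "m \<in> N" "x \<otimes> m \<in> U j" "x \<in> carrier G" using x by blast
      have "(x \<otimes> n) \<otimes> (inv n \<otimes> m) = x \<otimes> ((n \<otimes> inv n) \<otimes> m)"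
        using m n N_carrier by (simp only: m_assoc m_closed inv_closed)
      then have "(x \<otimes> n) \<otimes> (inv n \<otimes> m) \<in> U j" using m n N_carrier by simp
      moreover have "inv n \<otimes> m \<in> N" "x \<otimes> n \<in> carrier G" using m n N_carrier N_inv N_mult by simp_all
      ultimately show ?thesis by blast
    qed
    then show ?thesis using openin_borel_alg[OF saturation_open] by (simp only: sets_quot_alg saturated_def) blast
  qed
  \<comment> \<open>Cutting off along whole cosets keeps the function constant on cosets, hence
    measurable for the quotient.\<close>
  define s where "s = (\<lambda>j x. if x \<in> ?S j then h x else 0)"
  have sm: "s j \<in> borel_measurable quot_measure" for j
    unfolding measurable_Q s_def
    by (rule measurable_If_set[OF hq _ sets.Int[OF S sets.top]]) simp
  have "(\<lambda>j. l2norm quot_measure (\<lambda>x. h x - s j x)) \<longlonglongrightarrow> 0"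
  proof (rule l2norm_dominated[OF h(1) sm])
    show "cmod (h x - s j x) \<le> cmod (h x)" for j x by (simp add: s_def)
    fix x assume "x \<in> space quot_measure"
    then have x: "x \<in> carrier G" by (simp add: space_quot_measure)
    then obtain i where i: "x \<in> U i" using U_cover by blast
    have "\<forall>\<^sub>F j in sequentially. s j x = h x"
      using eventually_ge_at_top[of i]
    proof eventually_elim
      case (elim j)
      then have "x \<otimes> \<one> \<in> U j" using incseqD[OF U_incseq elim] i x by auto
      then have "x \<in> ?S j" using x subgroup.one_closed[OF N_subgroup] by blast
      then show ?case by (simp add: s_def)
    qed
    then show "(\<lambda>j. s j x) \<longlonglongrightarrow> h x" by (rule tendsto_eventually)
  qed
  \<comment> \<open>Replacing h by its cut-off changes a coefficient by at most 2 D times their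
    distance; the constant makes this less than \<epsilon>/2.\<close>
  moreover have "\<epsilon> / (4 * D + 1) > 0" using e D by simp
  ultimately have "\<forall>\<^sub>F j in sequentially. l2norm quot_measure (\<lambda>x. h x - s j x) < \<epsilon> / (4 * D + 1)"
    by (rule order_tendstoD(2))
  then obtain j where j: "l2norm quot_measure (\<lambda>x. h x - s j x) < \<epsilon> / (4 * D + 1)"
    by (meson eventually_happens trivial_limit_sequentially)
  define f where "f = s j"
  have f: "f \<in> square_integrable quot_measure"
    unfolding f_def by (rule square_integrable_bound[OF h(1) sm]) (simp add: s_def)
  have fD: "l2norm quot_measure f \<le> D"
    unfolding D_def l2norm_def using square_integrableD(2)[OF f] square_integrableD(2)[OF h(1)]
    by (intro real_sqrt_le_mono integral_mono) (auto simp: f_def s_def)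
  have supp: "\<exists>n\<in>N. x \<otimes> n \<in> U j" if "f x \<noteq> 0" for x using that by (auto simp: f_def s_def split: if_splits)
  \<comment> \<open>Chosen so that \<delta> D^2 < \<epsilon>/2, also when D = 0.\<close>
  define \<delta> where "\<delta> = \<epsilon> / (2 * D\<^sup>2 + 1)"
  have d: "\<delta> > 0" using e by (simp add: \<delta>_def add_nonneg_pos)
  \<comment> \<open>All u^{-1}g v in N with u, v in \<open>U j\<close> and g in C belong to L. The
    identity is included because the coefficients there are the squared norms, whose sum must not
    exceed 1 + \<delta>.\<close>
  define L where "L = insert \<one> ((((\<lambda>x. inv x) ` K j) <#> C <#> K j) \<inter> N)"
  have L: "compactin (subtopology T N) L"
  proof -
    have "compactin T (((\<lambda>x. inv x) ` K j) <#> C <#> K j)"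
      by (intro compactin_set_mult image_compactin[OF _ continuous_inv] K_compact C)
    then have "compactin T ((((\<lambda>x. inv x) ` K j) <#> C <#> K j) \<inter> N)"
      using closedin by (rule compact_Int_closedin)
    moreover have "compactin T {\<one>}" by (simp add: topspace_eq)
    ultimately have "compactin T L" unfolding L_def by (metis compactin_Un insert_is_Un)
    then show ?thesis using subgroup.one_closed[OF N_subgroup] by (auto simp: compactin_subtopology L_def)
  qed
  obtain p :: nat and Z where Z: "\<And>i. i < p \<Longrightarrow> Z i \<in> carrier (L2 \<nu>)"
    and Zap: "\<And>l. l \<in> L \<Longrightarrow> cmod (diag_coeff unit_rep 1 l - (\<Sum>i<p. diag_coeff (left_regular_rep (G\<lparr>carrier := N\<rparr>) \<nu>) (Z i) l)) < \<delta>"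
  proof -
    have "(1::complex) \<in> carrier (rep_space (unit_rep :: ('a, complex) representation))"
      by (simp add: unit_rep_def complex_line_def)
    from amen[unfolded weakly_contained_def rep_space_left_regular, rule_format, OF this L d] that
    show ?thesis by blast
  qed
  have "\<forall>i. \<exists>z. i < p \<longrightarrow> z \<in> square_integrable \<nu> \<and> Z i = L2_class \<nu> z" using Z by (metis L2_carrierE)
  then obtain z where z: "\<And>i. i < p \<Longrightarrow> z i \<in> square_integrable \<nu>" "\<And>i. i < p \<Longrightarrow> Z i = L2_class \<nu> (z i)" by metis
  define q where "q = (\<lambda>i l. \<integral>m. cnj (z i m) * z i (inv l \<otimes> m) \<partial>\<nu>)"
  have near: "cmod (1 - (\<Sum>i<p. q i l)) < \<delta>" if l: "l \<in> L" for l
  proof -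
    have lN: "l \<in> N" using compactin_subset_topspace[OF L] l topspace_N by blast
    have "diag_coeff unit_rep 1 l = 1" by (simp add: diag_coeff_def unit_rep_def complex_line_def)
    moreover have "diag_coeff (left_regular_rep (G\<lparr>carrier := N\<rparr>) \<nu>) (Z i) l = q i l" if "i < p" for i
      using N.diag_coeff_left_regular_rep[OF z(1)[OF that], of l] lN z(2)[OF that] by (simp add: inv_N q_def)
    ultimately show ?thesis using Zap[OF l] by simp
  qed
  have upper: "(\<Sum>i<p. (l2norm \<nu> (z i))\<^sup>2) \<le> 1 + \<delta>"
  proof -
    have "q i \<one> = complex_of_real ((l2norm \<nu> (z i))\<^sup>2)" if "i < p" for i
    proof -
      have "q i \<one> = (\<integral>m. cnj (z i m) * z i m \<partial>\<nu>)"
        unfolding q_def by (rule Bochner_Integration.integral_cong) (simp_all add: space_nu N_carrier)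
      then show ?thesis by (simp only: integral_cnj_mult_self l2norm_power2)
    qed
    then have "(\<Sum>i<p. q i \<one>) = complex_of_real (\<Sum>i<p. (l2norm \<nu> (z i))\<^sup>2)" by simp
    moreover have "cmod (1 - (\<Sum>i<p. q i \<one>)) < \<delta>" by (rule near) (simp add: L_def)
    ultimately have "cmod (complex_of_real (1 - (\<Sum>i<p. (l2norm \<nu> (z i))\<^sup>2))) < \<delta>" by simp
    then show ?thesis unfolding norm_of_real by linarith
  qed
  have lower: "1 - \<delta> \<le> (\<Sum>i<p. cmod (\<integral>m. cnj (z i m) * z i (inv (inv u \<otimes> g \<otimes> v) \<otimes> m) \<partial>\<nu>))"
    if "u \<in> U j" "v \<in> U j" "g \<in> C" "inv u \<otimes> g \<otimes> v \<in> N" for u v g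
  proof -
    have "inv u \<otimes> g \<otimes> v \<in> ((\<lambda>x. inv x) ` K j) <#> C <#> K j"
      using that(1-3) U_K unfolding set_mult_def by blast
    then have "inv u \<otimes> g \<otimes> v \<in> L" using that(4) by (simp add: L_def)
    from near[OF this] have "1 - \<delta> \<le> cmod (\<Sum>i<p. q i (inv u \<otimes> g \<otimes> v))"
      using norm_triangle_ineq2[of 1 "\<Sum>i<p. q i (inv u \<otimes> g \<otimes> v)"] by simp
    also have "\<dots> \<le> (\<Sum>i<p. cmod (q i (inv u \<otimes> g \<otimes> v)))" by (rule norm_sum)
    finally show ?thesis by (simp add: q_def)
  qed
  have ex: "\<exists>\<eta>. (\<forall>i<p. \<eta> i \<in> square_integrable \<mu>) \<and>
    (\<forall>g\<in>C. cmod ((\<integral>x. cnj (f x) * f (inv g \<otimes> x) \<partial>quot_measure)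
      - (\<Sum>i<p. \<integral>x. cnj (\<eta> i x) * \<eta> i (inv g \<otimes> x) \<partial>\<mu>)) \<le> \<delta> * (l2norm quot_measure f)\<^sup>2)"
    by (rule coefficient_approx[OF f supp z(1) d upper compactin_carrier[OF C] lower])
  obtain \<eta> where \<eta>: "\<And>i. i < p \<Longrightarrow> \<eta> i \<in> square_integrable \<mu>"
    and ap: "\<And>g. g \<in> C \<Longrightarrow> cmod ((\<integral>x. cnj (f x) * f (inv g \<otimes> x) \<partial>quot_measure)
        - (\<Sum>i<p. \<integral>x. cnj (\<eta> i x) * \<eta> i (inv g \<otimes> x) \<partial>\<mu>)) \<le> \<delta> * (l2norm quot_measure f)\<^sup>2"
    using ex by blast
  have "cmod (diag_coeff Q.left_regular_rep_total \<xi> g - (\<Sum>i<p. diag_coeff (left_regular_rep G \<mu>) (L2_class \<mu> (\<eta> i)) g)) < \<epsilon>"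
    if gC: "g \<in> C" for g
  proof -
    have g: "g \<in> carrier G" "inv g \<in> carrier G" using gC compactin_carrier[OF C] by auto
    let ?t = "\<lambda>k x. k (inv g \<otimes> x)" and ?r = "\<lambda>x. h x - f x"
    have r: "?r \<in> square_integrable quot_measure" by (rule square_integrable_diff[OF h(1) f])
    have t: "?t k \<in> square_integrable quot_measure" "l2norm quot_measure (?t k) = l2norm quot_measure k"
      if "k \<in> square_integrable quot_measure" for k
      using Q.square_integrable_translate[OF that g(2)] Q.l2norm_translate[OF square_integrableD(1)[OF that] g(2)] by auto
    have dh: "diag_coeff Q.left_regular_rep_total \<xi> g = (\<integral>x. cnj (h x) * ?t h x \<partial>quot_measure)"
      unfolding Q.diag_coeff_left_regular_rep_total h(2) by (rule Q.diag_coeff_left_regular_rep[OF h(1) g(1)])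
    have de: "diag_coeff (left_regular_rep G \<mu>) (L2_class \<mu> (\<eta> i)) g = (\<integral>x. cnj (\<eta> i x) * \<eta> i (inv g \<otimes> x) \<partial>\<mu>)" if "i < p" for i
      by (rule diag_coeff_left_regular_rep[OF \<eta>[OF that] g(1)])
    have "(\<integral>x. cnj (h x) * ?t h x \<partial>quot_measure) - (\<integral>x. cnj (f x) * ?t f x \<partial>quot_measure)
      = (\<integral>x. cnj (h x) * ?t h x - cnj (f x) * ?t f x \<partial>quot_measure)"
      using integrable_cnj_mult[OF h(1) t(1)[OF h(1)]] integrable_cnj_mult[OF f t(1)[OF f]] by simp
    \<comment> \<open>One factor is exchanged at a time, so each of the two terms contains the small
      difference h - f exactly once.\<close>
    also have "\<dots> = (\<integral>x. cnj (?r x) * ?t h x + cnj (f x) * ?t ?r x \<partial>quot_measure)"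
      by (rule Bochner_Integration.integral_cong) (simp_all add: algebra_simps)
    also have "\<dots> = (\<integral>x. cnj (?r x) * ?t h x \<partial>quot_measure) + (\<integral>x. cnj (f x) * ?t ?r x \<partial>quot_measure)"
      by (rule Bochner_Integration.integral_add[OF integrable_cnj_mult[OF r t(1)[OF h(1)]] integrable_cnj_mult[OF f t(1)[OF r]]])
    finally have "cmod ((\<integral>x. cnj (h x) * ?t h x \<partial>quot_measure) - (\<integral>x. cnj (f x) * ?t f x \<partial>quot_measure))
      \<le> cmod (\<integral>x. cnj (?r x) * ?t h x \<partial>quot_measure) + cmod (\<integral>x. cnj (f x) * ?t ?r x \<partial>quot_measure)"
      by (simp only: norm_triangle_ineq)
    also have "\<dots> \<le> l2norm quot_measure ?r * D + D * l2norm quot_measure ?r"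
    proof (rule add_mono)
      show "cmod (\<integral>x. cnj (?r x) * ?t h x \<partial>quot_measure) \<le> l2norm quot_measure ?r * D"
        using norm_integral_cnj_mult_le[OF r t(1)[OF h(1)]] by (simp only: t(2)[OF h(1)] D_def)
      have "cmod (\<integral>x. cnj (f x) * ?t ?r x \<partial>quot_measure) \<le> l2norm quot_measure f * l2norm quot_measure ?r"
        using norm_integral_cnj_mult_le[OF f t(1)[OF r]] by (simp only: t(2)[OF r])
      also have "\<dots> \<le> D * l2norm quot_measure ?r" by (intro mult_right_mono fD l2norm_nonneg)
      finally show "cmod (\<integral>x. cnj (f x) * ?t ?r x \<partial>quot_measure) \<le> D * l2norm quot_measure ?r" .
    qed
    also have "\<dots> = 2 * D * l2norm quot_measure ?r" by simp
    also have "\<dots> \<le> 2 * D * (\<epsilon> / (4 * D + 1))"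
      using j D by (intro mult_left_mono) (simp_all add: f_def)
    also have "\<dots> < \<epsilon> / 2" using e D by (simp add: field_simps)
    finally have 1: "cmod ((\<integral>x. cnj (h x) * ?t h x \<partial>quot_measure) - (\<integral>x. cnj (f x) * ?t f x \<partial>quot_measure)) < \<epsilon> / 2" .
    have "\<delta> * (l2norm quot_measure f)\<^sup>2 \<le> \<delta> * D\<^sup>2"
      using d fD l2norm_nonneg by (intro mult_left_mono power_mono) auto
    also have "\<dots> < \<epsilon> / 2"
    proof -
      have "2 * D\<^sup>2 + 1 > 0" by (simp add: add_nonneg_pos)
      then show ?thesis using e by (simp add: \<delta>_def divide_less_eq)
    qed
    finally have 2: "cmod ((\<integral>x. cnj (f x) * ?t f x \<partial>quot_measure) - (\<Sum>i<p. \<integral>x. cnj (\<eta> i x) * \<eta> i (inv g \<otimes> x) \<partial>\<mu>)) < \<epsilon> / 2"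
      using ap[OF gC] by linarith
    have "(\<Sum>i<p. diag_coeff (left_regular_rep G \<mu>) (L2_class \<mu> (\<eta> i)) g) = (\<Sum>i<p. \<integral>x. cnj (\<eta> i x) * \<eta> i (inv g \<otimes> x) \<partial>\<mu>)"
      using de by simp
    then show ?thesis unfolding dh using norm_diff_triangle_less[OF 1 2] by simp
  qed
  then have "(\<forall>i<p. L2_class \<mu> (\<eta> i) \<in> carrier (rep_space (left_regular_rep G \<mu>))) \<and>
      (\<forall>g\<in>C. cmod (diag_coeff Q.left_regular_rep_total \<xi> g
        - (\<Sum>i<p. diag_coeff (left_regular_rep G \<mu>) (L2_class \<mu> (\<eta> i)) g)) < \<epsilon>)"
    using \<eta> by (simp add: L2_class_in_carrier)
  then have "\<exists>\<eta>. (\<forall>i<p. \<eta> i \<in> carrier (rep_space (left_regular_rep G \<mu>))) \<and>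
      (\<forall>g\<in>C. cmod (diag_coeff Q.left_regular_rep_total \<xi> g
        - (\<Sum>i<p. diag_coeff (left_regular_rep G \<mu>) (\<eta> i) g)) < \<epsilon>)"
    by (rule exI[where x="\<lambda>i. L2_class \<mu> (\<eta> i)"])
  then show "\<exists>(n::nat) \<eta>. (\<forall>i<n. \<eta> i \<in> carrier (rep_space (left_regular_rep G \<mu>))) \<and>
      (\<forall>g\<in>C. cmod (diag_coeff Q.left_regular_rep_total \<xi> g - (\<Sum>i<n. diag_coeff (left_regular_rep G \<mu>) (\<eta> i) g)) < \<epsilon>)"
    by (rule exI[where x=p])
qed

section \<open>The reverse containment fails\<close>

text \<open>Since n^{-1}x = x (x^{-1}n^{-1}x) and N is normal, left translation by n moves points
  within their cosets, where f is constant.\<close>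

lemma diag_coeff_quot_N:
  assumes \<xi>: "\<xi> \<in> carrier (L2 quot_measure)" and n: "n \<in> N"
  shows "diag_coeff Q.left_regular_rep_total \<xi> n = diag_coeff Q.left_regular_rep_total \<xi> \<one>"
proof -
  obtain f where f: "f \<in> square_integrable quot_measure" "\<xi> = L2_class quot_measure f" using \<xi> by (rule L2_carrierE)
  have fq: "f \<in> borel_measurable quot_alg" using square_integrableD(1)[OF f(1)] by (simp add: measurable_Q)
  have "f (inv n \<otimes> x) = f (inv \<one> \<otimes> x)" if x: "x \<in> carrier G" for x
  proof -
    have "inv n \<otimes> x = x \<otimes> (inv x \<otimes> inv n \<otimes> x)" using x n N_carrier by (simp add: m_assoc[symmetric])
    then show ?thesis using quot_alg_invariant[OF fq x N_conj[OF x N_inv[OF n]]] x by simp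
  qed
  then have "(\<integral>x. cnj (f x) * f (inv n \<otimes> x) \<partial>quot_measure) = (\<integral>x. cnj (f x) * f (inv \<one> \<otimes> x) \<partial>quot_measure)"
    by (intro Bochner_Integration.integral_cong) (simp_all add: space_quot_measure)
  then show ?thesis
    unfolding Q.diag_coeff_left_regular_rep_total f(2)
    using Q.diag_coeff_left_regular_rep[OF f(1)] n N_carrier by simp
qed

text \<open>For n \<noteq> 1 in N, the indicator of a small neighbourhood V of the identity has
  coefficient \<mu> V at 1 and 0 at n, whereas coefficients on the quotient agree at 1 and n. On the
  compact set {1, n} no sum of the latter is within \<mu> V / 2 of the former.\<close>

lemma not_weakly_contained_quot:
  assumes N: "N \<noteq> {\<one>}"
  shows "\<not> weakly_contained T (left_regular_rep G \<mu>) Q.left_regular_rep_total"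
proof
  assume wc: "weakly_contained T (left_regular_rep G \<mu>) Q.left_regular_rep_total"
  obtain n where n: "n \<in> N" "n \<noteq> \<one>" using N subgroup.one_closed[OF N_subgroup] by blast
  then have nG: "n \<in> carrier G" using N_carrier by blast
  obtain A B where AB: "openin T A" "openin T B" "\<one> \<in> A" "n \<in> B" "disjnt A B"
    using Hausdorff n nG topspace_eq one_closed unfolding Hausdorff_space_def by metis
  obtain j where j: "\<one> \<in> U j" using U_cover one_closed by blast
  \<comment> \<open>V lies in A and n V in the disjoint set B, so V and n V do not meet; the factor
    \<open>U j\<close> makes the measure of V finite.\<close>
  define V where "V = A \<inter> {x \<in> carrier G. n \<otimes> x \<in> B} \<inter> U j"
  have V: "openin T V" unfolding V_def by (intro openin_Int AB openin_vimage_left nG U_open)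
  have V1: "\<one> \<in> V" using AB j nG by (simp add: V_def)
  have Vs: "V \<in> sets \<mu>" by (rule openin_sets_haar[OF V])
  have Vpos: "emeasure \<mu> V > 0" using emeasure_open_pos[OF V] V1 by blast
  have Vfin: "emeasure \<mu> V < \<infinity>"
    by (rule emeasure_subset_compact[OF _ K_compact[of j]]) (use U_K in \<open>auto simp: V_def\<close>)
  have VG: "V \<subseteq> carrier G" by (rule openin_carrier[OF V])
  define f where "f = (\<lambda>x. complex_of_real (indicator V x))"
  have eq: "(cmod (f x))\<^sup>2 = indicator V x" for x by (simp add: f_def indicator_def)
  have int: "integrable \<mu> (indicator V :: 'a \<Rightarrow> real)" using Vs Vfin by simp
  have f: "f \<in> square_integrable \<mu>"
    by (rule square_integrableI) (use Vs int in \<open>simp_all only: eq, simp add: f_def\<close>)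
  have d1: "diag_coeff (left_regular_rep G \<mu>) (L2_class \<mu> f) \<one> = complex_of_real (measure \<mu> V)"
  proof -
    have "diag_coeff (left_regular_rep G \<mu>) (L2_class \<mu> f) \<one> = (\<integral>x. cnj (f x) * f x \<partial>\<mu>)"
      unfolding diag_coeff_left_regular_rep[OF f one_closed]
      by (rule Bochner_Integration.integral_cong) (simp_all add: space_haar)
    also have "\<dots> = complex_of_real (measure \<mu> V)"
      unfolding integral_cnj_mult_self eq using VG by (simp add: space_haar Int_absorb2)
    finally show ?thesis .
  qed
  have dn: "diag_coeff (left_regular_rep G \<mu>) (L2_class \<mu> f) n = 0"
  proof -
    have "cnj (f x) * f (inv n \<otimes> x) = 0" if x: "x \<in> carrier G" for x
    proof -
      have "x \<notin> V" if y: "inv n \<otimes> x \<in> V"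
      proof -
        have "n \<otimes> (inv n \<otimes> x) \<in> B" using y by (simp add: V_def)
        then have "x \<in> B" using x nG by (simp add: m_assoc[symmetric])
        then show ?thesis using AB(5) by (auto simp: V_def disjnt_def)
      qed
      then show ?thesis by (auto simp: f_def indicator_def)
    qed
    then have "(\<integral>x. cnj (f x) * f (inv n \<otimes> x) \<partial>\<mu>) = (\<integral>x. 0 \<partial>\<mu>)"
      by (intro Bochner_Integration.integral_cong) (simp_all add: space_haar)
    then show ?thesis by (simp add: diag_coeff_left_regular_rep[OF f nG])
  qed
  have mpos: "measure \<mu> V > 0" using Vpos Vfin by (simp add: emeasure_eq_ennreal_measure)
  have c: "compactin T {\<one>, n}" using nG by (intro finite_imp_compactin) (auto simp: topspace_eq)
  have "L2_class \<mu> f \<in> carrier (rep_space (left_regular_rep G \<mu>))" using L2_class_in_carrier[OF f] by simp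
  then obtain p :: nat and \<eta> where \<eta>: "\<And>i. i < p \<Longrightarrow> \<eta> i \<in> carrier (rep_space Q.left_regular_rep_total)"
    and ap: "\<And>g. g \<in> {\<one>, n} \<Longrightarrow> cmod (diag_coeff (left_regular_rep G \<mu>) (L2_class \<mu> f) g
      - (\<Sum>i<p. diag_coeff Q.left_regular_rep_total (\<eta> i) g)) < measure \<mu> V / 2"
    using wc[unfolded weakly_contained_def, rule_format, OF _ c half_gt_zero[OF mpos]] by blast
  define t where "t = (\<Sum>i<p. diag_coeff Q.left_regular_rep_total (\<eta> i) \<one>)"
  have "(\<Sum>i<p. diag_coeff Q.left_regular_rep_total (\<eta> i) n) = t"
    unfolding t_def using \<eta> diag_coeff_quot_N[OF _ n(1)] by (intro sum.cong) (simp_all add: Q.left_regular_rep_total_def)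
  then have "cmod (0 - t) < measure \<mu> V / 2" using ap[of n] dn by simp
  moreover have "cmod (complex_of_real (measure \<mu> V) - t) < measure \<mu> V / 2" using ap[of \<one>] d1 by (simp add: t_def)
  ultimately have "cmod (complex_of_real (measure \<mu> V) - 0) < measure \<mu> V"
    using norm_diff_triangle_less[of "complex_of_real (measure \<mu> V)" t "measure \<mu> V / 2" 0 "measure \<mu> V / 2"]
    by (simp add: norm_minus_commute)
  then show False using mpos by simp
qed

end

theorem proposition3:
  fixes G :: "('a, 'b) monoid_scheme" and T :: "'a topology" and N :: "'a set"
  assumes "locally_compact_group G T"
    and "second_countable T"
    and "N \<lhd> G"
    and "closedin T N"
    and "amenable (G\<lparr>carrier := N\<rparr>) (subtopology T N)"
    and "N \<noteq> {\<one>\<^bsub>G\<^esub>}"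
  shows "\<not> Cstar_simple G T"
proof
  assume "Cstar_simple G T"
  then obtain \<mu> where \<mu>: "left_haar_measure G T \<mu>"
    and simple: "\<And>\<rho> :: ('a, ('a \<Rightarrow> complex) set) representation. unitary_rep G T \<rho> \<Longrightarrow>
      weakly_contained T \<rho> (left_regular_rep G \<mu>) \<longleftrightarrow> weakly_equivalent T \<rho> (left_regular_rep G \<mu>)"
    unfolding Cstar_simple_def by blast
  obtain \<nu> where \<nu>: "left_haar_measure (G\<lparr>carrier := N\<rparr>) (subtopology T N) \<nu>"
    and amen: "weakly_contained (subtopology T N) unit_rep (left_regular_rep (G\<lparr>carrier := N\<rparr>) \<nu>)"
    using assms(5) unfolding amenable_def by blast
  interpret haar_pair G T \<mu> N \<nu>
    by (intro haar_pair.intro haar_group.intro sc_group.intro sc_group_axioms.intro haar_group_axioms.intro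
        haar_pair_axioms.intro assms(1-4) \<mu> \<nu>)
  obtain \<beta> U K where *: "\<beta> \<in> borel_measurable BG" "\<And>x. x \<in> carrier G \<Longrightarrow> \<beta> x < \<infinity>"
    "\<And>x. x \<in> carrier G \<Longrightarrow> (\<integral>\<^sup>+n. \<beta> (x \<otimes>\<^bsub>G\<^esub> n) \<partial>\<nu>) = 1"
    "\<And>j. openin T (U j)" "\<And>j. U j \<subseteq> K j" "\<And>j. compactin T (K j)" "incseq U" "(\<Union>j. U j) = carrier G"
    "\<And>x n j. x \<in> carrier G \<Longrightarrow> n \<in> N \<Longrightarrow> x \<otimes>\<^bsub>G\<^esub> n \<in> U j \<Longrightarrow> \<beta> x \<noteq> 0 \<Longrightarrow> x \<in> U j"
    using Bruhat_function by metis
  interpret Bruhat G T \<mu> N \<nu> \<beta> U K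
    by unfold_locales (fact *)+
  \<comment> \<open>Vectors on the quotient are classes of functions on G, so the representation has
    the type required by \<open>simple\<close>, which upgrades its weak containment to weak
    equivalence.\<close>
  have "weakly_contained T (left_regular_rep G \<mu>) Q.left_regular_rep_total"
    using simple[OF unitary_rep_quot] weakly_contained_quot[OF amen] unfolding weakly_equivalent_def by blast
  then show False using not_weakly_contained_quot[OF assms(6)] by blast
qed

end
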